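(* Let $\Sigma_0,\Sigma_1\in\mathbb S_\succ^d$, $p>d+3$, let $\mu_i=\mathcal{IW}_d(\Sigma_i,p)$ be inverse-Wishart distributions, $i=0,1$, and let $c(X,Y)=\|X-Y\|_{\mathrm F}^2$. Set $m=p-d$ and $C=(\Sigma_0^{1/2}\Sigma_1\Sigma_0^{1/2})^{1/2}$. Then: (a) the unique optimal Monge map from $\mu_0$ to $\mu_1$ is $T^\star(X)=A^\star XA^\star$, where $A^\star=\Sigma_0^{-1/2}(\Sigma_0^{1/2}\Sigma_1\Sigma_0^{1/2})^{1/2}\Sigma_0^{-1/2}$; (b) $(\mathrm{id}_{\mathbb S_\succ^d},T^\star)_\#\mu_0$ is the unique optimal Kantorovich plan; (c) $$\mathds K_c(\mu_0,\mu_1)=\frac1{m(m-3)}\|\Sigma_0-\Sigma_1\|_{\mathrm F}^2+\frac1{m(m-1)(m-3)}\bigl((\mathrm{Tr}\,\Sigma_0)^2+(\mathrm{Tr}\,\Sigma_1)^2-2(\mathrm{Tr}\,C)^2\bigr);$$ (d) $\mathds M_c(\mu_0,\mu_1)=\mathds K_c(\mu_0,\mu_1)$.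
   Context: $\mathbb S_\succ^d$ is the cone of real symmetric positive definite $d\times d$ matrices ($d\ge1$); $\|\cdot\|_{\mathrm F}$ is the Frobenius norm; square roots are the positive definite ones; $T_\#\mu(B)=\mu(T^{-1}(B))$. For $\Psi\in\mathbb S_\succ^d$ and real $p>d-1$, the inverse-Wishart distribution $\mathcal{IW}_d(\Psi,p)$ is the probability law on $\mathbb S_\succ^d$ with density $$X\mapsto\frac{\det(\Psi)^{p/2}}{2^{pd/2}\mathsf\Gamma_d(p/2)}\det(X)^{-(p+d+1)/2}\exp\bigl(-\tfrac12\mathrm{Tr}(\Psi X^{-1})\bigr)$$ with respect to $\prod_{1\le i\le j\le d}dX_{ij}$, where $\mathsf\Gamma_d(a)=\pi^{d(d-1)/4}\prod_{j=1}^d\Gamma(a-\frac{j-1}2)$. With $\mathcal X=\mathbb S_\succ^d$: $\mathds M_c(\mu_0,\mu_1)=\inf_T\int c(X,T(X))\,d\mu_0(X)$ over Borel $T:\mathcal X\to\mathcal X$ with $T_\#\mu_0=\mu_1$ (a minimizer is an optimal Monge map; uniqueness is up to $\mu_0$-a.e. equality); $\mathds K_c(\mu_0,\mu_1)=\inf_\Gamma\int c\,d\Gamma$ over probability measures $\Gamma$ on $\mathcal X\times\mathcal X$ with marginals $\mu_0,\mu_1$ (a minimizer is an optimal Kantorovich plan). *)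

theory Defs
  imports "HOL-Probability.Probability"
begin

section \<open>Positive definite matrices\<close>

definition spd :: "(real^'n^'n) set" where
  "spd = {A. transpose A = A \<and> (\<forall>x. x \<noteq> 0 \<longrightarrow> x \<bullet> (A *v x) > 0)}"

text \<open>Only meaningful for \<open>A \<in> spd\<close>, which has exactly one positive definite square root.\<close>

definition spd_sqrt :: "real^'n^'n \<Rightarrow> real^'n^'n" where
  "spd_sqrt A = (THE B. B \<in> spd \<and> B ** B = A)"

section \<open>Inverse-Wishart distributions\<close>

text \<open>
  The order on the index type serves to select the free coordinates \<open>X $ i $ j\<close>, \<open>i \<le> j\<close>, of a
  symmetric matrix. \<open>sym_lborel\<close> is the product of the Lebesgue measures \<open>dX\<^sub>i\<^sub>j\<close> over these
  coordinates, carried by the symmetric matrices inside the space of all matrices.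
\<close>

definition sym_of_upper :: "('n::{finite,linorder} \<times> 'n \<Rightarrow> real) \<Rightarrow> real^'n::_^'n::_" where
  "sym_of_upper x = (\<chi> i j. if i \<le> j then x (i, j) else x (j, i))"

definition sym_lborel :: "(real^'n::{finite,linorder}^'n::_) measure" where
  "sym_lborel = distr (PiM {(i, j). i \<le> j} (\<lambda>_. lborel)) borel sym_of_upper"

definition multivariate_Gamma :: "nat \<Rightarrow> real \<Rightarrow> real" where
  "multivariate_Gamma d a =
     pi powr (real d * (real d - 1) / 4) * (\<Prod>j=1..d. Gamma (a - (real j - 1) / 2))"

definition inverse_wishart_density :: "real^'n^'n \<Rightarrow> real \<Rightarrow> real^'n^'n \<Rightarrow> real" where
  "inverse_wishart_density \<Psi> p X =
     (let d = real CARD('n) in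
      det \<Psi> powr (p / 2) / (2 powr (p * d / 2) * multivariate_Gamma CARD('n) (p / 2))
      * det X powr (- (p + d + 1) / 2)
      * exp (- (1 / 2) * trace (\<Psi> ** matrix_inv X)))"

text \<open>
  The underlying measurable space is \<open>spd\<close> with its Borel sets. The intended parameters are
  \<open>\<Psi> \<in> spd\<close> and \<open>p > CARD('n) - 1\<close>.
\<close>

definition inverse_wishart ::
    "real^'n::{finite,linorder}^'n::_ \<Rightarrow> real \<Rightarrow> (real^'n::_^'n::_) measure" where
  "inverse_wishart \<Psi> p =
     density (restrict_space sym_lborel spd) (\<lambda>X. ennreal (inverse_wishart_density \<Psi> p X))"

section \<open>Optimal transport\<close>

text \<open>
  Costs and integrals take values in \<open>ennreal\<close>, so the infimum over an empty set is \<open>\<infinity>\<close>.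
\<close>

definition transport_maps :: "'a measure \<Rightarrow> 'b measure \<Rightarrow> ('a \<Rightarrow> 'b) set" where
  "transport_maps M N = {T \<in> M \<rightarrow>\<^sub>M N. distr M N T = N}"

definition monge_cost :: "('a \<Rightarrow> 'b \<Rightarrow> ennreal) \<Rightarrow> 'a measure \<Rightarrow> 'b measure \<Rightarrow> ennreal" where
  "monge_cost c M N = (INF T\<in>transport_maps M N. \<integral>\<^sup>+ x. c x (T x) \<partial>M)"

definition optimal_monge_map ::
    "('a \<Rightarrow> 'b \<Rightarrow> ennreal) \<Rightarrow> 'a measure \<Rightarrow> 'b measure \<Rightarrow> ('a \<Rightarrow> 'b) \<Rightarrow> bool" where
  "optimal_monge_map c M N T \<longleftrightarrow>
     T \<in> transport_maps M N \<and> (\<integral>\<^sup>+ x. c x (T x) \<partial>M) = monge_cost c M N"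

text \<open>
  On second countable spaces the product \<open>\<sigma>\<close>-algebra used here is the Borel \<open>\<sigma>\<close>-algebra of the
  product topology.
\<close>

definition couplings :: "'a measure \<Rightarrow> 'b measure \<Rightarrow> ('a \<times> 'b) measure set" where
  "couplings M N = {G. sets G = sets (M \<Otimes>\<^sub>M N) \<and> prob_space G \<and>
     distr G M fst = M \<and> distr G N snd = N}"

definition kantorovich_cost :: "('a \<Rightarrow> 'b \<Rightarrow> ennreal) \<Rightarrow> 'a measure \<Rightarrow> 'b measure \<Rightarrow> ennreal" where
  "kantorovich_cost c M N = (INF G\<in>couplings M N. \<integral>\<^sup>+ z. c (fst z) (snd z) \<partial>G)"

definition optimal_kantorovich_plan ::
    "('a \<Rightarrow> 'b \<Rightarrow> ennreal) \<Rightarrow> 'a measure \<Rightarrow> 'b measure \<Rightarrow> ('a \<times> 'b) measure \<Rightarrow> bool" where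
  "optimal_kantorovich_plan c M N G \<longleftrightarrow>
     G \<in> couplings M N \<and> (\<integral>\<^sup>+ z. c (fst z) (snd z) \<partial>G) = kantorovich_cost c M N"

text \<open>
  The norm of the type \<open>real^'n^'n\<close> is the Euclidean norm of the matrix entries, i.e. the
  Frobenius norm.
\<close>

definition frobenius_cost :: "real^'n^'n \<Rightarrow> real^'n^'n \<Rightarrow> ennreal" where
  "frobenius_cost X Y = ennreal ((norm (X - Y))\<^sup>2)"

end

theory Submission
  imports Defs
begin

text \<open>
  Write \<open>B\<close> for the positive definite square root of \<open>A\<close>. Since \<open>B\<close> is symmetric, the inner product of
  \<open>B X B\<close> and \<open>B\<inverse> Y B\<inverse>\<close> is that of \<open>X\<close> and \<open>Y\<close>, whence
    \<open>\<bar>X - Y\<bar>\<^sup>2 + \<bar>B X B\<bar>\<^sup>2 + \<bar>B\<inverse> Y B\<inverse>\<bar>\<^sup>2 = \<bar>X\<bar>\<^sup>2 + \<bar>Y\<bar>\<^sup>2 + \<bar>B X B - B\<inverse> Y B\<inverse>\<bar>\<^sup>2\<close>.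
  Integrated against a coupling, all terms but the first and the last depend on the marginals alone. The
  last one is nonnegative and vanishes exactly where \<open>Y = A X A\<close>. So the cost of a coupling is a constant
  plus a nonnegative remainder that singles out the graph of \<open>T\<close>; this gives optimality and both
  uniqueness claims at once (\<open>transport_by_cost_splitting\<close>). The map \<open>T\<close> transports \<open>\<mu>0\<close> to \<open>\<mu>1\<close> because
  the family is covariant under congruences (\<open>distr_inverse_wishart_congruence\<close>) and
  \<open>A \<Sigma>0 A = \<Sigma>1\<close>. The constant is \<open>q \<Sigma>0 + q \<Sigma>1 - 2 q (B \<Sigma>0 B)\<close>, where \<open>q \<Psi>\<close> is the second moment
  of the law with scale matrix \<open>\<Psi>\<close> (\<open>inverse_wishart_second_moment\<close>), and it takes the stated form
  because \<open>\<bar>B \<Sigma>0 B\<bar>\<^sup>2\<close> is the inner product of \<open>\<Sigma>0\<close> and \<open>\<Sigma>1\<close> and the trace of \<open>B \<Sigma>0 B\<close> is that of \<open>C\<close>.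

  Covariance needs the Jacobian of \<open>X \<mapsto> B X B\<^sup>T\<close> on symmetric matrices. A translation-invariant measure
  on a space of coordinates is unique up to a factor, so a linear automorphism scales it by a number that is
  multiplicative in the automorphism. For positive definite \<open>B\<close> the spectral theorem then reduces the
  computation to a diagonal matrix. For orthogonal \<open>B\<close> no computation is needed: the standard law is
  mapped to a multiple of itself, and both have mass one. The polar decomposition covers all invertible \<open>B\<close>.

  The mass and the entry moments of the standard law come from eliminating one index at a time. If
  a block \<open>S\<close> is bordered by the column \<open>S w\<close> and the corner \<open>y + w \<bullet> S w\<close>, then the kernel of the
  larger block, multiplied by the Jacobian \<open>det S\<close>, is the kernel of \<open>S\<close> with \<open>p\<close> lowered by one, times an
  inverse-gamma kernel in \<open>y\<close>, times a Gaussian in \<open>w\<close> (\<open>nn_integral_bordered\<close>). Iteration gives the normalising constant. It also shows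
  that principal blocks are again inverse-Wishart, so that the second moments of the entries are
  computed in blocks of size one and two.
\<close>

text \<open>Unlike \<open>real^'n^'n\<close>, this notation leaves the sort of the index type to the context.\<close>

type_synonym 'n square = "((real, 'n) vec, 'n) vec"

section \<open>Symmetric and positive definite matrices\<close>

definition diag :: "('n \<Rightarrow> real) \<Rightarrow> real^'n^'n" where
  "diag d = (\<chi> i j. if i = j then d i else 0)"

lemma diag_mult: "diag c ** diag d = diag (\<lambda>i. c i * d i)"
  by (auto simp: diag_def matrix_matrix_mult_def vec_eq_iff if_distrib[of "\<lambda>y. y * _"] cong: if_cong)

lemma det_diag: "det (diag d) = (\<Prod>i\<in>UNIV. d i)"
  by (subst det_diagonal) (auto simp: diag_def)

lemma transpose_diag [simp]: "transpose (diag d) = diag d"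
  by (simp add: diag_def transpose_def vec_eq_iff)

lemma diag_mult_vec: "diag d *v x = (\<chi> i. d i * x $ i)"
  by (simp add: diag_def matrix_vector_mult_def vec_eq_iff if_distrib[of "\<lambda>y. y * _"] cong: if_cong)

lemma inner_symmetric_matrix:
  fixes S :: "real^'n^'n"
  assumes "transpose S = S"
  shows "x \<bullet> (S *v y) = (S *v x) \<bullet> y"
  using assms by (metis dot_lmul_matrix vector_transpose_matrix)

lemma inner_matrix_eq_trace:
  fixes A B :: "real^'n^'n"
  shows "A \<bullet> B = trace (transpose A ** B)"
  by (simp add: inner_vec_def trace_def matrix_matrix_mult_def transpose_def)
     (subst sum.swap, simp)

lemma matrix_add_rdistrib': "((A :: real^'n^'n) + B) ** C = A ** C + B ** C"
  by (simp add: matrix_matrix_mult_def vec_eq_iff sum.distrib algebra_simps)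

lemma matrix_sub_rdistrib': "((A :: real^'n^'n) - B) ** C = A ** C - B ** C"
  by (simp add: matrix_matrix_mult_def vec_eq_iff sum_subtractf algebra_simps)

lemma matrix_sub_ldistrib': "(C :: real^'n^'n) ** (A - B) = C ** A - C ** B"
  by (simp add: matrix_matrix_mult_def vec_eq_iff sum_subtractf algebra_simps)

lemma matrix_inv_unique:
  fixes A B :: "real^'n^'n"
  assumes "A ** B = mat 1"
  shows "matrix_inv A = B"
proof -
  have "B ** A = mat 1" using assms matrix_left_right_inverse by blast
  then have "\<exists>C. A ** C = mat 1 \<and> C ** A = mat 1" using assms by blast
  then have "A ** matrix_inv A = mat 1 \<and> matrix_inv A ** A = mat 1"
    unfolding matrix_inv_def by (rule someI_ex)
  then show ?thesis
    by (metis assms matrix_mul_assoc matrix_mul_lid matrix_mul_rid)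
qed

lemma matrix_inv_mult:
  fixes A :: "real^'n^'n"
  assumes "invertible A"
  shows "A ** matrix_inv A = mat 1" "matrix_inv A ** A = mat 1"
proof -
  obtain B where "A ** B = mat 1" "B ** A = mat 1" using assms invertible_def by blast
  then show "A ** matrix_inv A = mat 1" "matrix_inv A ** A = mat 1"
    using matrix_inv_unique by auto
qed

text \<open>
  A maximiser \<open>x\<close> of the quadratic form on the unit sphere of \<open>W\<close>, with maximum \<open>l\<close>, makes
  \<open>l * (y \<bullet> y) - y \<bullet> S y\<close> a nonnegative form that vanishes at \<open>x\<close>; hence \<open>x\<close> lies in its kernel.
\<close>

lemma symmetric_eigenvector_in_invariant_subspace:
  fixes S :: "real^'n^'n"
  assumes sym: "transpose S = S" and W: "subspace W" and inv: "\<And>x. x \<in> W \<Longrightarrow> S *v x \<in> W"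
    and nz: "W \<noteq> {0}"
  shows "\<exists>x\<in>W. norm x = 1 \<and> (\<exists>l. S *v x = l *\<^sub>R x)"
proof -
  let ?K = "W \<inter> sphere 0 1"
  obtain w where w: "w \<in> W" "w \<noteq> 0" using nz subspace_0[OF W] by blast
  then have "w /\<^sub>R norm w \<in> ?K" using W by (simp add: subspace_scale)
  moreover have "compact ?K"
    by (simp add: closed_Int_compact W closed_subspace)
  moreover have "continuous_on ?K (\<lambda>x. x \<bullet> (S *v x))"
    by (intro continuous_intros)
  ultimately obtain x where x: "x \<in> ?K" and max: "\<And>y. y \<in> ?K \<Longrightarrow> y \<bullet> (S *v y) \<le> x \<bullet> (S *v x)"
    using continuous_attains_sup[of ?K "\<lambda>x. x \<bullet> (S *v x)"] by blast
  define l where "l = x \<bullet> (S *v x)"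
  have xx: "x \<bullet> x = 1" and xW: "x \<in> W" using x by (auto simp: norm_eq_1)
  have nonneg: "0 \<le> l * (y \<bullet> y) - y \<bullet> (S *v y)" if "y \<in> W" for y
  proof (cases "y = 0")
    case False
    then have "y /\<^sub>R norm y \<in> ?K" using W that by (simp add: subspace_scale)
    from max[OF this] have "(y \<bullet> (S *v y)) / (norm y)^2 \<le> l"
      by (simp add: l_def matrix_vector_mult_scaleR power2_eq_square divide_inverse mult_ac)
    then show ?thesis using False by (simp add: field_simps power2_norm_eq_inner)
  qed simp
  have orth: "y \<bullet> (l *\<^sub>R x - S *v x) = 0" if y: "y \<in> W" for y
  proof -
    define a b where "a = y \<bullet> (l *\<^sub>R x - S *v x)" and "b = l * (y \<bullet> y) - y \<bullet> (S *v y)"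
    have *: "0 \<le> 2 * t * a + t^2 * b" for t
    proof -
      have "x + t *\<^sub>R y \<in> W" using W xW y by (simp add: subspace_add subspace_scale)
      from nonneg[OF this] show ?thesis
        using inner_symmetric_matrix[OF sym, of x y]
        by (simp add: a_def b_def l_def[symmetric] matrix_vector_right_distrib matrix_vector_mult_scaleR
            inner_simps xx power2_eq_square algebra_simps inner_commute)
    qed
    have "a = 0"
    proof (rule ccontr)
      assume "a \<noteq> 0"
      have b0: "b \<ge> 0" using nonneg[OF y] b_def by simp
      \<comment> \<open>the choice \<open>t = - a / (b + 1)\<close> makes the linear term win over the quadratic one\<close>
      have "0 \<le> 2 * (- a / (b + 1)) * a + (- a / (b + 1))^2 * b" by (rule *)
      also have "\<dots> = - (a^2) * (b + 2) / (b + 1)^2"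
        using b0 by (simp add: field_simps power2_eq_square add_nonneg_eq_0_iff)
      also have "\<dots> < 0" using b0 \<open>a \<noteq> 0\<close> by (simp add: divide_neg_pos mult_neg_pos)
      finally show False by simp
    qed
    then show ?thesis by (simp add: a_def)
  qed
  have "l *\<^sub>R x - S *v x \<in> W" using W xW inv by (simp add: subspace_diff subspace_scale)
  from orth[OF this] have "S *v x = l *\<^sub>R x" by simp
  then show ?thesis using x by auto
qed

text \<open>
  Among the orthonormal sets of eigenvectors take one of greatest size. Its orthogonal complement is
  invariant, so a nonzero complement would contain a further eigenvector.
\<close>

theorem symmetric_matrix_diagonalization:
  fixes S :: "real^'n^'n"
  assumes sym: "transpose S = S"
  obtains U d where "orthogonal_matrix U" "S = U ** diag d ** transpose U"
proof -
  define good where "good B \<longleftrightarrow> pairwise orthogonal B \<and> (\<forall>x\<in>B. norm x = 1 \<and> (\<exists>l. S *v x = l *\<^sub>R x))"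
    for B :: "(real^'n) set"
  have bound: "finite B \<and> card B \<le> CARD('n)" if "good B" for B
  proof -
    have "independent B"
      using that pairwise_orthogonal_independent[of B] by (force simp: good_def)
    then show ?thesis using independent_bound[of B] by simp
  qed
  have "good {}" by (simp add: good_def)
  have "\<exists>B. good B \<and> (\<forall>C. good C \<longrightarrow> card C \<le> card B)"
    using ex_has_greatest_nat[of good "{}" card "Suc CARD('n)"] \<open>good {}\<close> bound
    by (auto simp: less_Suc_eq_le)
  then obtain B where B: "good B" and Bmax: "\<And>C. good C \<Longrightarrow> card C \<le> card B" by blast
  define W where "W = {x. \<forall>b\<in>B. b \<bullet> x = 0}"
  have W: "subspace W" by (auto simp: W_def subspace_def inner_simps)
  have "S *v x \<in> W" if "x \<in> W" for x
  proof -
    have "b \<bullet> (S *v x) = 0" if "b \<in> B" for b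
    proof -
      obtain l where "S *v b = l *\<^sub>R b" using B \<open>b \<in> B\<close> by (auto simp: good_def)
      then show ?thesis using inner_symmetric_matrix[OF sym, of b x] \<open>x \<in> W\<close> \<open>b \<in> B\<close> by (simp add: W_def)
    qed
    then show ?thesis by (simp add: W_def)
  qed
  note eig = symmetric_eigenvector_in_invariant_subspace[OF sym W this]
  have "W = {0}"
  proof (rule ccontr)
    assume "W \<noteq> {0}"
    from eig[OF _ this] obtain x l where x: "x \<in> W" "norm x = 1" "S *v x = l *\<^sub>R x" by blast
    have "x \<notin> B" using x by (auto simp: W_def norm_eq_1)
    moreover have "good (insert x B)"
      using B x by (auto simp: good_def pairwise_insert orthogonal_def W_def inner_commute)
    ultimately show False using Bmax[of "insert x B"] bound[OF B] by simp
  qed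
  have ind: "independent B"
    using B pairwise_orthogonal_independent[of B] by (force simp: good_def)
  have "span B = UNIV"
  proof (rule ccontr)
    assume "span B \<noteq> UNIV"
    then obtain x where "x \<noteq> 0" "\<forall>b\<in>span B. x \<bullet> b = 0"
      using span_not_UNIV_orthogonal[of B] by blast
    then have "x \<in> W" by (auto simp: W_def span_base inner_commute)
    with \<open>W = {0}\<close> \<open>x \<noteq> 0\<close> show False by blast
  qed
  then have "card B = CARD('n)"
    using ind by (metis DIM_cart DIM_real dim_UNIV dim_span_eq_card_independent mult.right_neutral)
  then obtain f :: "'n \<Rightarrow> real^'n" where f: "bij_betw f UNIV B"
    using bound[OF B] finite_same_card_bij[of "UNIV :: 'n set" B] by auto
  have fB: "f i \<in> B" for i using f by (auto simp: bij_betw_def)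
  have on: "f i \<bullet> f j = (if i = j then 1 else 0)" for i j
  proof (cases "i = j")
    case True then show ?thesis using B fB[of i] by (auto simp: good_def norm_eq_1)
  next
    case False
    then have "f i \<noteq> f j" using f by (auto simp: bij_betw_def inj_def)
    then show ?thesis using B fB False by (auto simp: good_def pairwise_def orthogonal_def)
  qed
  have "\<forall>i. \<exists>l. S *v f i = l *\<^sub>R f i" using B fB by (auto simp: good_def)
  then obtain d where d: "\<And>i. S *v f i = d i *\<^sub>R f i" by metis
  define U :: "real^'n^'n" where "U = (\<chi> i j. f j $ i)"
  have U: "orthogonal_matrix U"
    unfolding orthogonal_matrix
    by (simp add: vec_eq_iff matrix_matrix_mult_def transpose_def U_def mat_def on[unfolded inner_vec_def, simplified])
  have "S ** U = U ** diag d"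
  proof -
    have "(S ** U) $ i $ j = (U ** diag d) $ i $ j" for i j
    proof -
      have "(S ** U) $ i $ j = (S *v f j) $ i" by (simp add: matrix_matrix_mult_def matrix_vector_mult_def U_def)
      also have "\<dots> = d j * f j $ i" by (simp add: d)
      also have "\<dots> = (U ** diag d) $ i $ j"
        by (simp add: matrix_matrix_mult_def diag_def U_def if_distrib cong: if_cong)
      finally show ?thesis .
    qed
    then show ?thesis by (simp add: vec_eq_iff)
  qed
  then have "S = U ** diag d ** transpose U"
    using U by (metis matrix_mul_assoc matrix_mul_rid orthogonal_matrix_def)
  with U that show ?thesis by blast
qed

lemma spd_transpose: "A \<in> spd \<Longrightarrow> transpose A = A"
  by (simp add: spd_def)

lemma spd_imp_invertible: "A \<in> spd \<Longrightarrow> invertible A"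
  unfolding spd_def invertible_left_inverse matrix_left_invertible_ker
  by (metis (mono_tags, lifting) inner_zero_right mem_Collect_eq order_less_irrefl)

lemma spd_congruence:
  fixes A B :: "real^'n^'n"
  assumes "A \<in> spd" "invertible B"
  shows "B ** A ** transpose B \<in> spd"
proof -
  have "transpose (B ** A ** transpose B) = B ** A ** transpose B"
    using assms by (simp add: matrix_transpose_mul spd_def matrix_mul_assoc)
  moreover have "x \<bullet> ((B ** A ** transpose B) *v x) > 0" if "x \<noteq> 0" for x
  proof -
    have eq: "x \<bullet> ((B ** A ** transpose B) *v x) = (transpose B *v x) \<bullet> (A *v (transpose B *v x))"
      by (metis dot_lmul_matrix matrix_vector_mul_assoc transpose_matrix_vector)
    have "invertible (transpose B)" using assms transpose_invertible by blast
    then have "transpose B *v x \<noteq> 0"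
      using that invertible_left_inverse matrix_left_invertible_ker by blast
    then show ?thesis unfolding eq using assms by (simp add: spd_def)
  qed
  ultimately show ?thesis by (simp add: spd_def)
qed

lemma spd_congruence_iff:
  fixes A B :: "real^'n^'n"
  assumes "invertible B"
  shows "B ** A ** transpose B \<in> spd \<longleftrightarrow> A \<in> spd"
proof
  assume *: "B ** A ** transpose B \<in> spd"
  have 1: "invertible (matrix_inv B)" using assms matrix_inv_mult invertible_def by blast
  have "matrix_inv B ** (B ** A ** transpose B) ** transpose (matrix_inv B)
      = (matrix_inv B ** B) ** A ** transpose (matrix_inv B ** B)"
    by (simp add: matrix_transpose_mul matrix_mul_assoc)
  also have "\<dots> = A" using matrix_inv_mult[OF assms] by simp
  finally show "A \<in> spd" using spd_congruence[OF * 1] by simp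
qed (use assms spd_congruence in blast)

lemma spd_mat_1: "mat 1 \<in> spd"
  by (simp add: spd_def)

lemma diag_spd_iff: "diag d \<in> spd \<longleftrightarrow> (\<forall>i. d i > 0)"
proof
  assume "diag d \<in> spd"
  then have "axis i 1 \<bullet> (diag d *v axis i 1) > 0" for i
    by (simp add: spd_def axis_eq_0_iff)
  then show "\<forall>i. d i > 0" by (simp add: diag_mult_vec inner_axis')
next
  assume d: "\<forall>i. d i > 0"
  have "x \<bullet> (diag d *v x) > 0" if x: "x \<noteq> 0" for x
  proof -
    obtain i where "x $ i \<noteq> 0" using x by (auto simp: vec_eq_iff)
    have *: "0 \<le> x$j * (d j * x$j)" for j
    proof -
      have "x$j * (d j * x$j) = d j * (x$j)^2" by (simp add: power2_eq_square)
      also have "\<dots> \<ge> 0" using d[rule_format, of j] by simp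
      finally show ?thesis .
    qed
    have "0 < x$i * (d i * x$i)"
    proof -
      have "x$i * (d i * x$i) = d i * (x$i)^2" by (simp add: power2_eq_square)
      also have "\<dots> > 0" using d[rule_format, of i] \<open>x $ i \<noteq> 0\<close> by simp
      finally show ?thesis .
    qed
    then have "0 < (\<Sum>j\<in>UNIV. x$j * (d j * x$j))"
      using * by (intro sum_pos2[of _ i]) auto
    then show ?thesis by (simp add: diag_mult_vec inner_vec_def)
  qed
  then show "diag d \<in> spd" by (simp add: spd_def)
qed

lemma spd_diagonalization:
  fixes A :: "real^'n^'n"
  assumes "A \<in> spd"
  obtains U d where "orthogonal_matrix U" "\<And>i. d i > 0" "A = U ** diag d ** transpose U"
proof -
  obtain U d where *: "orthogonal_matrix U" "A = U ** diag d ** transpose U"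
    using symmetric_matrix_diagonalization[OF spd_transpose[OF assms]] by metis
  have "invertible U" using *(1) unfolding invertible_def orthogonal_matrix_def by blast
  then have "diag d \<in> spd" using assms * spd_congruence_iff by blast
  then show ?thesis using that * diag_spd_iff by blast
qed

lemma spd_sqrt_exists:
  fixes A :: "real^'n^'n"
  assumes "A \<in> spd"
  shows "\<exists>B\<in>spd. B ** B = A"
proof -
  obtain U d where U: "orthogonal_matrix U" and d: "\<And>i. d i > 0" and A: "A = U ** diag d ** transpose U"
    using spd_diagonalization[OF assms] by metis
  let ?B = "U ** diag (\<lambda>i. sqrt (d i)) ** transpose U"
  have "invertible U" using U unfolding invertible_def orthogonal_matrix_def by blast
  then have "?B \<in> spd" using d spd_congruence diag_spd_iff by (metis real_sqrt_gt_0_iff)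
  moreover have "?B ** ?B = A"
  proof -
    have "?B ** ?B = U ** diag (\<lambda>i. sqrt (d i)) ** (transpose U ** U) ** diag (\<lambda>i. sqrt (d i)) ** transpose U"
      by (simp add: matrix_mul_assoc)
    also have "\<dots> = U ** (diag (\<lambda>i. sqrt (d i)) ** diag (\<lambda>i. sqrt (d i))) ** transpose U"
      using U by (simp add: orthogonal_matrix_def matrix_mul_assoc)
    also have "\<dots> = A" using d by (simp add: diag_mult A less_imp_le)
    finally show ?thesis .
  qed
  ultimately show ?thesis by blast
qed

text \<open>
  With \<open>D = B - C\<close> the hypothesis reads \<open>D (B + C) + (B + C) D = 0\<close>. Multiplying by \<open>D\<close> and taking
  traces shows that \<open>D (B + C) D\<close> has trace zero; this trace is a sum of values of the positive definite
  form \<open>B + C\<close> at the columns of \<open>D\<close>.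
\<close>

lemma spd_sqrt_unique:
  fixes B C :: "real^'n^'n"
  assumes B: "B \<in> spd" and C: "C \<in> spd" and eq: "B ** B = C ** C"
  shows "B = C"
proof -
  define D where "D = B - C"
  have D: "transpose D = D"
    using B C by (simp add: D_def spd_def transpose_def vec_eq_iff)
  have "D ** (B + C) + (B + C) ** D = 0"
  proof -
    have "D ** (B + C) + (B + C) ** D = (B ** B - C ** C) + (B ** B - C ** C)"
      by (simp add: D_def matrix_add_ldistrib matrix_add_rdistrib' matrix_sub_ldistrib' matrix_sub_rdistrib')
    then show ?thesis using eq by simp
  qed
  then have "D *v ((B + C) *v (D *v x)) + (B + C) *v (D *v (D *v x)) = 0" for x
    by (metis matrix_vector_mul_assoc matrix_vector_mult_0 matrix_vector_mult_add_rdistrib)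
  note * = this
  have sBC: "transpose (B + C) = B + C" using B C by (simp add: spd_def transpose_def vec_eq_iff)
  define E where "E = D ** (B + C) ** D"
  have E: "E *v x = D *v ((B + C) *v (D *v x))" for x
    by (simp add: E_def matrix_vector_mul_assoc[symmetric])
  have tr1: "trace E = (\<Sum>i\<in>UNIV. (D *v axis i 1) \<bullet> ((B + C) *v (D *v axis i 1)))"
  proof -
    have "E $ i $ i = (D *v axis i 1) \<bullet> ((B + C) *v (D *v axis i 1))" for i
    proof -
      have "E $ i $ i = axis i 1 \<bullet> (E *v axis i 1)"
        by (simp add: matrix_vector_mult_basis column_def inner_axis')
      then show ?thesis by (simp add: E inner_symmetric_matrix[OF D])
    qed
    then show ?thesis by (simp add: trace_def)
  qed
  have "trace E = trace ((B + C) ** D ** D)"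
    unfolding E_def by (metis matrix_mul_assoc trace_mul_sym)
  moreover have "trace E + trace ((B + C) ** D ** D) = 0"
  proof -
    have "(D ** (B + C) + (B + C) ** D) ** D = 0" using \<open>D ** (B + C) + (B + C) ** D = 0\<close> by simp
    then have "E + (B + C) ** D ** D = 0" by (simp add: E_def matrix_add_rdistrib')
    then show ?thesis by (metis trace_add trace_0 mat_0)
  qed
  ultimately have tr0: "trace E = 0" by simp
  have nn: "0 \<le> (D *v axis i 1) \<bullet> ((B + C) *v (D *v axis i 1))"
    and pos: "D *v axis i 1 \<noteq> 0 \<Longrightarrow> 0 < (D *v axis i 1) \<bullet> ((B + C) *v (D *v axis i 1))" for i
    using B C by (cases "D *v axis i 1 = 0";
       simp add: spd_def matrix_vector_mult_add_rdistrib inner_add_right add_pos_pos less_imp_le)+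
  have "D *v axis i 1 = 0" for i
    using tr0 nn pos unfolding tr1
    by (subst (asm) sum_nonneg_eq_0_iff) (auto simp: less_le)
  then have "D = 0" by (simp add: matrix_vector_mult_basis column_def vec_eq_iff)
  then show ?thesis by (simp add: D_def)
qed

lemma spd_sqrt_works:
  fixes A :: "real^'n^'n"
  assumes "A \<in> spd"
  shows "spd_sqrt A \<in> spd" "spd_sqrt A ** spd_sqrt A = A"
proof -
  have "\<exists>!B. B \<in> spd \<and> B ** B = A"
    using spd_sqrt_exists[OF assms] spd_sqrt_unique by metis
  from theI'[OF this] show "spd_sqrt A \<in> spd" "spd_sqrt A ** spd_sqrt A = A"
    unfolding spd_sqrt_def by auto
qed

lemma spd_det_pos:
  fixes A :: "real^'n^'n"
  assumes "A \<in> spd"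
  shows "det A > 0"
proof -
  have "det A = (det (spd_sqrt A))^2"
    using spd_sqrt_works(2)[OF assms] by (metis det_mul power2_eq_square)
  moreover have "det A \<noteq> 0" using spd_imp_invertible[OF assms] invertible_det_nz by blast
  ultimately show ?thesis by simp
qed

lemma spd_matrix_inv:
  fixes A :: "real^'n^'n"
  assumes "A \<in> spd"
  shows "matrix_inv A \<in> spd"
proof -
  let ?I = "matrix_inv A"
  note I = matrix_inv_mult[OF spd_imp_invertible[OF assms]]
  have "transpose ?I = ?I"
    using matrix_inv_unique[of A "transpose ?I"] I assms
    by (metis matrix_transpose_mul spd_transpose transpose_mat)
  moreover have "invertible ?I" using I invertible_def by blast
  ultimately show ?thesis
    using spd_congruence[OF assms, of ?I] I by (simp)
qed

text \<open>
  The uniform bound makes positive definiteness a countable union of closed conditions, hence Borel.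
\<close>

lemma spd_coercive:
  fixes A :: "real^'n^'n"
  assumes "A \<in> spd"
  obtains e where "e > 0" "\<And>x. e * (x \<bullet> x) \<le> x \<bullet> (A *v x)"
proof -
  let ?B = "spd_sqrt A"
  let ?C = "matrix_inv ?B"
  have B: "?B \<in> spd" "?B ** ?B = A" using spd_sqrt_works[OF assms] by auto
  note I = matrix_inv_mult[OF spd_imp_invertible[OF B(1)]]
  obtain K where K: "K > 0" "\<And>x. norm (?C *v x) \<le> norm x * K"
    using bounded_linear.pos_bounded[OF matrix_vector_mul_bounded_linear] by blast
  have "inverse (K^2) * (x \<bullet> x) \<le> x \<bullet> (A *v x)" for x
  proof -
    have "x \<bullet> (A *v x) = (norm (?B *v x))^2"
      using B(1) by (metis B(2) inner_symmetric_matrix matrix_vector_mul_assoc power2_norm_eq_inner spd_transpose)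
    moreover have "norm x \<le> norm (?B *v x) * K"
      using K(2)[of "?B *v x"] I by (simp add: matrix_vector_mul_assoc)
    then have "(norm x)^2 \<le> (norm (?B *v x))^2 * K^2"
      by (metis norm_ge_zero power_mono power_mult_distrib)
    ultimately show ?thesis using K(1) by (simp add: field_simps power2_norm_eq_inner[symmetric])
  qed
  then show ?thesis using that[of "inverse (K^2)"] K(1) by simp
qed

section \<open>Lebesgue measure on coordinate subspaces\<close>

text \<open>
  Uniqueness of Haar measure. In the double integral of \<open>1\<^sub>A(x) 1\<^sub>B(y)\<close> replace \<open>x\<close> by \<open>x + y\<close> and then
  \<open>y\<close> by \<open>y - x\<close>, exchanging the order of integration in between. Invariance is only required under
  translations by a subspace \<open>W\<close> of full measure, since the measures below live on proper subspaces.
\<close>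

lemma translation_invariant_measures_proportional:
  fixes M N :: "'a::euclidean_space measure"
  assumes M [measurable_cong]: "sets M = sets borel" and N [measurable_cong]: "sets N = sets borel"
    and "sigma_finite_measure M" "sigma_finite_measure N"
    and W: "subspace W" "AE x in M. x \<in> W" "AE x in N. x \<in> W"
    and trM: "\<And>w. w \<in> W \<Longrightarrow> distr M borel (\<lambda>x. w + x) = M"
    and trN: "\<And>w. w \<in> W \<Longrightarrow> distr N borel (\<lambda>x. w + x) = N"
    and A [measurable]: "A \<in> sets borel" and B [measurable]: "B \<in> sets borel"
  shows "emeasure N A * emeasure M (uminus -` B) = emeasure M A * emeasure N B"
proof -
  interpret M: sigma_finite_measure M by fact
  interpret N: sigma_finite_measure N by fact
  interpret MN: pair_sigma_finite M N by standard
  have shM: "(\<integral>\<^sup>+x. f (w + x) \<partial>M) = (\<integral>\<^sup>+x. f x \<partial>M)" if "w \<in> W" "f \<in> borel_measurable borel" for w f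
    using that trM[of w] nn_integral_distr[of "\<lambda>x. w + x" M borel f] by simp
  have shN: "(\<integral>\<^sup>+x. f (w + x) \<partial>N) = (\<integral>\<^sup>+x. f x \<partial>N)" if "w \<in> W" "f \<in> borel_measurable borel" for w f
    using that trN[of w] nn_integral_distr[of "\<lambda>x. w + x" N borel f] by simp
  let ?a = "indicator A :: 'a \<Rightarrow> ennreal" and ?b = "indicator B :: 'a \<Rightarrow> ennreal"
  have "emeasure M A * emeasure N B = (\<integral>\<^sup>+y. (\<integral>\<^sup>+x. ?a x \<partial>M) * ?b y \<partial>N)"
    using M N by (subst nn_integral_cmult) auto
  also have "\<dots> = (\<integral>\<^sup>+y. (\<integral>\<^sup>+x. ?a (y + x) * ?b y \<partial>M) \<partial>N)"
    using W(3)
  proof (intro nn_integral_cong_AE, eventually_elim)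
    case (elim y)
    show ?case using shM[OF elim(2), of ?a] M by (subst nn_integral_multc) auto
  qed
  also have "\<dots> = (\<integral>\<^sup>+x. (\<integral>\<^sup>+y. ?a (y + x) * ?b y \<partial>N) \<partial>M)"
    by (rule MN.Fubini') measurable
  also have "\<dots> = (\<integral>\<^sup>+x. (\<integral>\<^sup>+y. ?a y * ?b (y - x) \<partial>N) \<partial>M)"
    using W(2)
  proof (intro nn_integral_cong_AE, eventually_elim)
    case (elim x)
    show ?case
      using shN[OF elim(2), of "\<lambda>y. ?a y * ?b (y - x)"] by (simp add: add.commute)
  qed
  also have "\<dots> = (\<integral>\<^sup>+y. (\<integral>\<^sup>+x. ?a y * ?b (y - x) \<partial>M) \<partial>N)"
    by (rule MN.Fubini'[symmetric]) measurable
  also have "\<dots> = (\<integral>\<^sup>+y. (\<integral>\<^sup>+x. ?a y * ?b (- x) \<partial>M) \<partial>N)"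
    using W(3)
  proof (intro nn_integral_cong_AE, eventually_elim)
    case (elim y)
    show ?case
      using shM[OF elim(2), of "\<lambda>x. ?a y * ?b (y - x)"] by simp
  qed
  also have "\<dots> = (\<integral>\<^sup>+y. ?a y * emeasure M (uminus -` B) \<partial>N)"
  proof (intro nn_integral_cong)
    fix y
    have "uminus -` B \<in> sets borel" using measurable_sets[of uminus borel borel B] by simp
    moreover have "?b (- x) = indicator (uminus -` B) x" for x by (simp add: indicator_def)
    ultimately show "(\<integral>\<^sup>+x. ?a y * ?b (- x) \<partial>M) = ?a y * emeasure M (uminus -` B)"
      using M by (subst nn_integral_cmult) auto
  qed
  also have "\<dots> = emeasure N A * emeasure M (uminus -` B)"
    using N by (subst nn_integral_multc) auto
  finally show ?thesis by simp
qed

lemma linear_borel_measurable: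
  fixes L :: "'a::euclidean_space \<Rightarrow> 'b::euclidean_space"
  shows "linear L \<Longrightarrow> L \<in> borel_measurable borel"
  using linear_continuous_on[of L UNIV] by (simp add: borel_measurable_continuous_onI linear_linear)

abbreviation lborels :: "'i set \<Rightarrow> ('i \<Rightarrow> real) measure" where
  "lborels I \<equiv> PiM I (\<lambda>_. lborel)"

interpretation lborel_product: product_sigma_finite "\<lambda>_. lborel :: real measure"
  by standard

text \<open>
  A parametrisation \<open>e\<close> of a subspace by finitely many real coordinates, with linear coordinate
  functionals \<open>\<phi>\<close>. Both vectors and symmetric matrices are instances; in the second case the ambient
  space of all matrices is larger than the subspace.
\<close>

locale coordinate_space =
  fixes I :: "'i set" and e :: "('i \<Rightarrow> real) \<Rightarrow> 'a::euclidean_space" and \<phi> :: "'i \<Rightarrow> 'a \<Rightarrow> real"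
  assumes finite_I: "finite I"
    and e_measurable [measurable]: "e \<in> borel_measurable (lborels I)"
    and e_add: "e (\<lambda>i. x i + y i) = e x + e y"
    and e_scale: "e (\<lambda>i. c * x i) = c *\<^sub>R e x"
    and e_restrict: "e (restrict x I) = e x"
    and coord_linear: "i \<in> I \<Longrightarrow> linear (\<phi> i)"
    and coord_e: "i \<in> I \<Longrightarrow> \<phi> i (e x) = x i"
begin

abbreviation "V \<equiv> range e"

definition leb :: "'a measure" where "leb = distr (lborels I) borel e"

lemma sets_leb [measurable_cong, simp]: "sets leb = sets borel"
  by (simp add: leb_def)

lemma space_leb [simp]: "space leb = UNIV"
  by (simp add: leb_def)

lemma subspace_V: "subspace V"
proof (unfold subspace_def, safe)
  show "0 \<in> V" using e_scale[of 0 "\<lambda>_. 0"] by (metis rangeI scaleR_zero_left)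
  show "e x + e y \<in> V" for x y using e_add[of x y] by (metis rangeI)
  show "c *\<^sub>R e x \<in> V" for c x using e_scale[of c x] by (metis rangeI)
qed

lemma coord_measurable: "i \<in> I \<Longrightarrow> \<phi> i \<in> borel_measurable borel"
  by (intro linear_borel_measurable coord_linear)

lemma V_iff: "x \<in> V \<longleftrightarrow> e (restrict (\<lambda>i. \<phi> i x) I) = x"
proof
  assume "x \<in> V"
  then obtain u where u: "x = e u" by blast
  have "restrict (\<lambda>i. \<phi> i x) I = restrict u I" by (auto simp: u coord_e)
  then show "e (restrict (\<lambda>i. \<phi> i x) I) = x" by (simp add: e_restrict u)
qed (metis rangeI)

lemma V_measurable [measurable]: "V \<in> sets borel"
proof -
  have "(\<lambda>x. restrict (\<lambda>i. \<phi> i x) I) \<in> borel \<rightarrow>\<^sub>M lborels I"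
    using coord_measurable by (intro measurable_restrict) auto
  then have [measurable]: "(\<lambda>x. e (restrict (\<lambda>i. \<phi> i x) I)) \<in> borel_measurable borel"
    by (rule measurable_compose[OF _ e_measurable])
  have "V = {x \<in> space borel. e (restrict (\<lambda>i. \<phi> i x) I) = x}" using V_iff by auto
  also have "\<dots> \<in> sets borel" by measurable
  finally show ?thesis .
qed

lemma AE_V: "AE x in leb. x \<in> V"
  unfolding leb_def by (subst AE_distr_iff) auto

lemma nn_integral_leb:
  "f \<in> borel_measurable borel \<Longrightarrow> (\<integral>\<^sup>+x. f x \<partial>leb) = (\<integral>\<^sup>+x. f (e x) \<partial>lborels I)"
  unfolding leb_def by (subst nn_integral_distr) auto

lemma emeasure_leb_box:
  assumes "\<And>i. i \<in> I \<Longrightarrow> A i \<in> sets borel"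
  shows "emeasure leb {x. \<forall>i\<in>I. \<phi> i x \<in> A i} = (\<Prod>i\<in>I. emeasure lborel (A i))"
    and "{x. \<forall>i\<in>I. \<phi> i x \<in> A i} \<in> sets borel"
proof -
  have "{x \<in> space borel. \<forall>i\<in>I. \<phi> i x \<in> A i} \<in> sets borel"
  proof (rule sets.sets_Collect_finite_All)
    fix i assume "i \<in> I"
    then show "{x \<in> space borel. \<phi> i x \<in> A i} \<in> sets borel"
      using measurable_sets[OF coord_measurable assms] by (simp add: vimage_def)
  qed (rule finite_I)
  then show S: "{x. \<forall>i\<in>I. \<phi> i x \<in> A i} \<in> sets borel" by simp
  have "e -` {x. \<forall>i\<in>I. \<phi> i x \<in> A i} \<inter> space (lborels I) = Pi\<^sub>E I A"
    by (auto simp: space_PiM coord_e PiE_iff)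
  then show "emeasure leb {x. \<forall>i\<in>I. \<phi> i x \<in> A i} = (\<Prod>i\<in>I. emeasure lborel (A i))"
    unfolding leb_def using S assms
    by (subst emeasure_distr) (auto intro!: lborel_product.emeasure_PiM finite_I)
qed

definition box :: "real \<Rightarrow> 'a set" where "box r = {x. \<forall>i\<in>I. \<phi> i x \<in> {-r..r}}"

lemma box_measurable [measurable]: "box r \<in> sets borel"
  unfolding box_def by (rule emeasure_leb_box(2)) auto

lemma emeasure_box: "r \<ge> 0 \<Longrightarrow> emeasure leb (box r) = ennreal ((2 * r) ^ card I)"
  unfolding box_def by (subst emeasure_leb_box(1)) (auto simp: ennreal_power)

lemma UN_box: "(\<Union>n. box (real n)) = UNIV"
proof -
  have "x \<in> (\<Union>n. box (real n))" for x
  proof -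
    obtain n where "(\<Sum>i\<in>I. \<bar>\<phi> i x\<bar>) \<le> real n" using real_arch_simple by blast
    moreover have "\<bar>\<phi> i x\<bar> \<le> (\<Sum>i\<in>I. \<bar>\<phi> i x\<bar>)" if "i \<in> I" for i
      using finite_I that by (intro member_le_sum) auto
    ultimately have "\<bar>\<phi> i x\<bar> \<le> real n" if "i \<in> I" for i
      using that order_trans by blast
    then have "x \<in> box (real n)" unfolding box_def by (auto simp: abs_le_iff minus_le_iff)
    then show ?thesis by blast
  qed
  then show ?thesis by blast
qed

lemma uminus_box: "uminus -` box r = box r"
  unfolding box_def using coord_linear by (auto simp: linear_neg)

lemma sigma_finite_leb_image:
  fixes L L' :: "'a \<Rightarrow> 'a"
  assumes L: "linear L" "linear L'" "\<And>x. L' (L x) = x"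
  shows "sigma_finite_measure (distr leb borel L)"
proof
  have [measurable]: "L \<in> borel_measurable borel" "L' \<in> borel_measurable borel"
    using L by (auto intro: linear_borel_measurable)
  let ?B = "\<lambda>n. L' -` box (real n)"
  have m: "?B n \<in> sets borel" for n using measurable_sets_borel[of L' borel "box (real n)"] by simp
  have "emeasure (distr leb borel L) (?B n) \<noteq> \<infinity>" for n
  proof -
    have "L -` ?B n = box (real n)" using L by auto
    then show ?thesis using m by (subst emeasure_distr) (auto simp: emeasure_box)
  qed
  moreover have "(\<Union>n. ?B n) = UNIV" using UN_box by (auto simp: vimage_UN[symmetric])
  ultimately show "\<exists>A. countable A \<and> A \<subseteq> sets (distr leb borel L) \<and> \<Union> A = space (distr leb borel L) \<and>
      (\<forall>a\<in>A. emeasure (distr leb borel L) a \<noteq> \<infinity>)"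
    using m by (intro exI[of _ "range ?B"]) auto
qed

lemma leb_translation:
  assumes "w \<in> V"
  shows "distr leb borel (\<lambda>x. w + x) = leb"
proof -
  obtain u where u: "w = e u" using assms by blast
  let ?P = "lborels I"
  let ?t = "\<lambda>x. \<lambda>i\<in>I. u i + x i"
  have t [measurable]: "?t \<in> ?P \<rightarrow>\<^sub>M ?P" by measurable
  have P: "distr ?P ?P ?t = ?P"
  proof (rule lborel_product.PiM_eqI)
    fix A :: "'i \<Rightarrow> real set" assume A: "\<And>i. i \<in> I \<Longrightarrow> A i \<in> sets lborel"
    have B: "(\<lambda>x. u i + x) -` A i \<in> sets lborel" if "i \<in> I" for i
      using measurable_sets_borel[of "\<lambda>x. u i + x" borel "A i"] A[OF that] by simp
    have "?t -` Pi\<^sub>E I A \<inter> space ?P = Pi\<^sub>E I (\<lambda>i. (\<lambda>x. u i + x) -` A i)"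
      by (auto simp: space_PiM PiE_iff)
    then have "emeasure (distr ?P ?P ?t) (Pi\<^sub>E I A) = (\<Prod>i\<in>I. emeasure lborel ((\<lambda>x. u i + x) -` A i))"
      using A B finite_I by (subst emeasure_distr) (auto simp: lborel_product.emeasure_PiM sets_PiM_I_finite)
    also have "\<dots> = (\<Prod>i\<in>I. emeasure lborel (A i))"
    proof (rule prod.cong)
      fix i assume "i \<in> I"
      then show "emeasure lborel ((\<lambda>x. u i + x) -` A i) = emeasure lborel (A i)"
        using emeasure_distr[of "\<lambda>x. u i + x" lborel borel "A i"] A lborel_distr_plus[of "u i"] by simp
    qed simp
    finally show "emeasure (distr ?P ?P ?t) (Pi\<^sub>E I A) = (\<Prod>i\<in>I. emeasure lborel (A i))" .
  qed (auto simp: finite_I)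
  have "distr leb borel (\<lambda>x. w + x) = distr ?P borel (\<lambda>x. e (?t x))"
    unfolding leb_def by (subst distr_distr) (auto simp: comp_def u e_add e_restrict)
  also have "\<dots> = distr (distr ?P ?P ?t) borel e"
    by (subst distr_distr) (auto simp: comp_def)
  finally show ?thesis by (simp add: P leb_def)
qed

text \<open>
  Bijectivity is required on the ambient space, so that preimages of sets of finite measure again exhaust it.
\<close>

definition automorphism :: "('a \<Rightarrow> 'a) \<Rightarrow> bool" where
  "automorphism L \<longleftrightarrow> linear L \<and> (\<forall>x\<in>V. L x \<in> V) \<and>
     (\<exists>L'. linear L' \<and> (\<forall>x\<in>V. L' x \<in> V) \<and> (\<forall>x. L' (L x) = x) \<and> (\<forall>x. L (L' x) = x))"

text \<open>
  The box is symmetric under \<open>uminus\<close>, which removes the reflection in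
  \<open>translation_invariant_measures_proportional\<close>, and has positive finite measure.
\<close>

definition scale :: "('a \<Rightarrow> 'a) \<Rightarrow> real" where
  "scale L = enn2real (emeasure leb (L -` box 1) / emeasure leb (box 1))"

lemma automorphism_measurable: "automorphism L \<Longrightarrow> L \<in> borel_measurable borel"
  by (auto simp: automorphism_def intro: linear_borel_measurable)

lemma emeasure_automorphism_box_ratio:
  assumes L: "automorphism L" and A: "A \<in> sets borel"
  shows "emeasure leb (L -` A) = emeasure leb (L -` box 1) / emeasure leb (box 1) * emeasure leb A"
proof -
  obtain L' where L': "linear L'" "(\<forall>x\<in>V. L' x \<in> V)" "\<And>x. L' (L x) = x" "\<And>x. L (L' x) = x"
    using L unfolding automorphism_def by metis
  have lin: "linear L" and LV: "(\<forall>x\<in>V. L x \<in> V)" using L by (auto simp: automorphism_def)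
  have [measurable]: "L \<in> borel_measurable borel" by (rule automorphism_measurable[OF L])
  let ?N = "distr leb borel L"
  have tr: "distr ?N borel (\<lambda>x. w + x) = ?N" if "w \<in> V" for w
  proof -
    have "L' w \<in> V" using L' that by blast
    have "distr ?N borel (\<lambda>x. w + x) = distr leb borel (\<lambda>x. L (L' w + x))"
      by (subst distr_distr) (auto simp: comp_def linear_add[OF lin] L')
    also have "\<dots> = distr (distr leb borel (\<lambda>x. L' w + x)) borel L"
      by (subst distr_distr) (auto simp: comp_def)
    finally show ?thesis using leb_translation[OF \<open>L' w \<in> V\<close>] by simp
  qed
  have AE: "AE x in ?N. x \<in> V"
    using AE_V
  proof (subst AE_distr_iff, goal_cases)
    case 3
    then show ?case using LV by (auto elim!: eventually_mono)
  qed auto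
  have b: "emeasure leb (box 1) = ennreal (2 ^ card I)" by (simp add: emeasure_box)
  have "emeasure ?N A * emeasure leb (uminus -` box 1) = emeasure leb A * emeasure ?N (box 1)"
    using sigma_finite_leb_image[of "\<lambda>x. x" "\<lambda>x. x"] linear_id[unfolded id_def]
    by (intro translation_invariant_measures_proportional[where W = V])
       (auto simp: subspace_V AE_V AE leb_translation tr A distr_id2
             intro!: sigma_finite_leb_image[OF lin L'(1,3)])
  then have "emeasure leb (L -` A) * emeasure leb (box 1) = emeasure leb (L -` box 1) * emeasure leb A"
    using A by (simp add: emeasure_distr uminus_box mult.commute)
  moreover have "emeasure leb (L -` A) * emeasure leb (box 1) / emeasure leb (box 1) = emeasure leb (L -` A)"
    unfolding b by (rule ennreal_mult_divide_eq) auto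
  ultimately show ?thesis
    by (metis ennreal_times_divide ennreal_divide_times mult.commute)
qed

text \<open>
  The factor is positive and finite because its product with the factor of the inverse map is one.
\<close>

lemma emeasure_automorphism:
  assumes L: "automorphism L" and A: "A \<in> sets borel"
  shows "emeasure leb (L -` A) = ennreal (scale L) * emeasure leb A" and "scale L > 0"
proof -
  obtain L' where L': "linear L'" "(\<forall>x\<in>V. L' x \<in> V)" "\<And>x. L' (L x) = x" "\<And>x. L (L' x) = x"
    using L unfolding automorphism_def by metis
  have aL': "automorphism L'" using L L' unfolding automorphism_def by blast
  let ?c = "emeasure leb (L -` box 1) / emeasure leb (box 1)"
  let ?c' = "emeasure leb (L' -` box 1) / emeasure leb (box 1)"
  have b: "emeasure leb (box 1) = ennreal (2 ^ card I)" by (simp add: emeasure_box)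
  have m: "L' -` box 1 \<in> sets borel"
    using measurable_sets_borel[OF automorphism_measurable[OF aL'], of "box 1"] by simp
  have "emeasure leb (box 1) = emeasure leb (L -` (L' -` box 1))"
    using L' by (simp add: vimage_def)
  also have "\<dots> = ?c * (?c' * emeasure leb (box 1))"
    using emeasure_automorphism_box_ratio[OF L m] emeasure_automorphism_box_ratio[OF aL', of "box 1"] by simp
  finally have "?c * ?c' * emeasure leb (box 1) / emeasure leb (box 1) = emeasure leb (box 1) / emeasure leb (box 1)"
    by (simp add: mult_ac)
  then have one: "?c * ?c' = 1"
    unfolding b by (simp add: ennreal_mult_divide_eq divide_self_if)
  have "?c \<noteq> 0" "?c \<noteq> \<infinity>"
  proof -
    show c0: "?c \<noteq> 0" using one by auto
    have "?c' \<noteq> 0" using one by auto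
    then show "?c \<noteq> \<infinity>" using one by (auto simp: ennreal_top_mult)
  qed
  then show "scale L > 0" "emeasure leb (L -` A) = ennreal (scale L) * emeasure leb A"
    using emeasure_automorphism_box_ratio[OF L A]
    by (auto simp: scale_def enn2real_positive_iff less_top zero_less_iff_neq_zero)
qed

lemma nn_integral_automorphism:
  assumes L: "automorphism L" and f: "f \<in> borel_measurable borel"
  shows "(\<integral>\<^sup>+x. f (L x) \<partial>leb) = ennreal (scale L) * (\<integral>\<^sup>+x. f x \<partial>leb)"
proof -
  have [measurable]: "L \<in> borel_measurable borel" by (rule automorphism_measurable[OF L])
  have "distr leb borel L = density leb (\<lambda>_. ennreal (scale L))"
    by (rule measure_eqI)
       (auto simp: emeasure_distr emeasure_automorphism[OF L] emeasure_density nn_integral_cmult)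
  then show ?thesis
    using nn_integral_distr[of L leb borel f] f
    by (simp add: nn_integral_density nn_integral_cmult)
qed

lemma scale_eqI:
  assumes "emeasure leb (L -` box 1) = ennreal c * emeasure leb (box 1)" "c \<ge> 0"
  shows "scale L = c"
  using assms unfolding scale_def
  by (simp add: emeasure_box ennreal_mult_divide_eq)

lemma scale_comp:
  assumes L: "automorphism L" and K: "automorphism K"
  shows "scale (\<lambda>x. L (K x)) = scale L * scale K"
proof (rule scale_eqI)
  have m: "L -` box 1 \<in> sets borel"
    using measurable_sets_borel[OF automorphism_measurable[OF L], of "box 1"] by simp
  have "emeasure leb ((\<lambda>x. L (K x)) -` box 1) = emeasure leb (K -` (L -` box 1))"
    by (simp add: vimage_def)
  then show "emeasure leb ((\<lambda>x. L (K x)) -` box 1) = ennreal (scale L * scale K) * emeasure leb (box 1)"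
    using emeasure_automorphism[OF L, of "box 1"] emeasure_automorphism[OF K] m
    by (simp add: ennreal_mult' less_imp_le mult_ac)
  show "0 \<le> scale L * scale K"
    using emeasure_automorphism(2)[OF L m] emeasure_automorphism(2)[OF K m] by simp
qed

lemma scale_pos: "automorphism L \<Longrightarrow> scale L > 0"
  using emeasure_automorphism(2)[of L "{}"] by simp

lemma scale_id: "scale (\<lambda>x. x) = 1"
  by (rule scale_eqI) auto

end

section \<open>Linear changes of variables for vectors and symmetric matrices\<close>

text \<open>
  In a multiplicative family the factors of \<open>U\<close> and of its transpose cancel, whatever they are. So
  the factor of a positive definite matrix is that of its diagonal form.
\<close>

lemma (in coordinate_space) scale_spd_representation:
  fixes \<rho> :: "real^'n^'n \<Rightarrow> 'a \<Rightarrow> 'a"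
  assumes aut: "\<And>B. invertible B \<Longrightarrow> automorphism (\<rho> B)"
    and mult: "\<And>B C x. \<rho> (B ** C) x = \<rho> B (\<rho> C x)" and one: "\<And>x. \<rho> (mat 1) x = x"
    and U: "orthogonal_matrix U" and D: "invertible D"
  shows "scale (\<rho> (U ** D ** transpose U)) = scale (\<rho> D)"
proof -
  have U1: "U ** transpose U = mat 1" using U by (simp add: orthogonal_matrix_def)
  then have inv: "invertible U" "invertible (transpose U)"
    using U unfolding invertible_def orthogonal_matrix_def by auto
  have m: "scale (\<rho> (B ** C)) = scale (\<rho> B) * scale (\<rho> C)" if "invertible B" "invertible C" for B C
    using scale_comp[OF aut[OF that(1)] aut[OF that(2)]] by (simp add: mult[abs_def])
  have "scale (\<rho> U) * scale (\<rho> (transpose U)) = 1"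
    using m[OF inv] by (simp add: U1 one[abs_def] scale_id)
  then show ?thesis using m inv D by (simp add: invertible_mult)
qed

interpretation vec: coordinate_space UNIV "\<lambda>x. (\<chi> i. x i) :: real^'n" "\<lambda>i x. x $ i"
proof
  show "(\<lambda>x. (\<chi> i. x i) :: real^'n) \<in> borel_measurable (lborels UNIV)"
    by (subst borel_measurable_euclidean_space)
       (auto simp: Basis_vec_def inner_axis)
qed (auto simp: vec_eq_iff intro!: linearI)

lemma vec_automorphism:
  fixes B :: "real^'n^'n"
  assumes "invertible B"
  shows "vec.automorphism (\<lambda>x. B *v x)"
proof -
  note I = matrix_inv_mult[OF assms]
  have V: "x \<in> range (\<lambda>x. (\<chi> i. x i) :: real^'n)" for x :: "real^'n"
    by (metis rangeI vec_lambda_eta)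
  show ?thesis unfolding vec.automorphism_def using V
    by (intro conjI exI[of _ "\<lambda>x. matrix_inv B *v x"]) (auto simp: I matrix_vector_mul_assoc)
qed

lemma vec_scale_spd:
  fixes S :: "real^'n^'n"
  assumes S: "S \<in> spd"
  shows "vec.scale (\<lambda>x. S *v x) = 1 / det S"
proof -
  obtain U d where U: "orthogonal_matrix U" and d: "\<And>i. d i > 0" and S: "S = U ** diag d ** transpose U"
    using spd_diagonalization[OF S] by metis
  have iD: "invertible (diag d)" using d by (simp add: diag_spd_iff spd_imp_invertible)
  have "det U * det U = 1"
    using U by (metis det_I det_mul det_transpose orthogonal_matrix_def)
  then have det: "det S = (\<Prod>i\<in>UNIV. d i)" by (simp add: S det_mul det_diag)
  have "vec.scale (\<lambda>x. S *v x) = vec.scale (\<lambda>x. diag d *v x)"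
    unfolding S by (rule vec.scale_spd_representation[of "\<lambda>B x. B *v x"])
      (auto simp: vec_automorphism matrix_vector_mul_assoc U iD)
  also have "\<dots> = 1 / det S"
  proof (rule vec.scale_eqI)
    have "(\<lambda>x. diag d *v x) -` vec.box 1 = {x. \<forall>i\<in>UNIV. x $ i \<in> {-1 / d i .. 1 / d i}}"
      using d by (auto simp: vec.box_def diag_mult_vec field_simps)
    then have "emeasure vec.leb ((\<lambda>x. diag d *v x) -` vec.box 1)
        = (\<Prod>i\<in>UNIV. emeasure lborel {-1 / d i .. 1 / d i})"
      using vec.emeasure_leb_box(1)[of "\<lambda>i. {-1 / d i .. 1 / d i}"] by simp
    also have "\<dots> = (\<Prod>i\<in>UNIV. ennreal (2 / d i))"
      using d by (intro prod.cong) (auto simp: less_imp_le field_simps)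
    also have "\<dots> = ennreal (\<Prod>i\<in>UNIV. 2 / d i)"
      using d by (intro prod_ennreal) (simp add: less_imp_le)
    also have "\<dots> = ennreal (1 / det S) * emeasure vec.leb (vec.box 1 :: (real^'n) set)"
      using d by (simp add: vec.emeasure_box ennreal_mult''[symmetric] det prod_dividef)
    finally show "emeasure vec.leb ((\<lambda>x. diag d *v x) -` vec.box 1) = ennreal (1 / det S) * emeasure vec.leb (vec.box 1 :: (real^'n) set)" .
    show "0 \<le> 1 / det S" using d by (simp add: det prod_nonneg less_imp_le)
  qed
  finally show ?thesis .
qed

definition subvec :: "'n set \<Rightarrow> ('n \<Rightarrow> real) \<Rightarrow> real^'n" where
  "subvec F w = (\<chi> i. if i \<in> F then w i else 0)"

lemma borel_measurable_vec_lambda: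
  assumes "\<And>i. (\<lambda>x. f x i) \<in> borel_measurable M"
  shows "(\<lambda>x. (\<chi> i. f x i) :: real^'n) \<in> borel_measurable M"
  using assms by (subst borel_measurable_euclidean_space) (auto simp: Basis_vec_def inner_axis)

lemma borel_measurable_mat_lambda:
  assumes "\<And>i j. (\<lambda>x. f x i j) \<in> borel_measurable M"
  shows "(\<lambda>x. (\<chi> i j. f x i j) :: real^'n^'m) \<in> borel_measurable M"
  using assms by (subst borel_measurable_euclidean_space) (auto simp: Basis_vec_def inner_axis)

lemma measurable_subvec_superset:
  assumes "F \<subseteq> K"
  shows "subvec F \<in> borel_measurable (lborels K)"
  unfolding subvec_def
proof (rule borel_measurable_vec_lambda)
  show "(\<lambda>x. if i \<in> F then x i else 0) \<in> borel_measurable (lborels K)" for i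
    using assms by (cases "i \<in> F") auto
qed

lemmas measurable_subvec [measurable] = measurable_subvec_superset[OF subset_refl]

lemma matrix_vector_borel_measurable [measurable]:
  fixes B :: "real^'n^'m"
  shows "(\<lambda>x. B *v x) \<in> borel_measurable borel"
  by (intro linear_borel_measurable) simp

text \<open>
  The change of variables \<open>v = S w\<close> for the coordinates in \<open>F\<close> only. It follows from the case of
  all coordinates applied to an integrand that is independent of the remaining ones up to the indicator of
  a unit cube, since \<open>S\<close> acts on those as the identity.
\<close>

lemma nn_integral_subvec_linear:
  fixes S :: "real^'n^'n" and h :: "real^'n \<Rightarrow> ennreal"
  assumes S: "S \<in> spd" and Sfix: "\<And>k. k \<notin> F \<Longrightarrow> S *v axis k 1 = axis k 1"
    and h [measurable]: "h \<in> borel_measurable borel"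
  shows "(\<integral>\<^sup>+w. h (subvec F w) \<partial>lborels F)
    = ennreal (det S) * (\<integral>\<^sup>+w. h (S *v subvec F w) \<partial>lborels F)"
proof -
  define Q :: "(real^'n) set" where "Q = {x. \<forall>j\<in>-F. x $ j \<in> {0..1}}"
  have [measurable]: "Q \<in> sets borel"
  proof -
    have "Q = (\<Inter>j\<in>-F. {x. x $ j \<in> {0..1}})" by (auto simp: Q_def)
    also have "closed \<dots>"
      by (intro closed_INT ballI) (auto intro!: closed_Collect_conj closed_Collect_le continuous_intros)
    finally show ?thesis by (rule borel_closed)
  qed
  define pr :: "real^'n \<Rightarrow> real^'n" where "pr x = (\<chi> i. if i \<in> F then x $ i else 0)" for x
  have [measurable]: "pr \<in> borel_measurable borel"
    unfolding pr_def by (intro borel_measurable_vec_lambda) auto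
  define h' where "h' x = h (pr x) * indicator Q x" for x
  have h' [measurable]: "h' \<in> borel_measurable borel" unfolding h'_def by measurable
  have key: "(\<integral>\<^sup>+x. h' (B *v x) \<partial>vec.leb) = (\<integral>\<^sup>+w. h (B *v subvec F w) \<partial>lborels F)"
    if B: "B \<in> spd" and fixB: "\<And>k. k \<notin> F \<Longrightarrow> B *v axis k 1 = axis k 1" for B
  proof -
    have col: "B $ i $ k = (if i = k then 1 else 0)" if "k \<notin> F" for i k
      using fixB[OF that] by (simp add: matrix_vector_mult_basis) (auto simp: column_def vec_eq_iff axis_def)
    have row: "B $ k $ i = (if i = k then 1 else 0)" if "k \<notin> F" for i k
      using col[OF that, of i] spd_transpose[OF B] by (metis transpose_def vec_lambda_beta)
    have out: "(B *v x) $ i = x $ i" if "i \<notin> F" for x i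
      by (simp add: matrix_vector_mult_def row[OF that] if_distrib[of "\<lambda>y. y * _"] cong: if_cong)
    have inn: "(B *v x) $ i = (B *v (pr x)) $ i" if "i \<in> F" for x i
      unfolding matrix_vector_mult_def vec_lambda_beta
      using col that by (intro sum.cong) (auto simp: pr_def)
    have "(\<integral>\<^sup>+x. h' (B *v x) \<partial>vec.leb) = (\<integral>\<^sup>+x. h' (B *v (\<chi> i. x i)) \<partial>lborels (F \<union> -F))"
      by (simp add: vec.nn_integral_leb)
    also have "\<dots> = (\<integral>\<^sup>+w. (\<integral>\<^sup>+z. h' (B *v (\<chi> i. merge F (-F) (w, z) i)) \<partial>lborels (-F)) \<partial>lborels F)"
    proof (rule lborel_product.product_nn_integral_fold)
      have "(\<lambda>x. h' (B *v (\<chi> i. x i))) \<in> borel_measurable (lborels UNIV)"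
        using vec.e_measurable by measurable
      then show "(\<lambda>x. h' (B *v (\<chi> i. x i))) \<in> borel_measurable (lborels (F \<union> -F))" by simp
    qed auto
    also have "\<dots> = (\<integral>\<^sup>+w. (\<integral>\<^sup>+z. h (B *v subvec F w) * indicator (Pi\<^sub>E (-F) (\<lambda>_. {0..1::real})) z \<partial>lborels (-F)) \<partial>lborels F)"
    proof (intro nn_integral_cong)
      fix w z :: "'n \<Rightarrow> real" assume z: "z \<in> space (lborels (-F))"
      let ?x = "\<chi> i. merge F (-F) (w, z) i"
      have "pr ?x = subvec F w" by (auto simp: pr_def subvec_def vec_eq_iff merge_def)
      then have "pr (B *v ?x) $ i = (B *v subvec F w) $ i" for i
      proof (cases "i \<in> F")
        case True
        then show ?thesis using inn[of i ?x] \<open>pr ?x = subvec F w\<close> by (simp add: pr_def[of "B *v ?x"])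
      next
        case False
        then show ?thesis using out[of i "subvec F w"] by (simp add: pr_def[of "B *v ?x"]) (simp add: subvec_def)
      qed
      then have "pr (B *v ?x) = B *v subvec F w" by (simp add: vec_eq_iff)
      moreover have "indicator Q (B *v ?x) = (indicator (Pi\<^sub>E (-F) (\<lambda>_. {0..1::real})) z :: ennreal)"
        using z by (auto simp: indicator_def Q_def out space_PiM PiE_iff merge_def)
      ultimately show "h' (B *v ?x) = h (B *v subvec F w) * indicator (Pi\<^sub>E (-F) (\<lambda>_. {0..1::real})) z"
        by (simp add: h'_def)
    qed
    also have "\<dots> = (\<integral>\<^sup>+w. h (B *v subvec F w) \<partial>lborels F)"
    proof (intro nn_integral_cong)
      fix w
      have "emeasure (lborels (-F)) (Pi\<^sub>E (-F) (\<lambda>_. {0..1::real})) = 1"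
        by (subst lborel_product.emeasure_PiM) auto
      moreover have "Pi\<^sub>E (-F) (\<lambda>_. {0..1::real}) \<in> sets (lborels (-F))"
        by (intro sets_PiM_I_finite) auto
      ultimately show "(\<integral>\<^sup>+z. h (B *v subvec F w) * indicator (Pi\<^sub>E (-F) (\<lambda>_. {0..1::real})) z \<partial>lborels (-F)) = h (B *v subvec F w)"
        by (subst nn_integral_cmult_indicator) auto
    qed
    finally show ?thesis .
  qed
  have "(\<integral>\<^sup>+w. h (S *v subvec F w) \<partial>lborels F)
      = ennreal (1 / det S) * (\<integral>\<^sup>+w. h (subvec F w) \<partial>lborels F)"
    using key[OF S Sfix] key[OF spd_mat_1] vec.nn_integral_automorphism[OF vec_automorphism[OF spd_imp_invertible[OF S]] h']
    by (simp add: vec_scale_spd[OF S])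
  then show ?thesis
    using spd_det_pos[OF S] by (simp add: mult.assoc[symmetric] ennreal_mult''[symmetric])
qed

lemma sym_of_upper_measurable:
  "sym_of_upper \<in> borel_measurable (lborels {(i :: 'n::{finite,linorder}, j). i \<le> j})"
  unfolding sym_of_upper_def
proof (rule borel_measurable_mat_lambda)
  fix i j :: 'n
  show "(\<lambda>x. if i \<le> j then x (i, j) else x (j, i)) \<in> borel_measurable (lborels {(i :: 'n, j). i \<le> j})"
    by (cases "i \<le> j") (auto intro: measurable_component_singleton[where M="\<lambda>_. lborel", simplified])
qed

interpretation sym: coordinate_space "{(i :: 'n::{finite,linorder}, j). i \<le> j}" sym_of_upper
  "\<lambda>(i, j) X. X $ i $ j"
proof
  show "sym_of_upper \<in> borel_measurable (lborels {(i :: 'n, j). i \<le> j})"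
    by (rule sym_of_upper_measurable)
qed (auto simp: vec_eq_iff sym_of_upper_def intro!: linearI)

lemma sym_leb_eq: "sym.leb = sym_lborel"
  by (simp add: sym.leb_def sym_lborel_def)

lemma range_sym_of_upper: "X \<in> range sym_of_upper \<longleftrightarrow> transpose X = X"
  unfolding sym.V_iff by (auto simp: vec_eq_iff sym_of_upper_def transpose_def not_le less_imp_le)
     (metis linorder_neqE)

lemma linear_congruence:
  fixes B :: "real^'n^'n"
  shows "linear (\<lambda>X. B ** X ** transpose B)"
  by (intro linearI)
     (simp_all add: matrix_add_ldistrib matrix_add_rdistrib' scalar_matrix_assoc matrix_scalar_ac scalar_mult_eq_scaleR)

lemma congruence_mult: "(B ** C) ** X ** transpose (B ** C) = B ** (C ** X ** transpose C) ** transpose (B :: real^'n^'n)"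
  by (simp add: matrix_transpose_mul matrix_mul_assoc)

lemma sym_automorphism:
  fixes B :: "real^'n::{finite,linorder}^'n::_"
  assumes "invertible B"
  shows "sym.automorphism (\<lambda>X. B ** X ** transpose B)"
proof -
  note I = matrix_inv_mult[OF assms]
  have V: "\<forall>X\<in>range sym_of_upper. C ** X ** transpose C \<in> range sym_of_upper" for C :: "'n square"
    unfolding range_sym_of_upper by (simp add: matrix_transpose_mul matrix_mul_assoc range_sym_of_upper)
  show ?thesis unfolding sym.automorphism_def
  proof (intro conjI exI[of _ "\<lambda>X. matrix_inv B ** X ** transpose (matrix_inv B)"])
    show "\<forall>X. matrix_inv B ** (B ** X ** transpose B) ** transpose (matrix_inv B) = X"
      "\<forall>X. B ** (matrix_inv B ** X ** transpose (matrix_inv B)) ** transpose B = X"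
      by (simp_all add: congruence_mult[symmetric] I)
  qed (rule V linear_congruence)+
qed

text \<open>
  The pairs \<open>i \<le> j\<close> and \<open>j < i\<close> together give all pairs, and the two products differ by the diagonal;
  this determines the square of the product over the pairs \<open>i \<le> j\<close>.
\<close>

lemma prod_upper_pairs:
  fixes d :: "'n::{finite,linorder} \<Rightarrow> real"
  assumes d: "\<And>i. d i > 0"
  shows "(\<Prod>(i, j)\<in>{(i, j). i \<le> j}. d i * d j) = (\<Prod>i\<in>UNIV. d i) ^ (CARD('n) + 1)"
proof -
  let ?le = "{(i :: 'n, j). i \<le> j}" and ?gt = "{(i :: 'n, j). j < i}"
  define P where "P = (\<Prod>i\<in>UNIV. d i)"
  let ?f = "\<lambda>(i, j). d i * d j"
  have eq: "prod ?f ?le = prod ?f {(i, j). j \<le> i}"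
    by (rule prod.reindex_bij_witness[of _ prod.swap prod.swap]) auto
  have split: "{(i, j). j \<le> i} = ?gt \<union> (\<lambda>i. (i, i)) ` UNIV" by auto
  have "prod ?f {(i, j). j \<le> i} = prod ?f ?gt * prod ?f ((\<lambda>i. (i, i)) ` UNIV)"
    unfolding split by (rule prod.union_disjoint) auto
  also have "prod ?f ((\<lambda>i. (i, i)) ` UNIV) = P^2"
    by (subst prod.reindex) (auto simp: inj_on_def prod.distrib P_def power2_eq_square)
  finally have 1: "prod ?f ?le = prod ?f ?gt * P^2" using eq by simp
  have "prod ?f ?le * prod ?f ?gt = prod ?f (?le \<union> ?gt)"
    by (rule prod.union_disjoint[symmetric]) auto
  also have "?le \<union> ?gt = UNIV \<times> UNIV" by auto
  also have "prod ?f (UNIV \<times> UNIV) = (\<Prod>i\<in>UNIV. \<Prod>j\<in>UNIV. d i * d j)"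
    by (rule prod.cartesian_product[symmetric])
  also have "\<dots> = (P ^ CARD('n))^2"
    by (simp add: prod.distrib P_def prod_power_distrib power2_eq_square)
  finally have 2: "prod ?f ?le * prod ?f ?gt = (P ^ CARD('n))^2" .
  have "P > 0" unfolding P_def using d by (simp add: prod_pos)
  have "(prod ?f ?le)^2 = prod ?f ?le * (prod ?f ?gt * P^2)"
    by (subst 1[symmetric]) (rule power2_eq_square)
  also have "\<dots> = (P ^ CARD('n))^2 * P^2" by (simp only: 2[symmetric] mult.assoc)
  also have "\<dots> = (P ^ (CARD('n) + 1))^2" by (simp add: power_mult_distrib)
  finally have "(prod ?f ?le)^2 = (P ^ (CARD('n) + 1))^2" .
  moreover have "prod ?f ?le \<ge> 0" using d by (intro prod_nonneg) (auto simp: less_imp_le)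
  moreover have "P ^ (CARD('n) + 1) \<ge> 0" using \<open>P > 0\<close> by simp
  ultimately show ?thesis unfolding P_def by (simp only: power2_eq_iff_nonneg)
qed

lemma sym_scale_diag_conjugate:
  fixes U :: "real^'n::{finite,linorder}^'n::_"
  assumes U: "orthogonal_matrix U" and d: "\<And>i. d i > 0"
  defines "S \<equiv> U ** diag d ** transpose U"
  shows "sym.scale (\<lambda>X. S ** X ** transpose S) = 1 / det S ^ (CARD('n) + 1)"
proof -
  have iD: "invertible (diag d)" using d by (simp add: diag_spd_iff spd_imp_invertible)
  have "det U * det U = 1"
    using U by (metis det_I det_mul det_transpose orthogonal_matrix_def)
  then have det: "det S = (\<Prod>i\<in>UNIV. d i)" by (simp add: S_def det_mul det_diag)
  have "sym.scale (\<lambda>X. S ** X ** transpose S) = sym.scale (\<lambda>X. diag d ** X ** transpose (diag d))"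
    unfolding S_def by (rule sym.scale_spd_representation[of "\<lambda>B X. B ** X ** transpose B"])
      (auto simp only: sym_automorphism congruence_mult U iD transpose_mat matrix_mul_lid matrix_mul_rid)
  also have "\<dots> = 1 / det S ^ (CARD('n) + 1)"
  proof (rule sym.scale_eqI)
    let ?L = "\<lambda>X. diag d ** X ** transpose (diag d)"
    let ?I = "{(i :: 'n, j). i \<le> j}"
    have ent: "(diag d ** X ** diag d) $ i $ j = d i * d j * X $ i $ j" for X i j
      by (simp add: matrix_matrix_mult_def diag_def if_distrib[of "\<lambda>y. y * _"] if_distrib[of "\<lambda>y. _ * y"] cong: if_cong)
    have "?L -` sym.box 1 = {X. \<forall>i\<in>?I. (case i of (i, j) \<Rightarrow> \<lambda>X. X $ i $ j) X \<in> (case i of (i, j) \<Rightarrow> {-1 / (d i * d j) .. 1 / (d i * d j)})}"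
      using d by (auto simp: sym.box_def ent field_simps simp del: mult.assoc)
    then have "emeasure sym.leb (?L -` sym.box 1)
        = (\<Prod>(i,j)\<in>?I. emeasure lborel {-1 / (d i * d j) .. 1 / (d i * d j)})"
      by (simp only:) (subst sym.emeasure_leb_box, auto simp: case_prod_unfold)
    also have "\<dots> = (\<Prod>(i,j)\<in>?I. ennreal (2 / (d i * d j)))"
      using d by (intro prod.cong) (auto simp: less_imp_le field_simps)
    also have "\<dots> = ennreal (\<Prod>(i,j)\<in>?I. 2 / (d i * d j))"
      using d by (simp add: case_prod_unfold) (intro prod_ennreal, simp add: less_imp_le)
    also have "(\<Prod>(i,j)\<in>?I. 2 / (d i * d j)) = 2 ^ card ?I / det S ^ (CARD('n) + 1)"
      unfolding det prod_upper_pairs[of d, OF d, symmetric] by (simp add: case_prod_unfold prod_dividef)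
    also have "ennreal \<dots> = ennreal (1 / det S ^ (CARD('n) + 1)) * emeasure sym.leb (sym.box 1 :: ('n square) set)"
      using d by (simp add: sym.emeasure_box ennreal_mult''[symmetric])
    finally show "emeasure sym.leb (?L -` sym.box 1) = ennreal (1 / det S ^ (CARD('n) + 1)) * emeasure sym.leb (sym.box 1 :: ('n square) set)" .
    show "0 \<le> 1 / det S ^ (CARD('n) + 1)" using d by (simp add: det prod_nonneg less_imp_le)
  qed
  finally show ?thesis .
qed

section \<open>Bordered matrices\<close>

definition outer :: "real^'n \<Rightarrow> real^'n \<Rightarrow> real^'n^'n" where
  "outer u v = (\<chi> i j. u $ i * v $ j)"

lemma
  fixes A :: "real^'n^'n"
  shows outer_mult_right: "A ** outer u v = outer (A *v u) v"
    and outer_mult_left: "outer u v ** A = outer u (transpose A *v v)"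
    and outer_vec: "outer u v *v x = (v \<bullet> x) *\<^sub>R u"
    and transpose_outer: "transpose (outer u v) = outer v u"
    and outer_scale_left: "outer (c *\<^sub>R u) v = c *\<^sub>R outer u v"
    and outer_add_left: "outer (u + u') v = outer u v + outer u' v"
    and outer_diff_left: "outer (u - u') v = outer u v - outer u' v"
    and trace_outer: "trace (outer u v) = u \<bullet> v"
  by (simp_all add: outer_def vec_eq_iff matrix_matrix_mult_def matrix_vector_mult_def transpose_def
      sum_distrib_left sum_distrib_right trace_def inner_vec_def algebra_simps)

lemma scaleR_matrix_mult:
  fixes A B :: "real^'n^'n"
  shows "(c *\<^sub>R A) ** B = c *\<^sub>R (A ** B)" "A ** (c *\<^sub>R B) = c *\<^sub>R (A ** B)"
  by (simp_all add: vec_eq_iff matrix_matrix_mult_def sum_distrib_left mult_ac)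

lemma scaleR_matrix_vector: "(c *\<^sub>R (A :: real^'n^'n)) *v x = c *\<^sub>R (A *v x)"
  by (simp add: vec_eq_iff matrix_vector_mult_def sum_distrib_left mult_ac)

lemma transpose_add: "transpose (A + B) = transpose A + transpose (B :: real^'n^'n)"
  by (simp add: vec_eq_iff transpose_def)

lemma trace_scaleR: "trace (c *\<^sub>R A) = c * trace (A :: real^'n^'n)"
  by (simp add: trace_def sum_distrib_left)

text \<open>
  The border of \<open>S\<close> replaces row and column \<open>k\<close>, so that \<open>S\<close> and the bordered matrix have the same type.
  A block on an index set \<open>F\<close> is represented by the matrix that is the identity outside \<open>F\<close>.
\<close>

definition bordered :: "'n \<Rightarrow> real^'n^'n \<Rightarrow> real^'n \<Rightarrow> real \<Rightarrow> real^'n^'n" where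
  "bordered k S v t =
     (\<chi> i j. if i = k then (if j = k then t else v $ j) else if j = k then v $ i else S $ i $ j)"

context
  fixes S :: "real^'n^'n" and k :: 'n
  assumes sym: "transpose S = S" and Se: "S *v axis k 1 = axis k 1"
begin

lemma fixed_axis_entries:
  "S $ i $ k = (if i = k then 1 else 0)" "S $ k $ i = (if i = k then 1 else 0)"
proof -
  show *: "S $ i $ k = (if i = k then 1 else 0)" for i
    using Se by (simp add: matrix_vector_mult_basis) (auto simp: column_def vec_eq_iff axis_def)
  then show "S $ k $ i = (if i = k then 1 else 0)"
    using sym by (metis transpose_def vec_lambda_beta)
qed

lemma bordered_eq_sum:
  assumes "v $ k = 0"
  shows "bordered k S v t = S + (t - 1) *\<^sub>R outer (axis k 1) (axis k 1) + outer (axis k 1) v + outer v (axis k 1)"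
  using assms by (auto simp: bordered_def vec_eq_iff outer_def axis_def fixed_axis_entries)

text \<open>
  Gaussian elimination: in these coordinates the border is removed by a unipotent congruence, which leaves
  the Schur complement \<open>y\<close> in the corner.
\<close>

lemma bordered_mult_congruence:
  assumes "w $ k = 0"
  defines "U \<equiv> mat 1 + outer (axis k 1) w"
  shows "bordered k S (S *v w) (y + w \<bullet> (S *v w)) = U ** bordered k S 0 y ** transpose U"
proof -
  have we: "w \<bullet> axis k 1 = 0" "axis k 1 \<bullet> w = 0" using assms by (simp_all add: inner_axis inner_axis')
  have "(S *v w) $ k = axis k 1 \<bullet> (S *v w)" by (simp add: inner_axis')
  also have "\<dots> = 0" by (simp add: inner_symmetric_matrix[OF sym] Se we)
  finally have Sw: "(S *v w) $ k = 0" .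
  have Z: "bordered k S 0 y = S + (y - 1) *\<^sub>R outer (axis k 1) (axis k 1)"
    by (subst bordered_eq_sum) (simp_all add: outer_def vec_eq_iff)
  let ?e = "axis k 1 :: real^'n" and ?Z = "bordered k S 0 y"
  have Zw: "?Z *v w = S *v w" unfolding Z
    by (simp add: matrix_vector_mult_add_rdistrib scaleR_matrix_vector outer_vec we)
  have "transpose ?Z = ?Z" using sym by (auto simp: bordered_def transpose_def vec_eq_iff)
  then have "U ** ?Z = ?Z + outer ?e (S *v w)"
    unfolding U_def using outer_mult_left[of ?e w ?Z] by (simp add: matrix_add_rdistrib' Zw del: transpose_matrix_vector)
  then have "U ** ?Z ** transpose U = (?Z + outer ?e (S *v w)) ** (mat 1 + outer w ?e)"
    by (simp add: U_def transpose_add transpose_outer)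
  also have "\<dots> = ?Z + outer ?e (S *v w) + outer (S *v w + ((S *v w) \<bullet> w) *\<^sub>R ?e) ?e"
    by (simp add: matrix_add_ldistrib outer_mult_right matrix_vector_mult_add_rdistrib outer_vec Zw)
  also have "\<dots> = bordered k S (S *v w) (y + w \<bullet> (S *v w))"
    unfolding bordered_eq_sum[OF Sw] Z by (simp add: outer_add_left outer_scale_left inner_commute algebra_simps)
  finally show ?thesis by simp
qed

lemma unit_shear_inverse:
  assumes "w $ k = 0"
  shows "(mat 1 + outer (axis k 1) w) ** (mat 1 - outer (axis k 1) w) = mat 1"
    and "(mat 1 - outer (axis k 1) w) ** (mat 1 + outer (axis k 1) w) = mat 1"
    and "det (mat 1 + outer (axis k 1) w) = 1"
proof -
  have we: "w \<bullet> axis k 1 = 0" using assms by (simp add: inner_axis)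
  have [simp]: "outer (axis k 1) 0 = 0" by (simp add: outer_def vec_eq_iff)
  show 1: "(mat 1 + outer (axis k 1) w) ** (mat 1 - outer (axis k 1) w) = mat 1"
    by (simp add: matrix_sub_ldistrib' matrix_add_rdistrib' outer_mult_right matrix_vector_mult_add_rdistrib outer_vec we)
  then show "(mat 1 - outer (axis k 1) w) ** (mat 1 + outer (axis k 1) w) = mat 1"
    using matrix_left_right_inverse by blast
  let ?I = "mat 1 :: real^'n^'n"
  have "w = (\<Sum>j\<in>UNIV. w $ j *\<^sub>R row j ?I)"
    by (simp add: vec_eq_iff row_def mat_def if_distrib cong: if_cong)
  also have "\<dots> \<in> vec.span {row j ?I |j. j \<noteq> k}"
  proof (rule vec.span_sum)
    fix j
    show "w $ j *\<^sub>R row j ?I \<in> vec.span {row j ?I |j. j \<noteq> k}"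
    proof (cases "j = k")
      case True then show ?thesis using assms vec.span_zero by simp
    next
      case False
      then have "w $ j *s row j ?I \<in> vec.span {row j ?I |j. j \<noteq> k}"
        by (intro vec.span_scale vec.span_base) auto
      then show ?thesis by (simp add: scalar_mult_eq_scaleR)
    qed
  qed
  finally have "det (\<chi> i. if i = k then row k ?I + w else row i ?I) = det ?I"
    by (rule det_row_span)
  moreover have "(\<chi> i. if i = k then row k ?I + w else row i ?I) = mat 1 + outer (axis k 1) w"
    by (auto simp: vec_eq_iff outer_def axis_def row_def)
  ultimately show "det (mat 1 + outer (axis k 1) w) = 1" by simp
qed

lemma bordered_zero_quadratic_form:
  "x \<bullet> (bordered k S 0 y *v x) = (x - x $ k *\<^sub>R axis k 1) \<bullet> (S *v (x - x $ k *\<^sub>R axis k 1)) + y * (x $ k)^2"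
proof -
  have Z: "bordered k S 0 y = S + (y - 1) *\<^sub>R outer (axis k 1) (axis k 1)"
    by (subst bordered_eq_sum) (simp_all add: outer_def vec_eq_iff)
  have 1: "axis k 1 \<bullet> (S *v x) = x $ k" "(S *v x) \<bullet> axis k 1 = x $ k" for x
  proof -
    show "axis k 1 \<bullet> (S *v x) = x $ k"
      by (subst inner_symmetric_matrix[OF sym]) (simp add: Se inner_axis')
    then show "(S *v x) \<bullet> axis k 1 = x $ k" by (simp add: inner_commute)
  qed
  show ?thesis unfolding Z
    by (simp add: matrix_vector_mult_add_rdistrib scaleR_matrix_vector outer_vec matrix_vector_mult_diff_distrib
        matrix_vector_mult_scaleR Se inner_simps 1 axis_nth inner_axis[of x] inner_axis'[of _ _ x] inner_axis_axis power2_eq_square algebra_simps)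
qed

lemma bordered_zero_spd_iff:
  assumes S: "S \<in> spd"
  shows "bordered k S 0 y \<in> spd \<longleftrightarrow> y > 0"
proof
  assume "bordered k S 0 y \<in> spd"
  then have "axis k 1 \<bullet> (bordered k S 0 y *v axis k 1) > 0" by (simp add: spd_def axis_eq_0_iff)
  then show "y > 0" unfolding bordered_zero_quadratic_form by simp
next
  assume y: "y > 0"
  have "x \<bullet> (bordered k S 0 y *v x) > 0" if x: "x \<noteq> 0" for x
  proof -
    let ?z = "x - x $ k *\<^sub>R axis k 1"
    have nn: "?z \<bullet> (S *v ?z) \<ge> 0" "y * (x $ k)^2 \<ge> 0"
      using S y by (cases "?z = 0"; simp add: spd_def less_imp_le)+
    show ?thesis
    proof (cases "x $ k = 0")
      case True
      then show ?thesis unfolding bordered_zero_quadratic_form using S x by (simp add: spd_def)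
    next
      case False
      then have "y * (x $ k)^2 > 0" using y by simp
      then show ?thesis unfolding bordered_zero_quadratic_form using nn by linarith
    qed
  qed
  moreover have "transpose (bordered k S 0 y) = bordered k S 0 y"
    using sym by (auto simp: bordered_def transpose_def vec_eq_iff)
  ultimately show "bordered k S 0 y \<in> spd" by (simp add: spd_def)
qed

lemma bordered_spd_iff:
  assumes S: "S \<in> spd" and w: "w $ k = 0"
  shows "bordered k S (S *v w) (y + w \<bullet> (S *v w)) \<in> spd \<longleftrightarrow> y > 0"
proof -
  have "invertible (mat 1 + outer (axis k 1) w)"
    using unit_shear_inverse[OF w] invertible_def by blast
  then show ?thesis
    unfolding bordered_mult_congruence[OF w] by (simp add: spd_congruence_iff bordered_zero_spd_iff[OF S])
qed

lemma det_bordered: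
  assumes w: "w $ k = 0"
  shows "det (bordered k S (S *v w) (y + w \<bullet> (S *v w))) = det S * y"
proof -
  have "bordered k S 0 y = S ** diag (\<lambda>i. if i = k then y else 1)"
  proof -
    have "(S ** diag (\<lambda>i. if i = k then y else 1)) $ i $ j = S $ i $ j * (if j = k then y else 1)" for i j
      by (simp add: matrix_matrix_mult_def diag_def if_distrib cong: if_cong)
    then show ?thesis by (auto simp: vec_eq_iff bordered_def fixed_axis_entries)
  qed
  then have "det (bordered k S 0 y) = det S * y"
    by (simp add: det_mul det_diag prod.If_cases)
  then show ?thesis
    unfolding bordered_mult_congruence[OF w] using unit_shear_inverse(3)[OF w] by (simp add: det_mul)
qed

text \<open>
  Besides the entry \<open>1 / y\<close> of the Schur complement (where the inverse of \<open>S\<close> has \<open>1\<close>) the trace picks up the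
  square length of the column \<open>w\<close>, which becomes the exponent of a Gaussian.
\<close>

lemma trace_inv_bordered:
  assumes S: "S \<in> spd" and w: "w $ k = 0" and y: "y > 0"
  shows "trace (matrix_inv (bordered k S (S *v w) (y + w \<bullet> (S *v w)))) =
    trace (matrix_inv S) + (1 / y - 1) + (w \<bullet> w) / y"
proof -
  let ?e = "axis k 1 :: real^'n"
  let ?Z = "bordered k S 0 y" and ?U = "mat 1 + outer ?e w" and ?U' = "mat 1 - outer ?e w"
  let ?Zi = "matrix_inv S + (1 / y - 1) *\<^sub>R outer ?e ?e"
  have we: "w \<bullet> ?e = 0" "?e \<bullet> w = 0" using w by (simp_all add: inner_axis inner_axis')
  note I = matrix_inv_mult[OF spd_imp_invertible[OF S]]
  have Sie: "matrix_inv S *v ?e = ?e"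
    using I(2) Se by (metis matrix_vector_mul_assoc matrix_vector_mul_lid)
  have Sit: "transpose (matrix_inv S) = matrix_inv S"
    using spd_matrix_inv[OF S] by (simp add: spd_transpose)
  have Z: "?Z = S + (y - 1) *\<^sub>R outer ?e ?e"
    by (subst bordered_eq_sum) (simp_all add: outer_def vec_eq_iff)
  have c: "(1 / y - 1) + ((y - 1) + (y - 1) * (1 / y - 1)) = 0" using y by (simp add: field_simps)
  have "(S + a *\<^sub>R outer ?e ?e) ** (matrix_inv S + b *\<^sub>R outer ?e ?e) = mat 1 + (b + (a + a * b)) *\<^sub>R outer ?e ?e" for a b
  proof -
    have "outer ?e ?e ** matrix_inv S = outer ?e ?e"
      using outer_mult_left[of ?e ?e "matrix_inv S"] by (simp only: Sit Sie)
    then show ?thesis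
      by (simp add: matrix_add_ldistrib matrix_add_rdistrib' scaleR_matrix_mult outer_mult_right I Se
          outer_vec inner_axis_axis scaleR_matrix_vector outer_add_left outer_scale_left algebra_simps)
  qed
  then have "?Z ** ?Zi = mat 1 + ((1 / y - 1) + ((y - 1) + (y - 1) * (1 / y - 1))) *\<^sub>R outer ?e ?e"
    unfolding Z .
  then have ZZi: "?Z ** ?Zi = mat 1" unfolding c by simp
  have "(?U ** ?Z ** transpose ?U) ** (transpose ?U' ** ?Zi ** ?U')
      = ?U ** ?Z ** transpose (?U' ** ?U) ** ?Zi ** ?U'"
    by (simp add: matrix_transpose_mul matrix_mul_assoc)
  also have "\<dots> = ?U ** (?Z ** ?Zi) ** ?U'" by (simp add: unit_shear_inverse[OF w] matrix_mul_assoc)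
  also have "\<dots> = mat 1" by (simp add: ZZi unit_shear_inverse[OF w])
  finally have "matrix_inv (?U ** ?Z ** transpose ?U) = transpose ?U' ** ?Zi ** ?U'"
    by (rule matrix_inv_unique)
  then have "trace (matrix_inv (?U ** ?Z ** transpose ?U)) = trace (?Zi ** (?U' ** transpose ?U'))"
    by (metis matrix_mul_assoc trace_mul_sym)
  also have "transpose ?U' = mat 1 - outer w ?e"
    by (simp add: vec_eq_iff transpose_def outer_def mat_def)
  also have "?U' ** (mat 1 - outer w ?e) = mat 1 - outer w ?e - outer ?e w + (w \<bullet> w) *\<^sub>R outer ?e ?e"
    by (simp add: matrix_sub_ldistrib' matrix_sub_rdistrib' outer_mult_right matrix_vector_mult_diff_rdistrib
        outer_vec outer_diff_left outer_scale_left)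
  also have "trace (?Zi ** (mat 1 - outer w ?e - outer ?e w + (w \<bullet> w) *\<^sub>R outer ?e ?e)) =
     trace ?Zi - (?Zi *v w) \<bullet> ?e - (?Zi *v ?e) \<bullet> w + (w \<bullet> w) * ((?Zi *v ?e) \<bullet> ?e)"
    by (simp only: matrix_sub_ldistrib' matrix_add_ldistrib scaleR_matrix_mult outer_mult_right trace_add trace_sub
        trace_outer trace_scaleR matrix_mul_rid)
  also have "?Zi *v ?e = (1 / y) *\<^sub>R ?e"
    by (simp add: matrix_vector_mult_add_rdistrib Sie scaleR_matrix_vector outer_vec inner_axis_axis algebra_simps)
  also have "(?Zi *v w) \<bullet> ?e = 0"
    using inner_symmetric_matrix[OF Sit, of w ?e]
    by (simp add: matrix_vector_mult_add_rdistrib scaleR_matrix_vector outer_vec we inner_simps Sie)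
  also have "trace ?Zi = trace (matrix_inv S) + (1 / y - 1)"
    by (simp add: trace_add trace_scaleR trace_outer inner_axis_axis)
  finally show ?thesis unfolding bordered_mult_congruence[OF w] by (simp add: we inner_axis_axis)
qed

lemma bordered_spd_imp_spd:
  assumes X: "bordered k S v t \<in> spd"
  shows "S \<in> spd"
proof -
  have "x \<bullet> (S *v x) > 0" if x: "x \<noteq> 0" for x
  proof -
    let ?z = "x - x $ k *\<^sub>R axis k 1"
    have zk: "?z $ k = 0" by simp
    have eq: "?z \<bullet> (bordered k S v t *v ?z) = ?z \<bullet> (S *v ?z)"
    proof -
      have "(bordered k S v t *v ?z) $ i = (S *v ?z) $ i" if "i \<noteq> k" for i
        unfolding matrix_vector_mult_def vec_lambda_beta using that zk
        by (intro sum.cong) (auto simp: bordered_def)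
      then have "?z $ i \<bullet> (bordered k S v t *v ?z) $ i = ?z $ i \<bullet> (S *v ?z) $ i" for i
        using zk by (cases "i = k") (simp_all del: vector_minus_component)
      then show ?thesis unfolding inner_vec_def by (intro sum.cong refl)
    qed
    have eq2: "x \<bullet> (S *v x) = ?z \<bullet> (S *v ?z) + (x $ k)^2"
    proof -
      have "bordered k S 0 1 = S" by (auto simp: bordered_def vec_eq_iff fixed_axis_entries)
      then show ?thesis using bordered_zero_quadratic_form[of x 1] by simp
    qed
    show ?thesis
    proof (cases "?z = 0")
      case True
      then have "x $ k \<noteq> 0" using x by (metis diff_zero eq_iff_diff_eq_0 scaleR_zero_left)
      then show ?thesis unfolding eq2 True by simp
    next
      case False
      then have "?z \<bullet> (bordered k S v t *v ?z) > 0" using X unfolding spd_def by blast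
      then have "?z \<bullet> (S *v ?z) > 0" using eq by simp
      then show ?thesis unfolding eq2 by (simp add: add_pos_nonneg)
    qed
  qed
  then show ?thesis using sym by (simp add: spd_def)
qed

end

section \<open>One-dimensional integrals and coordinates of symmetric blocks\<close>

text \<open>
  The unnormalised density of the reciprocal of a Gamma variable with shape \<open>s\<close> and rate \<open>1 / 2\<close>.
\<close>

definition inv_gamma :: "real \<Rightarrow> real \<Rightarrow> real" where
  "inv_gamma s y = (if y > 0 then y powr (- (s + 1)) * exp (- 1 / (2 * y)) else 0)"

lemma inv_gamma_nonneg: "inv_gamma s y \<ge> 0"
  by (simp add: inv_gamma_def)

lemma inv_gamma_measurable [measurable]: "inv_gamma s \<in> borel_measurable borel"
  unfolding inv_gamma_def by measurable

lemma inv_gamma_powr: "y > 0 \<Longrightarrow> inv_gamma s y * y powr a = inv_gamma (s - a) y"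
  by (simp add: inv_gamma_def powr_add[symmetric] algebra_simps)

text \<open>
  The substitution \<open>t = 1 / (2 * y)\<close> in Euler's integral.
\<close>

lemma nn_integral_inv_gamma:
  assumes s: "s > 0"
  shows "(\<integral>\<^sup>+y. ennreal (inv_gamma s y) \<partial>lborel) = ennreal (2 powr s * Gamma s)"
proof -
  define f where "f t = t powr (s - 1) / exp t" for t :: real
  let ?S = "{0<..} :: real set"
  have "(f has_integral Gamma s) {0..}" unfolding f_def by (rule Gamma_integral_real[OF s])
  moreover have "negligible {x \<in> {0..} - ?S. f x \<noteq> 0}" "negligible {x \<in> ?S - {0..}. f x \<noteq> 0}"
    by (rule negligible_subset[of "{0}"], simp, force)+
  ultimately have int: "(f has_integral Gamma s) ?S"
    using has_integral_spike_set_eq[of "{0..}" ?S f] by blast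
  have f0: "f t \<ge> 0" for t by (simp add: f_def)
  have abs: "f absolutely_integrable_on ?S"
    using int f0 by (intro nonnegative_absolutely_integrable_1) (auto simp: integrable_on_def)
  define g where "g y = 1 / (2 * y)" for y :: real
  have img: "g ` ?S = ?S"
  proof
    show "?S \<subseteq> g ` ?S"
    proof
      fix y :: real assume "y \<in> ?S"
      then have "y = g (1 / (2 * y))" "1 / (2 * y) \<in> ?S" by (auto simp: g_def)
      then show "y \<in> g ` ?S" by blast
    qed
  qed (auto simp: g_def)
  have "(\<lambda>y. \<bar>- 1 / (2 * y^2)\<bar> * f (g y)) absolutely_integrable_on ?S \<and>
    integral ?S (\<lambda>y. \<bar>- 1 / (2 * y^2)\<bar> * f (g y)) = Gamma s"
  proof (subst has_absolute_integral_change_of_variables_1'[where g = g])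
    show "(g has_real_derivative - 1 / (2 * y^2)) (at y within ?S)" if "y \<in> ?S" for y
      unfolding g_def using that
      by (auto intro!: derivative_eq_intros simp: power2_eq_square field_simps)
    show "inj_on g ?S" by (auto simp: inj_on_def g_def)
    show "f absolutely_integrable_on g ` ?S \<and> integral (g ` ?S) f = Gamma s"
      unfolding img using abs int by (simp add: integral_unique)
  qed auto
  then have "((\<lambda>y. \<bar>- 1 / (2 * y^2)\<bar> * f (g y)) has_integral Gamma s) ?S"
    using set_lebesgue_integral_eq_integral(1) by (metis has_integral_integral)
  then have "(\<integral>\<^sup>+y. ennreal (indicator ?S y * (\<bar>- 1 / (2 * y^2)\<bar> * f (g y))) \<partial>lborel) = ennreal (Gamma s)"
    by (intro nn_integral_has_integral_lebesgue) (auto simp: f0)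
  moreover have "indicator ?S y * (\<bar>- 1 / (2 * y^2)\<bar> * f (g y)) = 2 powr (- s) * inv_gamma s y" for y
  proof (cases "y > 0")
    case True
    have "(1 / (2 * y)) powr (s - 1) = 2 powr (1 - s) * y powr (1 - s)"
      using True by (simp add: powr_divide powr_mult powr_diff field_simps)
    moreover have "y powr (1 - s) / y^2 = y powr (- (s + 1))"
      using True powr_realpow[of y 2] by (simp add: powr_diff powr_add powr_minus field_simps power2_eq_square)
    moreover have "2 powr (1 - s) / 2 = (2 powr (- s) :: real)" by (simp add: powr_diff powr_minus field_simps)
    ultimately show ?thesis using True
      by (simp add: f_def g_def inv_gamma_def exp_minus field_simps)
  qed (simp add: inv_gamma_def)
  ultimately have "ennreal (2 powr (- s)) * (\<integral>\<^sup>+y. ennreal (inv_gamma s y) \<partial>lborel) = ennreal (Gamma s)"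
    by (simp add: ennreal_mult inv_gamma_nonneg nn_integral_cmult)
  then have "ennreal (2 powr s) * (ennreal (2 powr (- s)) * (\<integral>\<^sup>+y. ennreal (inv_gamma s y) \<partial>lborel))
      = ennreal (2 powr s) * ennreal (Gamma s)" by simp
  then show ?thesis
    using s by (simp add: mult.assoc[symmetric] ennreal_mult''[symmetric] powr_add[symmetric] Gamma_real_pos less_imp_le)
qed

lemma nn_integral_gaussian:
  assumes y: "y > 0"
  shows "(\<integral>\<^sup>+w. ennreal (exp (- (w^2) / (2 * y))) \<partial>lborel) = ennreal (sqrt (2 * pi * y))"
    and "(\<integral>\<^sup>+w. ennreal (w^2 * exp (- (w^2) / (2 * y))) \<partial>lborel) = ennreal (y * sqrt (2 * pi * y))"
proof -
  have *: "(\<integral>\<^sup>+w. ennreal (w^(2*k) * exp (- (w^2) / (2 * y))) \<partial>lborel) =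
    ennreal (sqrt (2 * pi * y) * (fact (2 * k) / ((2 / y) ^ k * fact k)))" for k :: nat
  proof -
    have "has_bochner_integral lborel (\<lambda>x. normal_density 0 (sqrt y) x * (x - 0) ^ (2 * k))
     (fact (2 * k) / ((2 / (sqrt y)\<^sup>2) ^ k * fact k))"
      using y by (intro normal_moment_even) auto
    then have 1: "(\<integral>\<^sup>+x. ennreal (normal_density 0 (sqrt y) x * x ^ (2 * k)) \<partial>lborel) = ennreal (fact (2 * k) / ((2 / y) ^ k * fact k))"
      using y by (subst nn_integral_eq_integral) (auto simp: has_bochner_integral_iff power_mult)
    have "ennreal (w^(2*k) * exp (- (w^2) / (2 * y))) =
        ennreal (sqrt (2 * pi * y)) * ennreal (normal_density 0 (sqrt y) w * w ^ (2 * k))" for w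
      using y by (subst ennreal_mult[symmetric]) (auto simp: normal_density_def power_mult)
    then have "(\<integral>\<^sup>+w. ennreal (w^(2*k) * exp (- (w^2) / (2 * y))) \<partial>lborel) =
        ennreal (sqrt (2 * pi * y)) * (\<integral>\<^sup>+x. ennreal (normal_density 0 (sqrt y) x * x ^ (2 * k)) \<partial>lborel)"
      by (simp only:) (rule nn_integral_cmult, simp)
    also have "\<dots> = ennreal (sqrt (2 * pi * y)) * ennreal (fact (2 * k) / ((2 / y) ^ k * fact k))"
      by (simp only: 1)
    finally show ?thesis using y by (subst ennreal_mult) auto
  qed
  show "(\<integral>\<^sup>+w. ennreal (exp (- (w^2) / (2 * y))) \<partial>lborel) = ennreal (sqrt (2 * pi * y))"
    using *[of 0] by simp
  show "(\<integral>\<^sup>+w. ennreal (w^2 * exp (- (w^2) / (2 * y))) \<partial>lborel) = ennreal (y * sqrt (2 * pi * y))"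
    using *[of 1] by (simp add: fact_numeral numeral_2_eq_2 mult.commute)
qed

lemma inner_subvec: "subvec F w \<bullet> subvec F w = (\<Sum>i\<in>F. (w i)^2)"
proof -
  have "subvec F w \<bullet> subvec F w = (\<Sum>i\<in>UNIV. if i \<in> F then (w i)^2 else 0)"
    unfolding inner_vec_def subvec_def by (intro sum.cong) (auto simp: power2_eq_square)
  then show ?thesis by (simp add: sum.If_cases)
qed

lemma nn_integral_gaussian_subvec:
  assumes y: "y > 0"
  shows "(\<integral>\<^sup>+w. ennreal (exp (- (subvec F w \<bullet> subvec F w) / (2 * y))) \<partial>lborels F)
    = ennreal ((2 * pi) powr (card F / 2) * y powr (card F / 2))"
proof -
  have "ennreal (exp (- (subvec F w \<bullet> subvec F w) / (2 * y))) = (\<Prod>i\<in>F. ennreal (exp (- ((w i)^2) / (2 * y))))" for w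
  proof -
    have "- (subvec F w \<bullet> subvec F w) / (2 * y) = (\<Sum>i\<in>F. - ((w i)^2) / (2 * y))"
      by (simp add: inner_subvec sum_divide_distrib sum_negf)
    then show ?thesis by (simp add: exp_sum prod_ennreal)
  qed
  then have "(\<integral>\<^sup>+w. ennreal (exp (- (subvec F w \<bullet> subvec F w) / (2 * y))) \<partial>lborels F)
     = (\<integral>\<^sup>+w. (\<Prod>i\<in>F. ennreal (exp (- ((w i)^2) / (2 * y)))) \<partial>lborels F)" by simp
  also have "\<dots> = (\<Prod>i\<in>F. (\<integral>\<^sup>+w. ennreal (exp (- (w^2) / (2 * y))) \<partial>lborel))"
    by (rule lborel_product.product_nn_integral_prod) auto
  also have "\<dots> = ennreal (sqrt (2 * pi * y) ^ card F)"
    unfolding nn_integral_gaussian(1)[OF y] using y by (simp add: ennreal_power)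
  also have "sqrt (2 * pi * y) ^ card F = (2 * pi) powr (card F / 2) * y powr (card F / 2)"
  proof -
    have "sqrt (2 * pi * y) ^ card F = (2 * pi * y) powr (1/2 * card F)"
      using y by (simp add: powr_half_sqrt[symmetric] powr_realpow[symmetric] powr_powr)
    then show ?thesis using y by (simp add: powr_mult)
  qed
  finally show ?thesis .
qed

definition upper_pairs :: "'n::linorder set \<Rightarrow> ('n \<times> 'n) set" where
  "upper_pairs F = {(i, j). i \<in> F \<and> j \<in> F \<and> i \<le> j}"

text \<open>
  The coordinate of the unordered pair of \<open>i\<close> and \<open>j\<close> is indexed by \<open>(min i j, max i j)\<close>, so the next index
  to be adjoined may be anywhere in the order.
\<close>

definition block_matrix :: "'n::{finite,linorder} set \<Rightarrow> ('n \<times> 'n \<Rightarrow> real) \<Rightarrow> real^'n::_^'n::_" where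
  "block_matrix F x = (\<chi> i j. if i \<in> F \<and> j \<in> F then x (min i j, max i j) else if i = j then 1 else 0)"

lemma transpose_block_matrix: "transpose (block_matrix F x) = block_matrix F x"
  by (simp add: transpose_def block_matrix_def vec_eq_iff min.commute max.commute)

lemma block_matrix_fixes_axis: "k \<notin> F \<Longrightarrow> block_matrix F x *v axis k 1 = axis k 1"
  by (simp add: matrix_vector_mult_basis) (auto simp: column_def block_matrix_def axis_def vec_eq_iff)

lemma block_matrix_UNIV: "block_matrix UNIV x = sym_of_upper x"
  by (simp add: block_matrix_def sym_of_upper_def vec_eq_iff min_def max_def)

lemma block_matrix_empty: "block_matrix {} x = mat 1"
  by (simp add: block_matrix_def mat_def)

lemma block_matrix_measurable [measurable]:
  "block_matrix F \<in> borel_measurable (lborels (upper_pairs F))"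
  unfolding block_matrix_def
proof (rule borel_measurable_mat_lambda)
  fix i j
  show "(\<lambda>x. if i \<in> F \<and> j \<in> F then x (min i j, max i j) else if i = j then 1 else 0)
    \<in> borel_measurable (lborels (upper_pairs F))"
    by (cases "i \<in> F \<and> j \<in> F")
       (auto simp: upper_pairs_def min_def max_def intro!: measurable_component_singleton[where M="\<lambda>_. lborel", simplified])
qed

lemma product_lborel_reindex:
  assumes inj: "inj_on \<pi> K" and K: "finite K"
  shows "distr (lborels (\<pi> ` K)) (lborels K) (\<lambda>x. \<lambda>i\<in>K. x (\<pi> i)) = lborels K"
proof (rule lborel_product.PiM_eqI)
  have [measurable]: "(\<lambda>x. \<lambda>i\<in>K. x (\<pi> i)) \<in> lborels (\<pi> ` K) \<rightarrow>\<^sub>M lborels K"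
    by (intro measurable_restrict measurable_component_singleton) auto
  fix A :: "'a \<Rightarrow> real set" assume A: "\<And>i. i \<in> K \<Longrightarrow> A i \<in> sets lborel"
  let ?B = "\<lambda>j. A (the_inv_into K \<pi> j)"
  have inv: "the_inv_into K \<pi> (\<pi> i) = i" if "i \<in> K" for i by (rule the_inv_into_f_f[OF inj that])
  have "(\<lambda>x. \<lambda>i\<in>K. x (\<pi> i)) -` Pi\<^sub>E K A \<inter> space (lborels (\<pi> ` K)) = Pi\<^sub>E (\<pi> ` K) ?B"
    by (auto simp: space_PiM PiE_iff inv)
  then have "emeasure (distr (lborels (\<pi> ` K)) (lborels K) (\<lambda>x. \<lambda>i\<in>K. x (\<pi> i))) (Pi\<^sub>E K A)
      = emeasure (lborels (\<pi> ` K)) (Pi\<^sub>E (\<pi> ` K) ?B)"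
    using A K by (subst emeasure_distr) (auto intro!: sets_PiM_I_finite)
  also have "\<dots> = (\<Prod>j\<in>\<pi> ` K. emeasure lborel (?B j))"
    using A K inv by (intro lborel_product.emeasure_PiM) auto
  also have "\<dots> = (\<Prod>i\<in>K. emeasure lborel (A i))"
    using inj inv by (subst prod.reindex) (auto intro!: prod.cong)
  finally show "emeasure (distr (lborels (\<pi> ` K)) (lborels K) (\<lambda>x. \<lambda>i\<in>K. x (\<pi> i))) (Pi\<^sub>E K A)
      = (\<Prod>i\<in>K. emeasure lborel (A i))" .
qed (auto simp: K)

lemma measurable_vec_nth: "(\<lambda>x :: real^'n. x $ i) \<in> borel_measurable borel"
  by (intro borel_measurable_continuous_onI continuous_intros)

lemma measurable_bordered [measurable (raw)]:
  assumes [measurable]: "v \<in> borel_measurable M" "t \<in> borel_measurable M"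
  shows "(\<lambda>x. bordered k S (v x) (t x)) \<in> borel_measurable M"
  unfolding bordered_def
proof (rule borel_measurable_mat_lambda)
  fix i j
  have [measurable]: "(\<lambda>x. v x $ i) \<in> borel_measurable M" for i
    by (rule measurable_compose[OF assms(1) measurable_vec_nth])
  show "(\<lambda>x. if i = k then if j = k then t x else v x $ j else if j = k then v x $ i else S $ i $ j) \<in> borel_measurable M"
    by measurable
qed

text \<open>
  The new coordinates are \<open>(min i k, max i k)\<close> for \<open>i\<close> in \<open>insert k F\<close>. Reindexing them by \<open>i\<close> turns them into the
  column \<open>v\<close> and the corner \<open>t\<close>.
\<close>

lemma nn_integral_block_matrix_insert:
  fixes f :: "real^'n::{finite,linorder}^'n::_ \<Rightarrow> ennreal"
  assumes k: "k \<notin> F" and f [measurable]: "f \<in> borel_measurable borel"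
  shows "(\<integral>\<^sup>+x. f (block_matrix (insert k F) x) \<partial>lborels (upper_pairs (insert k F)))
    = (\<integral>\<^sup>+x. (\<integral>\<^sup>+t. (\<integral>\<^sup>+v. f (bordered k (block_matrix F x) (subvec F v) t) \<partial>lborels F) \<partial>lborel)
         \<partial>lborels (upper_pairs F))"
proof -
  define \<pi> where "\<pi> i = (min i k, max i k)" for i
  let ?K = "insert k F"
  have inj: "inj_on \<pi> ?K" by (auto simp: inj_on_def \<pi>_def min_def max_def split: if_splits)
  have U: "upper_pairs ?K = upper_pairs F \<union> \<pi> ` ?K"
  proof (intro equalityI subsetI)
    fix q assume "q \<in> upper_pairs ?K"
    then obtain a b where q: "q = (a, b)" "a \<in> ?K" "b \<in> ?K" "a \<le> b" by (auto simp: upper_pairs_def)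
    consider "a \<in> F" "b \<in> F" | "a = k" | "b = k" using q by blast
    then show "q \<in> upper_pairs F \<union> \<pi> ` ?K"
    proof cases
      case 1 then show ?thesis using q by (auto simp: upper_pairs_def)
    next
      case 2
      then have "q = \<pi> b" using q by (simp add: \<pi>_def min_def max_def)
      then show ?thesis using q by blast
    next
      case 3
      then have "q = \<pi> a" using q by (simp add: \<pi>_def min_def max_def)
      then show ?thesis using q by blast
    qed
  qed (auto simp: upper_pairs_def \<pi>_def min_def max_def)
  have disj: "upper_pairs F \<inter> \<pi> ` ?K = {}"
    using k by (auto simp: upper_pairs_def \<pi>_def min_def max_def split: if_splits)
  have fin: "finite (upper_pairs F)" by (rule finite_subset[OF subset_UNIV]) simp
  have "(\<integral>\<^sup>+x. f (block_matrix ?K x) \<partial>lborels (upper_pairs ?K)) =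
     (\<integral>\<^sup>+x. (\<integral>\<^sup>+z. f (block_matrix ?K (merge (upper_pairs F) (\<pi> ` ?K) (x, z))) \<partial>lborels (\<pi> ` ?K)) \<partial>lborels (upper_pairs F))"
    unfolding U
  proof (rule lborel_product.product_nn_integral_fold[OF disj fin])
    show "(\<lambda>x. f (block_matrix ?K x)) \<in> borel_measurable (lborels (upper_pairs F \<union> \<pi> ` ?K))"
      unfolding U[symmetric] by measurable
  qed simp
  also have "\<dots> = (\<integral>\<^sup>+x. (\<integral>\<^sup>+z. f (bordered k (block_matrix F x) (subvec F (\<lambda>i\<in>?K. z (\<pi> i))) ((\<lambda>i\<in>?K. z (\<pi> i)) k)) \<partial>lborels (\<pi> ` ?K)) \<partial>lborels (upper_pairs F))"
  proof (intro nn_integral_cong arg_cong[of _ _ f])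
    fix x z
    show "block_matrix ?K (merge (upper_pairs F) (\<pi> ` ?K) (x, z)) =
       bordered k (block_matrix F x) (subvec F (\<lambda>i\<in>?K. z (\<pi> i))) ((\<lambda>i\<in>?K. z (\<pi> i)) k)" (is "?L = ?R")
    proof -
      have m1: "merge (upper_pairs F) (\<pi> ` ?K) (x, z) (min i j, max i j) = x (min i j, max i j)"
        if "i \<in> F" "j \<in> F" for i j
        using that by (auto simp: merge_def upper_pairs_def min_def max_def)
      have m2: "merge (upper_pairs F) (\<pi> ` ?K) (x, z) (min i k, max i k) = z (\<pi> i)" if "i \<in> ?K" for i
      proof -
        have "\<pi> i \<in> \<pi> ` ?K" using that by blast
        then have "\<pi> i \<notin> upper_pairs F" using disj by blast
        then show ?thesis using \<open>\<pi> i \<in> \<pi> ` ?K\<close> unfolding \<pi>_def[of i, symmetric] by (simp add: merge_def)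
      qed
      have "?L $ i $ j = ?R $ i $ j" for i j
        using m1[of i j] m2[of i] m2[of j] k
        by (auto simp: block_matrix_def bordered_def subvec_def min.commute[of k] max.commute[of k])
      then show ?thesis by (simp add: vec_eq_iff)
    qed
  qed
  also have "\<dots> = (\<integral>\<^sup>+x. (\<integral>\<^sup>+z. f (bordered k (block_matrix F x) (subvec F z) (z k)) \<partial>lborels ?K) \<partial>lborels (upper_pairs F))"
  proof (intro nn_integral_cong)
    fix x
    have [measurable]: "subvec F \<in> borel_measurable (lborels ?K)"
      by (rule measurable_subvec_superset) auto
    have [measurable]: "(\<lambda>x. \<lambda>i\<in>?K. x (\<pi> i)) \<in> lborels (\<pi> ` ?K) \<rightarrow>\<^sub>M lborels ?K"
      by (intro measurable_restrict measurable_component_singleton) auto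
    let ?h = "\<lambda>z. f (bordered k (block_matrix F x) (subvec F z) (z k))"
    have "(\<integral>\<^sup>+z. ?h z \<partial>lborels ?K) = (\<integral>\<^sup>+z. ?h z \<partial>distr (lborels (\<pi> ` ?K)) (lborels ?K) (\<lambda>x. \<lambda>i\<in>?K. x (\<pi> i)))"
      by (simp only: product_lborel_reindex[OF inj finite])
    also have "\<dots> = (\<integral>\<^sup>+z. ?h (\<lambda>i\<in>?K. z (\<pi> i)) \<partial>lborels (\<pi> ` ?K))"
      by (rule nn_integral_distr) measurable
    finally show "(\<integral>\<^sup>+z. ?h (\<lambda>i\<in>?K. z (\<pi> i)) \<partial>lborels (\<pi> ` ?K)) = (\<integral>\<^sup>+z. ?h z \<partial>lborels ?K)" by simp
  qed
  also have "\<dots> = (\<integral>\<^sup>+x. (\<integral>\<^sup>+t. (\<integral>\<^sup>+v. f (bordered k (block_matrix F x) (subvec F v) t) \<partial>lborels F) \<partial>lborel) \<partial>lborels (upper_pairs F))"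
  proof (intro nn_integral_cong)
    fix x
    have [measurable]: "subvec F \<in> borel_measurable (lborels ?K)"
      by (rule measurable_subvec_superset) auto
    have "subvec F (z(k := t)) = subvec F z" for z t using k by (auto simp: subvec_def vec_eq_iff)
    then show "(\<integral>\<^sup>+z. f (bordered k (block_matrix F x) (subvec F z) (z k)) \<partial>lborels ?K) =
       (\<integral>\<^sup>+t. (\<integral>\<^sup>+v. f (bordered k (block_matrix F x) (subvec F v) t) \<partial>lborels F) \<partial>lborel)"
      using k by (subst lborel_product.product_nn_integral_insert_rev) auto
  qed
  finally show ?thesis .
qed

section \<open>Elimination of one index at a time\<close>

text \<open>
  The set is a countable union of the closed sets on which the form is at least \<open>1 / (n + 1)\<close> times the square length.
\<close>

lemma spd_borel [measurable]: "(spd :: (real^'n^'n) set) \<in> sets borel"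
proof -
  let ?C = "\<lambda>n. {A :: real^'n^'n. transpose A = A \<and> (\<forall>x. inverse (real (Suc n)) * (x \<bullet> x) \<le> x \<bullet> (A *v x))}"
  have entry: "continuous_on UNIV (\<lambda>A :: real^'n^'n. A $ i $ j)" for i j
    by (intro continuous_intros)
  have form: "continuous_on UNIV (\<lambda>A :: real^'n^'n. x \<bullet> (A *v x))" for x
    unfolding inner_vec_def matrix_vector_mult_def by (simp, intro continuous_intros)
  have C: "?C n \<in> sets borel" for n
  proof -
    have eq: "?C n = (\<Inter>i. \<Inter>j. {A. A $ j $ i = A $ i $ j}) \<inter> (\<Inter>x. {A. inverse (real (Suc n)) * (x \<bullet> x) \<le> x \<bullet> (A *v x)})"
      by (auto simp: vec_eq_iff transpose_def)
    show ?thesis unfolding eq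
      by (intro borel_closed closed_Int closed_INT ballI closed_Collect_eq closed_Collect_le entry form continuous_on_const)
  qed
  have "spd = (\<Union>n. ?C n)"
  proof (intro equalityI subsetI)
    fix A :: "real^'n^'n" assume A: "A \<in> spd"
    obtain e where e: "e > 0" "\<And>x. e * (x \<bullet> x) \<le> x \<bullet> (A *v x)" using spd_coercive[OF A] by metis
    obtain n where n: "inverse (real (Suc n)) < e" using reals_Archimedean[OF e(1)] by blast
    have "inverse (real (Suc n)) * (x \<bullet> x) \<le> x \<bullet> (A *v x)" for x
      using e(2)[of x] n mult_right_mono[of "inverse (real (Suc n))" e "x \<bullet> x"] by (smt (verit) inner_ge_zero)
    then show "A \<in> (\<Union>n. ?C n)" using spd_transpose[OF A] by blast
  next
    fix A :: "real^'n^'n" assume "A \<in> (\<Union>n. ?C n)"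
    then obtain n where sym: "transpose A = A" and n: "\<And>x. inverse (real (Suc n)) * (x \<bullet> x) \<le> x \<bullet> (A *v x)" by blast
    have "x \<bullet> (A *v x) > 0" if "x \<noteq> 0" for x
    proof -
      have "inverse (real (Suc n)) * (x \<bullet> x) > 0" using that by simp
      then show ?thesis using n[of x] by linarith
    qed
    then show "A \<in> spd" using sym by (simp add: spd_def)
  qed
  moreover have "(\<Union>n. ?C n) \<in> sets borel" using C by (intro sets.countable_UN) blast
  ultimately show ?thesis by (simp only:)
qed

lemma matrix_entry_measurable: "(\<lambda>X :: real^'n^'m. X $ i $ j) \<in> borel_measurable borel"
  by (intro borel_measurable_continuous_onI continuous_intros)

lemma det_measurable [measurable (raw)]:
  fixes f :: "'a \<Rightarrow> real^'n^'n"
  assumes f: "f \<in> borel_measurable M"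
  shows "(\<lambda>x. det (f x)) \<in> borel_measurable M"
proof -
  have [measurable]: "(\<lambda>x. f x $ i $ j) \<in> borel_measurable M" for i j
    by (rule measurable_compose[OF f matrix_entry_measurable])
  show ?thesis unfolding det_def by measurable
qed

definition iw_kernel :: "real \<Rightarrow> real^'n^'n \<Rightarrow> real^'n^'n \<Rightarrow> real" where
  "iw_kernel a \<Psi> X = (if X \<in> spd then det X powr (- a) * exp (- trace (\<Psi> ** matrix_inv X) / 2) else 0)"

lemma iw_kernel_nonneg: "iw_kernel a \<Psi> X \<ge> 0"
  by (simp add: iw_kernel_def)

text \<open>
  Cramer's rule expresses the entries of the inverse by determinants.
\<close>

lemma iw_kernel_measurable [measurable]:
  fixes \<Psi> :: "real^'n^'n"
  shows "iw_kernel a \<Psi> \<in> borel_measurable borel"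
proof -
  define R :: "real^'n^'n \<Rightarrow> real^'n^'n" where
    "R X = (\<chi> k l. det (\<chi> i j. if j = k then axis l 1 $ i else X $ i $ j) / det X)" for X
  have R: "matrix_inv X = R X" if X: "X \<in> spd" for X
  proof (rule matrix_inv_unique)
    have nz: "det X \<noteq> 0" using spd_det_pos[OF X] by simp
    have "X *v column l (R X) = axis l 1" for l
      unfolding cramer[OF nz] by (simp add: R_def column_def vec_eq_iff)
    then have "(X *v column l (R X)) $ i = axis l 1 $ i" for i l by (simp only:)
    then have "(X ** R X) $ i $ l = (mat 1 :: real^'n^'n) $ i $ l" for i l
      by (simp add: matrix_vector_mult_def matrix_matrix_mult_def column_def axis_def mat_def)
    then show "X ** R X = mat 1" by (simp add: vec_eq_iff)
  qed
  have [measurable]: "(\<lambda>X. R X $ k $ l) \<in> borel_measurable borel" for k l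
  proof -
    have [measurable]: "(\<lambda>X. (\<chi> i j. if j = k then axis l 1 $ i else X $ i $ j) :: real^'n^'n) \<in> borel_measurable borel"
      by (intro borel_measurable_mat_lambda measurable_If matrix_entry_measurable) auto
    show ?thesis unfolding R_def by simp
  qed
  have "(\<lambda>X. trace (\<Psi> ** R X)) \<in> borel_measurable borel"
    unfolding trace_def matrix_matrix_mult_def by simp
  moreover have "iw_kernel a \<Psi> = (\<lambda>X. if X \<in> spd then det X powr (- a) * exp (- trace (\<Psi> ** R X) / 2) else 0)"
    using R by (auto simp: iw_kernel_def)
  ultimately show ?thesis by simp
qed

text \<open>
  The trace in the kernel runs over all indices, and those outside \<open>F\<close> contribute \<open>1\<close> each. An index that is
  adjoined to \<open>F\<close> loses this contribution, whence the factors \<open>exp (1 / 2)\<close> below.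
\<close>

definition block_integral :: "'n::{finite,linorder} set \<Rightarrow> real \<Rightarrow> (real^'n::_^'n::_ \<Rightarrow> ennreal) \<Rightarrow> ennreal" where
  "block_integral F p g = (\<integral>\<^sup>+x. ennreal (iw_kernel ((p + card F + 1) / 2) (mat 1) (block_matrix F x)) * g (block_matrix F x)
      \<partial>lborels (upper_pairs F))"

text \<open>
  Substitute \<open>v = S w\<close> and \<open>t = y + w \<bullet> S w\<close>. The Jacobian \<open>det S\<close> lowers the exponent of the
  determinant by one. Only \<open>y > 0\<close> contributes, and if \<open>S\<close> is not positive definite both sides vanish.
\<close>

lemma nn_integral_bordered:
  fixes S :: "real^'n::{finite,linorder}^'n::_"
  assumes sym: "transpose S = S" and Sfix: "\<And>j. j \<notin> F \<Longrightarrow> S *v axis j 1 = axis j 1" and k: "k \<notin> F"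
    and g [measurable]: "g \<in> borel_measurable borel"
  shows "(\<integral>\<^sup>+t. (\<integral>\<^sup>+v. ennreal (iw_kernel a (mat 1) (bordered k S (subvec F v) t)) * g (bordered k S (subvec F v) t)
             \<partial>lborels F) \<partial>lborel)
    = ennreal (iw_kernel (a - 1) (mat 1) S) *
      (\<integral>\<^sup>+y. ennreal (exp (1 / 2) * inv_gamma (a - 1) y) *
        (\<integral>\<^sup>+w. ennreal (exp (- (subvec F w \<bullet> subvec F w) / (2 * y))) *
             g (bordered k S (S *v subvec F w) (y + subvec F w \<bullet> (S *v subvec F w))) \<partial>lborels F) \<partial>lborel)"
proof (cases "S \<in> spd")
  case False
  then have "bordered k S v t \<notin> spd" for v t using bordered_spd_imp_spd[OF sym Sfix[OF k]] by blast
  then show ?thesis using False by (simp add: iw_kernel_def)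
next
  case S: True
  let ?P = "lborels F"
  define f where "f X = ennreal (iw_kernel a (mat 1) X) * g X" for X
  have f [measurable]: "f \<in> borel_measurable borel" unfolding f_def by measurable
  interpret P: sigma_finite_measure ?P
    by (rule lborel_product.sigma_finite) simp
  have PL: "pair_sigma_finite lborel ?P" "pair_sigma_finite ?P lborel"
    by (auto intro!: pair_sigma_finite.intro P.sigma_finite_measure_axioms sigma_finite_lborel)
  let ?u = "subvec F"
  let ?X = "\<lambda>w y. bordered k S (S *v ?u w) (y + ?u w \<bullet> (S *v ?u w))" and ?Y = "\<lambda>y. ennreal (exp (1 / 2) * inv_gamma (a - 1) y)"
    and ?E = "\<lambda>w y. ennreal (exp (- (?u w \<bullet> ?u w) / (2 * y)))"
  have Su [measurable]: "(\<lambda>w. S *v ?u w) \<in> borel_measurable ?P"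
    by (rule measurable_compose[OF measurable_subvec matrix_vector_borel_measurable])
  have [measurable]: "(\<lambda>w. ?u w \<bullet> (S *v ?u w)) \<in> borel_measurable ?P" by measurable
  have uk: "?u w $ k = 0" for w using k by (simp add: subvec_def)
  have detS: "det S > 0" by (rule spd_det_pos[OF S])
  have pt: "ennreal (det S) * f (?X w y) =
      ennreal (iw_kernel (a - 1) (mat 1) S) * (?Y y *
        (?E w y * g (?X w y)))" for w y
  proof (cases "y > 0")
    case False
    then show ?thesis
      by (simp add: f_def iw_kernel_def bordered_spd_iff[OF sym Sfix[OF k] S uk] inv_gamma_def)
  next
    case True
    have "exp (- (trace (matrix_inv S) + (1 / y - 1) + (?u w \<bullet> ?u w) / y) / 2) =
       exp (- trace (matrix_inv S) / 2) * exp (1 / 2) * exp (- 1 / (2 * y)) * exp (- (?u w \<bullet> ?u w) / (2 * y))"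
      using True unfolding exp_add[symmetric] by (simp add: field_simps)
    moreover have "det S * (det S * y) powr (- a) = det S powr (- (a - 1)) * y powr (- (a - 1 + 1))"
      using True detS powr_add[of "det S" 1 "- a"] by (simp add: powr_mult)
    ultimately have "det S * iw_kernel a (mat 1) (?X w y) =
      iw_kernel (a - 1) (mat 1) S * ((exp (1 / 2) * inv_gamma (a - 1) y) * exp (- (?u w \<bullet> ?u w) / (2 * y)))"
      using True
      by (simp add: iw_kernel_def bordered_spd_iff[OF sym Sfix[OF k] S uk] det_bordered[OF sym Sfix[OF k] uk] S
          trace_inv_bordered[OF sym Sfix[OF k] S uk True] inv_gamma_def mult_ac)
    then have "ennreal (det S) * ennreal (iw_kernel a (mat 1) (?X w y)) =
      ennreal (iw_kernel (a - 1) (mat 1) S) * (?Y y * ?E w y)"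
      using detS by (simp add: ennreal_mult[symmetric] iw_kernel_nonneg inv_gamma_nonneg)
    then show ?thesis by (simp add: f_def mult.assoc[symmetric])
  qed
  have "(\<integral>\<^sup>+t. (\<integral>\<^sup>+v. f (bordered k S (?u v) t) \<partial>?P) \<partial>lborel) =
     (\<integral>\<^sup>+t. (\<integral>\<^sup>+w. ennreal (det S) * f (bordered k S (S *v ?u w) t) \<partial>?P) \<partial>lborel)"
  proof (rule nn_integral_cong)
    fix t
    have "(\<integral>\<^sup>+v. f (bordered k S (?u v) t) \<partial>?P) = ennreal (det S) * (\<integral>\<^sup>+w. f (bordered k S (S *v ?u w) t) \<partial>?P)"
      by (rule nn_integral_subvec_linear[OF S Sfix, of F "\<lambda>v. f (bordered k S v t)"]) auto
    then show "(\<integral>\<^sup>+v. f (bordered k S (?u v) t) \<partial>?P) = (\<integral>\<^sup>+w. ennreal (det S) * f (bordered k S (S *v ?u w) t) \<partial>?P)"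
      by (subst nn_integral_cmult) auto
  qed
  also have "\<dots> = (\<integral>\<^sup>+w. (\<integral>\<^sup>+t. ennreal (det S) * f (bordered k S (S *v ?u w) t) \<partial>lborel) \<partial>?P)"
    by (rule pair_sigma_finite.Fubini'[OF PL(2)]) measurable
  also have "\<dots> = (\<integral>\<^sup>+w. (\<integral>\<^sup>+y. ennreal (det S) * f (?X w y) \<partial>lborel) \<partial>?P)"
  proof (rule nn_integral_cong)
    fix w
    show "(\<integral>\<^sup>+t. ennreal (det S) * f (bordered k S (S *v ?u w) t) \<partial>lborel) =
       (\<integral>\<^sup>+y. ennreal (det S) * f (?X w y) \<partial>lborel)"
      by (subst nn_integral_real_affine[of _ 1 "?u w \<bullet> (S *v ?u w)"]) (auto simp: add.commute)
  qed
  also have "\<dots> = (\<integral>\<^sup>+y. (\<integral>\<^sup>+w. ennreal (det S) * f (?X w y) \<partial>?P) \<partial>lborel)"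
    by (rule pair_sigma_finite.Fubini'[OF PL(1)]) measurable
  also have "\<dots> = (\<integral>\<^sup>+y. ennreal (iw_kernel (a - 1) (mat 1) S) * (?Y y *
        (\<integral>\<^sup>+w. ?E w y * g (?X w y) \<partial>?P)) \<partial>lborel)"
    unfolding pt
    by (intro nn_integral_cong, subst nn_integral_cmult, measurable, subst nn_integral_cmult, measurable)
  also have "\<dots> = ennreal (iw_kernel (a - 1) (mat 1) S) * (\<integral>\<^sup>+y. ?Y y *
        (\<integral>\<^sup>+w. ?E w y * g (?X w y) \<partial>?P) \<partial>lborel)"
    by (rule nn_integral_cmult) measurable
  finally show ?thesis unfolding f_def .
qed

lemma block_integral_insert:
  assumes k: "k \<notin> F" and g [measurable]: "g \<in> borel_measurable borel"
  shows "block_integral (insert k F) p g = (\<integral>\<^sup>+x. ennreal (iw_kernel ((p + card F) / 2) (mat 1) (block_matrix F x)) *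
      (\<integral>\<^sup>+y. ennreal (exp (1 / 2) * inv_gamma ((p + card F) / 2) y) *
        (\<integral>\<^sup>+w. ennreal (exp (- (subvec F w \<bullet> subvec F w) / (2 * y))) *
             g (bordered k (block_matrix F x) (block_matrix F x *v subvec F w)
                 (y + subvec F w \<bullet> (block_matrix F x *v subvec F w))) \<partial>lborels F) \<partial>lborel)
      \<partial>lborels (upper_pairs F))"
proof -
  have a: "(p + card (insert k F) + 1) / 2 - 1 = (p + card F) / 2" using k by (simp add: field_simps)
  show ?thesis unfolding block_integral_def
    by (subst nn_integral_block_matrix_insert[OF k, where f = "\<lambda>X. ennreal (iw_kernel _ _ X) * g X"], measurable,
        intro nn_integral_cong, rule trans[OF nn_integral_bordered[OF transpose_block_matrix block_matrix_fixes_axis k g]],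
        assumption, simp only: a)
qed

text \<open>
  The Gaussian integral contributes \<open>(2 * pi * y) powr (n / 2)\<close>; its power of \<open>y\<close> changes the shape of the
  inverse-gamma kernel from \<open>(p + n) / 2\<close> to \<open>p / 2\<close>.
\<close>

definition step_constant :: "nat \<Rightarrow> real \<Rightarrow> real" where
  "step_constant n p = exp (1 / 2) * (2 * pi) powr (n / 2) * (2 powr (p / 2) * Gamma (p / 2))"

lemma step_constant_pos: "p > 0 \<Longrightarrow> step_constant n p > 0"
  by (simp add: step_constant_def Gamma_real_pos)

lemma block_integral_insert_block_function:
  assumes k: "k \<notin> F" and g [measurable]: "g \<in> borel_measurable borel" and p: "p > 0"
    and block: "\<And>S v t. g (bordered k S v t) = g S"
  shows "block_integral (insert k F) p g = ennreal (step_constant (card F) p) * block_integral F (p - 1) g"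
proof -
  let ?E = "\<lambda>w y. ennreal (exp (- (subvec F w \<bullet> subvec F w) / (2 * y)))"
  let ?n = "card F"
  let ?K = "exp (1 / 2) * (2 * pi) powr (?n / 2)"
  have inner: "(\<integral>\<^sup>+y. ennreal (exp (1 / 2) * inv_gamma ((p + ?n) / 2) y) *
        (\<integral>\<^sup>+w. ?E w y * c \<partial>lborels F) \<partial>lborel) =
        ennreal (step_constant ?n p) * c" for c
  proof -
    have "ennreal (exp (1 / 2) * inv_gamma ((p + ?n) / 2) y) *
        (\<integral>\<^sup>+w. ?E w y * c \<partial>lborels F) =
        (ennreal ?K * c) * ennreal (inv_gamma (p / 2) y)" for y
    proof (cases "y > 0")
      case True
      have "(\<integral>\<^sup>+w. ?E w y * c \<partial>lborels F) =
         ennreal ((2 * pi) powr (?n / 2) * y powr (?n / 2)) * c"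
        unfolding nn_integral_gaussian_subvec[OF True, symmetric] by (rule nn_integral_multc; measurable)
      moreover have "exp (1 / 2) * inv_gamma ((p + ?n) / 2) y * ((2 * pi) powr (?n / 2) * y powr (?n / 2)) = ?K * inv_gamma (p / 2) y"
        using inv_gamma_powr[OF True, of "(p + ?n) / 2" "?n / 2"] by (simp add: field_simps)
      then have "ennreal (exp (1 / 2) * inv_gamma ((p + ?n) / 2) y) * ennreal ((2 * pi) powr (?n / 2) * y powr (?n / 2)) =
         ennreal ?K * ennreal (inv_gamma (p / 2) y)"
        by (simp add: ennreal_mult[symmetric] inv_gamma_nonneg)
      ultimately show ?thesis by (simp add: mult_ac)
    qed (simp add: inv_gamma_def)
    then have "(\<integral>\<^sup>+y. ennreal (exp (1 / 2) * inv_gamma ((p + ?n) / 2) y) *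
        (\<integral>\<^sup>+w. ?E w y * c \<partial>lborels F) \<partial>lborel) =
        (ennreal ?K * c) * ennreal (2 powr (p / 2) * Gamma (p / 2))"
      using p by (simp add: nn_integral_cmult nn_integral_inv_gamma)
    also have "\<dots> = ennreal (step_constant ?n p) * c"
      using p by (simp add: step_constant_def ennreal_mult Gamma_real_pos less_imp_le mult_ac)
    finally show ?thesis .
  qed
  have a: "(p - 1 + ?n + 1) / 2 = (p + ?n) / 2" by simp
  show ?thesis
    unfolding block_integral_insert[OF k g] block inner block_integral_def[of F] a
    by (subst nn_integral_cmult[symmetric]) (measurable, simp add: mult_ac)
qed

lemma multivariate_Gamma_Suc:
  "multivariate_Gamma (Suc n) a = pi powr (n / 2) * Gamma a * multivariate_Gamma n (a - 1 / 2)"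
proof -
  have "(\<Prod>j=1..Suc n. Gamma (a - (real j - 1) / 2)) = Gamma a * (\<Prod>j=2..Suc n. Gamma (a - (real j - 1) / 2))"
    by (subst prod.atLeast_Suc_atMost) (auto simp: numeral_2_eq_2)
  also have "(\<Prod>j=2..Suc n. Gamma (a - (real j - 1) / 2)) = (\<Prod>j=1..n. Gamma (a - 1 / 2 - (real j - 1) / 2))"
  proof (rule prod.reindex_bij_witness[of _ Suc "\<lambda>j. j - 1"])
    fix j assume "j \<in> {2..Suc n}"
    then have "a - 1 / 2 - (real (j - 1) - 1) / 2 = a - (real j - 1) / 2" by (simp add: of_nat_diff field_simps)
    then show "Gamma (a - 1 / 2 - (real (j - 1) - 1) / 2) = Gamma (a - (real j - 1) / 2)" by (simp only:)
  qed auto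
  finally have "(\<Prod>j=1..Suc n. Gamma (a - (real j - 1) / 2)) = Gamma a * (\<Prod>j=1..n. Gamma (a - 1 / 2 - (real j - 1) / 2))" .
  moreover have "real (Suc n) * (real (Suc n) - 1) / 4 = n / 2 + real n * (real n - 1) / 4"
    by (simp add: field_simps)
  ultimately show ?thesis unfolding multivariate_Gamma_def by (simp only: powr_add mult_ac)
qed

text \<open>
  The recursion for \<open>multivariate_Gamma\<close> matches the constant of one elimination step.
\<close>

lemma block_integral_one:
  fixes F :: "'n::{finite,linorder} set"
  assumes "p > real (card F) - 1"
  shows "block_integral F p (\<lambda>_. 1) =
    ennreal (exp ((real (card F) - real CARD('n)) / 2) * 2 powr (p * card F / 2) * multivariate_Gamma (card F) (p / 2))"
  using finite[of F] assms
proof (induction F arbitrary: p rule: finite_induct)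
  case empty
  have "upper_pairs ({} :: 'n set) = {}" by (simp add: upper_pairs_def)
  moreover have "matrix_inv (mat 1 :: 'n square) = mat 1" by (rule matrix_inv_unique) simp
  ultimately show ?case
    by (simp add: block_integral_def PiM_empty block_matrix_empty iw_kernel_def spd_mat_1 trace_I
        multivariate_Gamma_def)
next
  case (insert k F)
  let ?n = "card F"
  have p: "p > 0" "p > real ?n" using insert by auto
  have "block_integral (insert k F) p (\<lambda>_. 1) = ennreal (step_constant ?n p) * block_integral F (p - 1) (\<lambda>_. 1)"
    using insert.hyps p by (intro block_integral_insert_block_function) auto
  also have "block_integral F (p - 1) (\<lambda>_. 1) =
    ennreal (exp ((real ?n - real CARD('n)) / 2) * 2 powr ((p - 1) * ?n / 2) * multivariate_Gamma ?n ((p - 1) / 2))"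
    using p by (intro insert.IH) simp
  also have "ennreal (step_constant ?n p) * \<dots> =
     ennreal (step_constant ?n p * (exp ((real ?n - real CARD('n)) / 2) * 2 powr ((p - 1) * ?n / 2) * multivariate_Gamma ?n ((p - 1) / 2)))"
    using step_constant_pos[OF p(1), of ?n] by (simp add: ennreal_mult' less_imp_le)
  also have "step_constant ?n p * (exp ((real ?n - real CARD('n)) / 2) * 2 powr ((p - 1) * ?n / 2) * multivariate_Gamma ?n ((p - 1) / 2)) =
     exp ((real (Suc ?n) - real CARD('n)) / 2) * 2 powr (p * Suc ?n / 2) * multivariate_Gamma (Suc ?n) (p / 2)"
  proof -
    have "exp ((real (Suc ?n) - real CARD('n)) / 2) = exp (1 / 2) * exp ((real ?n - real CARD('n)) / 2)"
      unfolding exp_add[symmetric] by (simp add: field_simps)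
    moreover have "2 powr (p * Suc ?n / 2) = 2 powr (?n / 2) * (2 powr (p / 2) * 2 powr ((p - 1) * ?n / 2))"
      unfolding powr_add[symmetric] by (simp add: field_simps)
    moreover have "(2 * pi) powr (?n / 2) = 2 powr (?n / 2) * pi powr (?n / 2)" by (simp add: powr_mult)
    moreover have "p / 2 - 1 / 2 = (p - 1) / 2" by simp
    ultimately show ?thesis unfolding multivariate_Gamma_Suc step_constant_def by (simp only: mult_ac)
  qed
  finally show ?case using insert.hyps by simp
qed

text \<open>
  Integrands that depend only on the block \<open>F\<close> see all other indices through one common factor. With the
  factor divided out, this says that the principal block \<open>F\<close> of an inverse-Wishart matrix is
  inverse-Wishart with \<open>p\<close> lowered by the number of removed indices.
\<close>

lemma block_integral_Un:
  fixes F G :: "'n::{finite,linorder} set"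
  assumes "F \<inter> G = {}" "p > real (card G)"
  shows "\<exists>c :: ennreal. \<forall>g \<in> borel_measurable borel.
    (\<forall>X Y. (\<forall>i\<in>F. \<forall>j\<in>F. X $ i $ j = Y $ i $ j) \<longrightarrow> g X = g Y) \<longrightarrow>
    block_integral (F \<union> G) p g = c * block_integral F (p - real (card G)) g"
  using finite[of G] assms
proof (induction G arbitrary: p rule: finite_induct)
  case empty
  show ?case by (rule exI[of _ 1]) simp
next
  case (insert k G)
  have k: "k \<notin> F \<union> G" and disj: "F \<inter> G = {}" and p: "p - 1 > real (card G)" "p > 0" using insert by auto
  obtain c where c: "\<forall>g \<in> borel_measurable borel.
    (\<forall>X Y. (\<forall>i\<in>F. \<forall>j\<in>F. X $ i $ j = Y $ i $ j) \<longrightarrow> g X = g Y) \<longrightarrow>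
    block_integral (F \<union> G) (p - 1) g = c * block_integral F (p - 1 - real (card G)) g"
    using insert.IH[OF disj p(1)] by metis
  have "block_integral (F \<union> insert k G) p g =
      (ennreal (step_constant (card (F \<union> G)) p) * c) * block_integral F (p - real (card (insert k G))) g"
    if g: "g \<in> borel_measurable borel" and block: "\<forall>X Y. (\<forall>i\<in>F. \<forall>j\<in>F. X $ i $ j = Y $ i $ j) \<longrightarrow> g X = g Y" for g
  proof -
    have "g (bordered k S v t) = g S" for S v t
      using k by (intro block[rule_format]) (auto simp: bordered_def)
    then have "block_integral (insert k (F \<union> G)) p g = ennreal (step_constant (card (F \<union> G)) p) * block_integral (F \<union> G) (p - 1) g"
      using g by (intro block_integral_insert_block_function[OF k _ p(2)]) auto
    also have "block_integral (F \<union> G) (p - 1) g = c * block_integral F (p - 1 - real (card G)) g"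
      using c g block by blast
    finally show ?thesis
      using insert.hyps by (simp add: mult.assoc algebra_simps)
  qed
  then show ?case by blast
qed

lemma Gamma_real_Suc: "x > 0 \<Longrightarrow> Gamma (x + 1) = x * Gamma (x :: real)"
  by (rule Gamma_plus1) (auto elim!: nonpos_Ints_cases)

text \<open>
  A block of size one is an inverse-gamma variable, and multiplication by \<open>y\<^sup>2\<close> lowers its shape by two.
\<close>

lemma block_integral_diagonal_square:
  fixes k :: "'n::{finite,linorder}"
  assumes p: "p > 4"
  shows "block_integral {k} p (\<lambda>X. ennreal ((X $ k $ k)\<^sup>2)) = ennreal (1 / ((p - 2) * (p - 4))) * block_integral {k} p (\<lambda>_. 1)"
proof -
  have mk [measurable]: "(\<lambda>X :: 'n square. ennreal ((X $ k $ k)\<^sup>2)) \<in> borel_measurable borel"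
    using matrix_entry_measurable[of k k] by measurable
  have u: "subvec {} w = 0" for w :: "'n \<Rightarrow> real" by (simp add: subvec_def vec_eq_iff)
  have bk: "bordered k S v t $ k $ k = t" for S v t by (simp add: bordered_def)
  have w: "(\<integral>\<^sup>+w. c \<partial>lborels {}) = c" for c :: ennreal by (simp add: PiM_empty)
  let ?c = "2 powr (p / 2 - 2) * Gamma (p / 2 - 2)"
  have "(\<integral>\<^sup>+y. ennreal (exp (1 / 2) * inv_gamma (p / 2) y) * ennreal (y\<^sup>2) \<partial>lborel) =
      (\<integral>\<^sup>+y. ennreal (exp (1 / 2)) * ennreal (inv_gamma (p / 2 - 2) y) \<partial>lborel)"
  proof (rule nn_integral_cong)
    fix y :: real
    show "ennreal (exp (1 / 2) * inv_gamma (p / 2) y) * ennreal (y\<^sup>2) = ennreal (exp (1 / 2)) * ennreal (inv_gamma (p / 2 - 2) y)"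
    proof (cases "y > 0")
      case True
      have "inv_gamma (p / 2) y * y\<^sup>2 = inv_gamma (p / 2 - 2) y"
        using inv_gamma_powr[OF True, of "p / 2" 2] True powr_realpow[of y 2] by simp
      then show ?thesis by (simp add: ennreal_mult[symmetric] inv_gamma_nonneg)
    qed (simp add: inv_gamma_def)
  qed
  also have "\<dots> = ennreal (exp (1 / 2)) * ennreal ?c"
    using p by (subst nn_integral_cmult) (auto simp: nn_integral_inv_gamma)
  also have "\<dots> = ennreal (exp (1 / 2) * ?c)" using p by (subst ennreal_mult) (auto simp: Gamma_real_pos less_imp_le)
  finally have sq: "(\<integral>\<^sup>+y. ennreal (exp (1 / 2) * inv_gamma (p / 2) y) * ennreal (y\<^sup>2) \<partial>lborel) = ennreal (exp (1 / 2) * ?c)" .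
  have "block_integral {k} p (\<lambda>X. ennreal ((X $ k $ k)\<^sup>2)) = ennreal (exp (1 / 2) * ?c) * block_integral ({} :: 'n set) (p - 1) (\<lambda>_. 1)"
  proof -
    have pt: "(\<integral>\<^sup>+w. ennreal (exp (- (subvec {} w \<bullet> subvec {} w) / (2 * y))) *
        ennreal ((bordered k (S :: 'n square) (S *v subvec {} w) (y + subvec {} w \<bullet> (S *v subvec {} w)) $ k $ k)\<^sup>2)
        \<partial>lborels {}) = ennreal (y\<^sup>2)" for S y
      by (simp add: u bk PiM_empty)
    have "block_integral {k} p (\<lambda>X. ennreal ((X $ k $ k)\<^sup>2)) =
       (\<integral>\<^sup>+x. ennreal (iw_kernel (p / 2) (mat 1) (block_matrix {} x :: 'n square)) * ennreal (exp (1 / 2) * ?c) \<partial>lborels (upper_pairs {}))"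
      by (subst block_integral_insert[OF _ mk]) (simp_all only: pt sq card.empty of_nat_0 add_0_right, simp_all)
    also have "\<dots> = ennreal (exp (1 / 2) * ?c) * (\<integral>\<^sup>+x. ennreal (iw_kernel (p / 2) (mat 1) (block_matrix {} x :: 'n square)) \<partial>lborels (upper_pairs {}))"
      by (simp only: mult.commute[of _ "ennreal (exp (1 / 2) * ?c)"]) (rule nn_integral_cmult, measurable)
    finally show ?thesis by (simp add: block_integral_def)
  qed
  also have "exp (1 / 2) * ?c = 1 / ((p - 2) * (p - 4)) * step_constant 0 p"
  proof -
    have 1: "Gamma (p / 2) = (p / 2 - 1) * ((p / 2 - 2) * Gamma (p / 2 - 2))"
      using Gamma_real_Suc[of "p / 2 - 1"] Gamma_real_Suc[of "p / 2 - 2"] p by simp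
    have 2: "2 powr (p / 2) = 4 * 2 powr (p / 2 - 2)" by (simp add: powr_diff)
    have "step_constant 0 p = ((p - 2) * (p - 4)) * (exp (1 / 2) * ?c)"
      unfolding step_constant_def 1 2 by (simp add: field_simps)
    then show ?thesis using p by simp
  qed
  also have "ennreal (1 / ((p - 2) * (p - 4)) * step_constant 0 p) = ennreal (1 / ((p - 2) * (p - 4))) * ennreal (step_constant 0 p)"
    using p step_constant_pos[of p 0] by (subst ennreal_mult) auto
  also have "\<dots> * block_integral ({} :: 'n set) (p - 1) (\<lambda>_. 1) = ennreal (1 / ((p - 2) * (p - 4))) * block_integral {k} p (\<lambda>_. 1)"
    using block_integral_insert_block_function[of k "{}" "\<lambda>_. 1" p] p by (simp add: mult.assoc)
  finally show ?thesis .
qed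

text \<open>
  In a block of size two the off-diagonal entry is \<open>X\<^sub>i\<^sub>i * w\<close>, where \<open>w\<close> is Gaussian of variance \<open>y\<close> and \<open>y\<close> is
  independent of \<open>X\<^sub>i\<^sub>i\<close>. So its second moment is that of \<open>X\<^sub>i\<^sub>i\<close> times the mean of \<open>y\<close>.
\<close>

lemma block_integral_offdiagonal_square:
  fixes i k :: "'n::{finite,linorder}"
  assumes p: "p > 5" and ik: "i \<noteq> k"
  shows "block_integral {k, i} p (\<lambda>X. ennreal ((X $ i $ k)\<^sup>2))
    = ennreal (1 / ((p - 2) * (p - 3) * (p - 5))) * block_integral {k, i} p (\<lambda>_. 1)"
proof -
  let ?E = "\<lambda>w y. ennreal (exp (- (subvec {i} w \<bullet> subvec {i} w) / (2 * y)))"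
    and ?k = "\<lambda>x. ennreal (iw_kernel ((p + card {i}) / 2) (mat 1) (block_matrix {i} x))"
  have mik [measurable]: "(\<lambda>X :: 'n square. ennreal ((X $ i $ k)\<^sup>2)) \<in> borel_measurable borel"
    and [measurable]: "(\<lambda>X :: 'n square. ennreal ((X $ i $ i)\<^sup>2)) \<in> borel_measurable borel"
    using matrix_entry_measurable[of i k] matrix_entry_measurable[of i i] by measurable
  have card1: "real (card {i}) = 1" by simp
  have bk: "bordered k S v t $ i $ k = v $ i" for S v t using ik by (simp add: bordered_def)
  have Sw: "(S *v subvec {i} w) $ i = S $ i $ i * w i" for S :: "'n square" and w
    by (simp add: matrix_vector_mult_def subvec_def if_distrib cong: if_cong)
  let ?c = "exp (1 / 2) * sqrt (2 * pi) * (2 powr (p / 2 - 1) * Gamma (p / 2 - 1))"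
  have inner: "(\<integral>\<^sup>+y. ennreal (exp (1 / 2) * inv_gamma ((p + 1) / 2) y) *
        (\<integral>\<^sup>+w. ?E w y * ennreal ((s * w i)\<^sup>2) \<partial>lborels {i}) \<partial>lborel) =
      ennreal ?c * ennreal (s\<^sup>2)" for s :: real
  proof -
    have "ennreal (exp (1 / 2) * inv_gamma ((p + 1) / 2) y) *
        (\<integral>\<^sup>+w. ?E w y * ennreal ((s * w i)\<^sup>2) \<partial>lborels {i}) =
        ennreal (exp (1 / 2) * sqrt (2 * pi) * s\<^sup>2) * ennreal (inv_gamma (p / 2 - 1) y)" for y
    proof (cases "y > 0")
      case True
      have "(\<integral>\<^sup>+w. ?E w y * ennreal ((s * w i)\<^sup>2) \<partial>lborels {i}) =
         (\<integral>\<^sup>+w. ennreal (s\<^sup>2) * ennreal ((w i)\<^sup>2 * exp (- ((w i)\<^sup>2) / (2 * y))) \<partial>lborels {i})"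
        by (simp add: inner_subvec ennreal_mult[symmetric] power_mult_distrib mult_ac)
      also have "\<dots> = (\<integral>\<^sup>+w. ennreal (s\<^sup>2) * ennreal (w\<^sup>2 * exp (- (w\<^sup>2) / (2 * y))) \<partial>lborel)"
        by (rule lborel_product.product_nn_integral_singleton) measurable
      also have "\<dots> = ennreal (s\<^sup>2) * ennreal (y * sqrt (2 * pi * y))"
        by (subst nn_integral_cmult) (measurable, simp only: nn_integral_gaussian(2)[OF True])
      finally have 1: "(\<integral>\<^sup>+w. ?E w y * ennreal ((s * w i)\<^sup>2) \<partial>lborels {i})
         = ennreal (s\<^sup>2 * (y * sqrt (2 * pi * y)))" using True by (simp add: ennreal_mult)
      have Y: "y * sqrt (2 * pi * y) = sqrt (2 * pi) * y powr (3 / 2)"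
        using True powr_add[of y 1 "1 / 2"] by (simp add: real_sqrt_mult powr_half_sqrt)
      have "(p + 1) / 2 - 3 / 2 = p / 2 - 1" by (simp add: field_simps)
      then have J: "inv_gamma ((p + 1) / 2) y * y powr (3 / 2) = inv_gamma (p / 2 - 1) y"
        using inv_gamma_powr[OF True, of "(p + 1) / 2" "3 / 2"] by (simp only:)
      have "exp (1 / 2) * inv_gamma ((p + 1) / 2) y * (s\<^sup>2 * (y * sqrt (2 * pi * y))) =
          exp (1 / 2) * sqrt (2 * pi) * s\<^sup>2 * (inv_gamma ((p + 1) / 2) y * y powr (3 / 2))"
        unfolding Y by (simp only: mult_ac)
      then have "exp (1 / 2) * inv_gamma ((p + 1) / 2) y * (s\<^sup>2 * (y * sqrt (2 * pi * y))) =
          exp (1 / 2) * sqrt (2 * pi) * s\<^sup>2 * inv_gamma (p / 2 - 1) y"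
        unfolding J .
      then show ?thesis unfolding 1 using True by (simp only: ennreal_mult[symmetric] inv_gamma_nonneg mult_nonneg_nonneg exp_ge_zero
            zero_le_power2 real_sqrt_ge_zero less_imp_le pi_ge_zero zero_le_numeral)
    qed (simp add: inv_gamma_def)
    then have "(\<integral>\<^sup>+y. ennreal (exp (1 / 2) * inv_gamma ((p + 1) / 2) y) *
        (\<integral>\<^sup>+w. ?E w y * ennreal ((s * w i)\<^sup>2) \<partial>lborels {i}) \<partial>lborel) =
        ennreal (exp (1 / 2) * sqrt (2 * pi) * s\<^sup>2) * ennreal (2 powr (p / 2 - 1) * Gamma (p / 2 - 1))"
      using p by (simp add: nn_integral_cmult nn_integral_inv_gamma)
    also have "\<dots> = ennreal (?c * s\<^sup>2)"
      using p by (subst ennreal_mult[symmetric]) (auto simp: Gamma_real_pos less_imp_le mult_ac)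
    also have "\<dots> = ennreal ?c * ennreal (s\<^sup>2)"
      using p by (subst ennreal_mult) (auto simp: Gamma_real_pos less_imp_le)
    finally show ?thesis .
  qed
  have a: "(p - 1 + card {i} + 1) / 2 = (p + card {i}) / 2" by simp
  have "block_integral {k, i} p (\<lambda>X. ennreal ((X $ i $ k)\<^sup>2)) = ennreal ?c * block_integral {i} (p - 1) (\<lambda>X. ennreal ((X $ i $ i)\<^sup>2))"
  proof -
    have "block_integral {k, i} p (\<lambda>X. ennreal ((X $ i $ k)\<^sup>2)) =
       (\<integral>\<^sup>+x. ?k x * (ennreal ?c * ennreal ((block_matrix {i} x $ i $ i)\<^sup>2))
          \<partial>lborels (upper_pairs {i}))"
      using ik by (subst block_integral_insert[OF _ mik]) (simp_all only: bk Sw card1 inner, simp_all)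
    also have "\<dots> = (\<integral>\<^sup>+x. ennreal ?c * (?k x * ennreal ((block_matrix {i} x $ i $ i)\<^sup>2))
          \<partial>lborels (upper_pairs {i}))"
      by (simp only: mult_ac)
    also have "\<dots> = ennreal ?c * (\<integral>\<^sup>+x. (?k x * ennreal ((block_matrix {i} x $ i $ i)\<^sup>2))
          \<partial>lborels (upper_pairs {i}))"
      by (rule nn_integral_cmult) measurable
    finally show ?thesis unfolding block_integral_def[of "{i}"] a .
  qed
  also have "block_integral {i} (p - 1) (\<lambda>X. ennreal ((X $ i $ i)\<^sup>2)) = ennreal (1 / ((p - 3) * (p - 5))) * block_integral {i} (p - 1) (\<lambda>_. 1)"
    using p block_integral_diagonal_square[of "p - 1" i] by simp
  also have "ennreal ?c = ennreal (1 / (p - 2)) * ennreal (step_constant 1 p)"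
  proof -
    have 1: "Gamma (p / 2) = (p / 2 - 1) * Gamma (p / 2 - 1)"
      using Gamma_real_Suc[of "p / 2 - 1"] p by simp
    have 2: "2 powr (p / 2) = 2 * 2 powr (p / 2 - 1)" by (simp add: powr_diff)
    have 3: "sqrt (2 * pi) = (2 * pi) powr (1 / 2)" by (simp add: powr_half_sqrt)
    have "step_constant 1 p = (p - 2) * ?c"
      unfolding step_constant_def 1 2 3 by (simp add: algebra_simps)
    then have "?c = 1 / (p - 2) * step_constant 1 p" using p by simp
    then show ?thesis using p step_constant_pos[of p 1] by (subst ennreal_mult[symmetric]) auto
  qed
  also have "ennreal (1 / (p - 2)) * ennreal (step_constant 1 p) * (ennreal (1 / ((p - 3) * (p - 5))) * block_integral {i} (p - 1) (\<lambda>_. 1)) =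
     (ennreal (1 / (p - 2)) * ennreal (1 / ((p - 3) * (p - 5)))) * (ennreal (step_constant 1 p) * block_integral {i} (p - 1) (\<lambda>_. 1))"
    by (simp only: mult_ac)
  also have "ennreal (1 / (p - 2)) * ennreal (1 / ((p - 3) * (p - 5))) = ennreal (1 / ((p - 2) * (p - 3) * (p - 5)))"
    using p by (subst ennreal_mult[symmetric]) (auto simp: mult.assoc)
  also have "ennreal (step_constant 1 p) * block_integral {i} (p - 1) (\<lambda>_. 1) = block_integral {k, i} p (\<lambda>_. 1)"
    using block_integral_insert_block_function[of k "{i}" "\<lambda>_. 1" p] p ik by simp
  finally show ?thesis .
qed

lemma block_integral_UNIV_squares:
  fixes i j :: "'n::{finite,linorder}"
  assumes p: "p > real CARD('n) + 3"
  defines "m \<equiv> p - real CARD('n)"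
  shows "block_integral UNIV p (\<lambda>X. ennreal ((X $ i $ i)\<^sup>2))
      = ennreal (1 / ((m - 1) * (m - 3))) * block_integral (UNIV :: 'n set) p (\<lambda>_. 1)"
    and "i \<noteq> j \<Longrightarrow> block_integral UNIV p (\<lambda>X. ennreal ((X $ i $ j)\<^sup>2))
      = ennreal (1 / (m * (m - 1) * (m - 3))) * block_integral (UNIV :: 'n set) p (\<lambda>_. 1)"
proof -
  have m[measurable]: "(\<lambda>X :: 'n square. ennreal ((X $ i $ j)\<^sup>2)) \<in> borel_measurable borel" for i j
    using matrix_entry_measurable[of i j] by measurable
  have *: "block_integral UNIV p (\<lambda>X. ennreal ((X $ a $ b)\<^sup>2)) = ennreal r * block_integral (UNIV :: 'n set) p (\<lambda>_. 1)"
    if ab: "a \<in> F" "b \<in> F" and r: "block_integral F (p - real CARD('n) + real (card F)) (\<lambda>X. ennreal ((X $ a $ b)\<^sup>2))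
      = ennreal r * block_integral F (p - real CARD('n) + real (card F)) (\<lambda>_. 1)" for a b r and F :: "'n set"
  proof -
    have cF: "card F \<le> CARD('n)" by (rule card_mono) auto
    have cC: "card (- F) = CARD('n) - card F" by (simp add: Compl_eq_Diff_UNIV card_Diff_subset)
    have cc: "p - real (card (- F)) = p - real CARD('n) + real (card F)"
      using cF by (simp add: cC of_nat_diff)
    have "p > real (card (- F))" using p cF by (simp add: cC of_nat_diff)
    then obtain c :: ennreal where c: "\<forall>g \<in> borel_measurable borel.
      (\<forall>X Y. (\<forall>i\<in>F. \<forall>j\<in>F. X $ i $ j = Y $ i $ j) \<longrightarrow> g X = g Y) \<longrightarrow>
      block_integral (F \<union> - F) p g = c * block_integral F (p - real (card (- F))) g"
      using block_integral_Un[of F "- F" p] by auto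
    have "block_integral (F \<union> - F) p (\<lambda>X. ennreal ((X $ a $ b)\<^sup>2)) = c * block_integral F (p - real (card (- F))) (\<lambda>X. ennreal ((X $ a $ b)\<^sup>2))"
      using ab by (intro c[rule_format] m) auto
    moreover have "block_integral (F \<union> - F) p (\<lambda>_. 1) = c * block_integral F (p - real (card (- F))) (\<lambda>_. 1)"
      by (intro c[rule_format]) auto
    ultimately show ?thesis using r unfolding cc by (simp add: mult_ac)
  qed
  show "block_integral UNIV p (\<lambda>X. ennreal ((X $ i $ i)\<^sup>2))
      = ennreal (1 / ((m - 1) * (m - 3))) * block_integral (UNIV :: 'n set) p (\<lambda>_. 1)"
    using p block_integral_diagonal_square[of "m + 1" i] by (intro *[of _ "{i}"]) (auto simp: m_def)
  assume ij: "i \<noteq> j"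
  show "block_integral UNIV p (\<lambda>X. ennreal ((X $ i $ j)\<^sup>2))
      = ennreal (1 / (m * (m - 1) * (m - 3))) * block_integral (UNIV :: 'n set) p (\<lambda>_. 1)"
    using p ij block_integral_offdiagonal_square[of "m + 2" i j] by (intro *[of _ "{j, i}"]) (auto simp: m_def)
qed

section \<open>Mass, covariance and second moments of inverse-Wishart laws\<close>

definition iw_const :: "real^'n^'n \<Rightarrow> real \<Rightarrow> real" where
  "iw_const \<Psi> p = det \<Psi> powr (p / 2) / (2 powr (p * CARD('n) / 2) * multivariate_Gamma CARD('n) (p / 2))"

lemma sets_sym_lborel [measurable_cong, simp]: "sets sym_lborel = sets borel"
  by (simp add: sym_lborel_def)

lemma space_sym_lborel [simp]: "space sym_lborel = UNIV"
  by (simp add: sym_lborel_def)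

lemma inverse_wishart_altdef:
  fixes \<Psi> :: "real^'n::{finite,linorder}^'n::_" and p :: real
  shows "inverse_wishart \<Psi> p = density (restrict_space sym_lborel spd)
    (\<lambda>X. ennreal (iw_const \<Psi> p * iw_kernel ((p + CARD('n) + 1) / 2) \<Psi> X))"
proof -
  have "inverse_wishart_density \<Psi> p X = iw_const \<Psi> p * iw_kernel ((p + CARD('n) + 1) / 2) \<Psi> X" if "X \<in> spd" for X
    unfolding inverse_wishart_density_def iw_kernel_def iw_const_def Let_def using that
    by (simp only: if_True mult.assoc minus_divide_left) simp
  then show ?thesis
    unfolding inverse_wishart_def density_def
    by (intro arg_cong[of _ _ "measure_of _ _"] ext nn_integral_cong) (simp add: space_restrict_space)
qed

lemma sets_inverse_wishart [measurable_cong, simp]: "sets (inverse_wishart \<Psi> p) = sets (restrict_space borel spd)"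
  unfolding inverse_wishart_def by (simp add: sets_restrict_space)

lemma space_inverse_wishart [simp]: "space (inverse_wishart \<Psi> p) = spd"
  unfolding inverse_wishart_def by (simp add: space_restrict_space)

lemma nn_integral_inverse_wishart:
  fixes \<Psi> :: "real^'n::{finite,linorder}^'n::_"
  assumes f [measurable]: "f \<in> borel_measurable borel"
  shows "(\<integral>\<^sup>+X. f X \<partial>inverse_wishart \<Psi> p) =
    ennreal (iw_const \<Psi> p) * (\<integral>\<^sup>+X. ennreal (iw_kernel ((p + CARD('n) + 1) / 2) \<Psi> X) * f X \<partial>sym_lborel)"
proof -
  let ?k = "iw_kernel ((p + CARD('n) + 1) / 2) \<Psi>"
  have [measurable]: "f \<in> borel_measurable (restrict_space sym_lborel spd)" "?k \<in> borel_measurable (restrict_space sym_lborel spd)"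
    by (rule measurable_restrict_space1; measurable)+
  have "(\<integral>\<^sup>+X. f X \<partial>inverse_wishart \<Psi> p) = (\<integral>\<^sup>+X. ennreal (iw_const \<Psi> p * ?k X) * f X \<partial>restrict_space sym_lborel spd)"
    unfolding inverse_wishart_altdef by (rule nn_integral_density) measurable
  also have "\<dots> = (\<integral>\<^sup>+X. ennreal (iw_const \<Psi> p * ?k X) * f X * indicator spd X \<partial>sym_lborel)"
    by (rule nn_integral_restrict_space) simp
  also have "\<dots> = (\<integral>\<^sup>+X. ennreal (iw_const \<Psi> p) * (ennreal (?k X) * f X) \<partial>sym_lborel)"
    by (intro nn_integral_cong) (auto simp: indicator_def iw_kernel_def ennreal_mult'' mult.assoc)
  also have "\<dots> = ennreal (iw_const \<Psi> p) * (\<integral>\<^sup>+X. ennreal (?k X) * f X \<partial>sym_lborel)"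
    by (rule nn_integral_cmult) measurable
  finally show ?thesis .
qed

lemma block_integral_UNIV:
  fixes g :: "real^'n::{finite,linorder}^'n::_ \<Rightarrow> ennreal"
  assumes [measurable]: "g \<in> borel_measurable borel"
  shows "block_integral UNIV p g = (\<integral>\<^sup>+X. ennreal (iw_kernel ((p + CARD('n) + 1) / 2) (mat 1) X) * g X \<partial>sym_lborel)"
proof -
  have "upper_pairs (UNIV :: 'n set) = {(i, j). i \<le> j}" by (simp add: upper_pairs_def)
  then show ?thesis
    unfolding block_integral_def sym_leb_eq[symmetric]
    by (subst sym.nn_integral_leb) (auto simp: block_matrix_UNIV)
qed

lemma multivariate_Gamma_pos:
  assumes "a > (real n - 1) / 2"
  shows "multivariate_Gamma n a > 0"
  unfolding multivariate_Gamma_def using assms by (intro mult_pos_pos prod_pos Gamma_real_pos) auto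

lemma inverse_wishart_standard_total_mass:
  assumes "p > real CARD('n) - 1"
  shows "(\<integral>\<^sup>+X. 1 \<partial>inverse_wishart (mat 1 :: real^'n::{finite,linorder}^'n::_) p) = 1"
proof -
  have "multivariate_Gamma CARD('n) (p / 2) > 0" using assms by (intro multivariate_Gamma_pos) simp
  then have Z: "2 powr (p * real CARD('n) / 2) * multivariate_Gamma CARD('n) (p / 2) > 0" (is "?Z > 0") by simp
  have "(\<integral>\<^sup>+X. 1 \<partial>inverse_wishart (mat 1 :: 'n square) p) =
      ennreal (iw_const (mat 1 :: 'n square) p) * block_integral (UNIV :: 'n set) p (\<lambda>_. 1)"
    unfolding block_integral_UNIV[OF borel_measurable_const] by (rule nn_integral_inverse_wishart) simp
  also have "block_integral (UNIV :: 'n set) p (\<lambda>_. 1) = ennreal ?Z"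
    using block_integral_one[of "UNIV :: 'n set" p] assms by simp
  also have "ennreal (iw_const (mat 1 :: 'n square) p) * ennreal ?Z = ennreal (1 / ?Z * ?Z)"
    using Z by (subst ennreal_mult) (simp_all add: iw_const_def)
  also have "1 / ?Z * ?Z = 1"
    using less_imp_neq[OF Z] by (simp only: times_divide_eq_left mult_1 divide_self_if) simp
  finally show ?thesis by simp
qed

lemma det_congruence: "det (B ** X ** transpose B) = (det B)\<^sup>2 * det (X :: real^'n^'n)"
  by (simp add: det_mul power2_eq_square)

lemma iw_kernel_congruence:
  fixes B :: "real^'n^'n"
  assumes B: "invertible B"
  shows "iw_kernel a (B ** \<Psi> ** transpose B) (B ** X ** transpose B) = ((det B)\<^sup>2) powr (- a) * iw_kernel a \<Psi> X"
proof (cases "X \<in> spd")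
  case False
  then show ?thesis using spd_congruence_iff[OF B] by (simp add: iw_kernel_def)
next
  case X: True
  let ?Bi = "matrix_inv B"
  note I = matrix_inv_mult[OF B]
  note IX = matrix_inv_mult[OF spd_imp_invertible[OF X]]
  have t: "transpose B ** transpose ?Bi = mat 1"
    by (simp add: matrix_transpose_mul[symmetric] I)
  have "(B ** X ** transpose B) ** (transpose ?Bi ** matrix_inv X ** ?Bi) =
      B ** (X ** (transpose B ** transpose ?Bi) ** matrix_inv X) ** ?Bi"
    by (simp add: matrix_mul_assoc)
  also have "\<dots> = mat 1" by (simp add: t IX I)
  finally have inv: "matrix_inv (B ** X ** transpose B) = transpose ?Bi ** matrix_inv X ** ?Bi"
    by (rule matrix_inv_unique)
  have "(B ** \<Psi> ** transpose B) ** matrix_inv (B ** X ** transpose B) =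
     B ** \<Psi> ** (transpose B ** transpose ?Bi) ** matrix_inv X ** ?Bi"
    unfolding inv by (simp add: matrix_mul_assoc)
  also have "\<dots> = B ** (\<Psi> ** matrix_inv X ** ?Bi)" by (simp add: t matrix_mul_assoc)
  also have "trace \<dots> = trace (\<Psi> ** matrix_inv X ** ?Bi ** B)" by (rule trace_mul_sym)
  also have "\<dots> = trace (\<Psi> ** matrix_inv X)" by (simp add: matrix_mul_assoc[symmetric] I)
  finally show ?thesis
    using X spd_congruence_iff[OF B] spd_det_pos[OF X] by (simp add: iw_kernel_def det_congruence powr_mult)
qed

text \<open>
  The factor by which the image of an inverse-Wishart law under the congruence by \<open>B\<close> could differ from the
  expected law: the scaling of the coordinate measure against the power of the determinant in the
  density. It involves neither the scale matrix nor \<open>p\<close>, and is shown to be one.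
\<close>

definition push_ratio :: "real^'n::{finite,linorder}^'n::_ \<Rightarrow> real" where
  "push_ratio B = sym.scale (\<lambda>X. B ** X ** transpose B) * ((det B)\<^sup>2) powr ((CARD('n) + 1) / 2)"

lemma measurable_congruence [measurable]:
  "(\<lambda>X. B ** X ** transpose (B :: real^'n^'n)) \<in> borel_measurable borel"
  by (rule linear_borel_measurable[OF linear_congruence])

lemma nn_integral_inverse_wishart_push_ratio:
  fixes B :: "real^'n::{finite,linorder}^'n::_"
  assumes B: "invertible B" and \<Psi>: "\<Psi> \<in> spd" and f [measurable]: "f \<in> borel_measurable borel"
  shows "(\<integral>\<^sup>+X. f (B ** X ** transpose B) \<partial>inverse_wishart \<Psi> p) =
    ennreal (push_ratio B) * (\<integral>\<^sup>+X. f X \<partial>inverse_wishart (B ** \<Psi> ** transpose B) p)"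
proof -
  let ?a = "(p + CARD('n) + 1) / 2" and ?L = "\<lambda>X. B ** X ** transpose B" and ?s = "sym.scale (\<lambda>X. B ** X ** transpose B)"
  let ?b = "(det B)\<^sup>2"
  have b: "?b > 0" using B invertible_det_nz[of B] by simp
  have s: "?s > 0" by (rule sym.scale_pos[OF sym_automorphism[OF B]])
  define I where "I = (\<integral>\<^sup>+X. ennreal (iw_kernel ?a \<Psi> X) * f (?L X) \<partial>sym_lborel)"
  define I' where "I' = (\<integral>\<^sup>+X. ennreal (iw_kernel ?a (?L \<Psi>) X) * f X \<partial>sym_lborel)"
  have "ennreal (?b powr - ?a) * I = (\<integral>\<^sup>+X. ennreal (?b powr - ?a) * (ennreal (iw_kernel ?a \<Psi> X) * f (?L X)) \<partial>sym_lborel)"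
    unfolding I_def by (rule nn_integral_cmult[symmetric]) measurable
  also have "\<dots> = (\<integral>\<^sup>+X. ennreal (iw_kernel ?a (?L \<Psi>) (?L X)) * f (?L X) \<partial>sym_lborel)"
    by (simp add: iw_kernel_congruence[OF B] ennreal_mult iw_kernel_nonneg mult.assoc)
  also have "\<dots> = ennreal ?s * I'"
    unfolding I'_def sym_leb_eq[symmetric]
    by (rule sym.nn_integral_automorphism[OF sym_automorphism[OF B], of "\<lambda>X. ennreal (iw_kernel ?a (?L \<Psi>) X) * f X"]) measurable
  finally have "ennreal (?b powr ?a) * (ennreal (?b powr - ?a) * I) = ennreal (?b powr ?a) * (ennreal ?s * I')" by simp
  then have I: "I = ennreal (?b powr ?a * ?s) * I'"
    using b s by (simp add: mult.assoc[symmetric] ennreal_mult[symmetric] powr_add[symmetric])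
  have c: "iw_const (?L \<Psi>) p = iw_const \<Psi> p * ?b powr (p / 2)"
    using b spd_det_pos[OF \<Psi>] by (simp add: iw_const_def det_congruence powr_mult)
  have r: "?b powr ?a * ?s = push_ratio B * ?b powr (p / 2)"
  proof -
    have "?b powr ?a = ?b powr ((CARD('n) + 1) / 2) * ?b powr (p / 2)"
      using powr_add[of ?b "(CARD('n) + 1) / 2" "p / 2"] by (simp add: field_simps)
    then show ?thesis by (simp add: push_ratio_def)
  qed
  have "push_ratio B \<ge> 0" using s by (simp add: push_ratio_def)
  have "(\<integral>\<^sup>+X. f (?L X) \<partial>inverse_wishart \<Psi> p) = ennreal (iw_const \<Psi> p) * I"
    unfolding I_def by (rule nn_integral_inverse_wishart) measurable
  also have "\<dots> = ennreal (push_ratio B) * (ennreal (iw_const (?L \<Psi>) p) * I')"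
    unfolding I r c using \<open>push_ratio B \<ge> 0\<close> by (simp add: ennreal_mult'' ennreal_mult' mult_ac)
  also have "ennreal (iw_const (?L \<Psi>) p) * I' = (\<integral>\<^sup>+X. f X \<partial>inverse_wishart (?L \<Psi>) p)"
    unfolding I'_def by (rule nn_integral_inverse_wishart[symmetric]) measurable
  finally show ?thesis .
qed

lemma push_ratio_mult:
  fixes B C :: "real^'n::{finite,linorder}^'n::_"
  assumes B: "invertible B" and C: "invertible C"
  shows "push_ratio (B ** C) = push_ratio B * push_ratio C"
proof -
  have "(\<lambda>X. (B ** C) ** X ** transpose (B ** C)) = (\<lambda>X. B ** (C ** X ** transpose C) ** transpose B)"
    by (rule ext) (rule congruence_mult)
  then have "sym.scale (\<lambda>X. (B ** C) ** X ** transpose (B ** C)) =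
      sym.scale (\<lambda>X. B ** X ** transpose B) * sym.scale (\<lambda>X. C ** X ** transpose C)"
    using sym.scale_comp[OF sym_automorphism[OF B] sym_automorphism[OF C]] by simp
  then show ?thesis by (simp add: push_ratio_def det_mul power_mult_distrib powr_mult)
qed

lemma push_ratio_spd:
  fixes S :: "real^'n::{finite,linorder}^'n::_"
  assumes S: "S \<in> spd"
  shows "push_ratio S = 1"
proof -
  obtain U d where U: "orthogonal_matrix U" and d: "\<And>i. d i > 0" and S': "S = U ** diag d ** transpose U"
    using spd_diagonalization[OF S] by metis
  have det: "det S > 0" by (rule spd_det_pos[OF S])
  have "((det S)\<^sup>2) powr ((CARD('n) + 1) / 2) = (det S powr 2) powr ((CARD('n) + 1) / 2)"
    using powr_realpow[OF det, of 2] by simp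
  also have "\<dots> = det S powr (real (CARD('n) + 1))"
    unfolding powr_powr by (simp add: add_divide_distrib)
  also have "\<dots> = det S ^ (CARD('n) + 1)" by (rule powr_realpow[OF det])
  finally have "((det S)\<^sup>2) powr ((CARD('n) + 1) / 2) = det S ^ (CARD('n) + 1)" .
  moreover have "sym.scale (\<lambda>X. S ** X ** transpose S) = 1 / det S ^ (CARD('n) + 1)"
    unfolding S' by (rule sym_scale_diag_conjugate[OF U d])
  ultimately show ?thesis using det by (simp add: push_ratio_def)
qed

text \<open>
  The congruence fixes the standard law up to this factor, and that law has mass one. Any admissible
  value of \<open>p\<close> serves, for instance the dimension.
\<close>

lemma push_ratio_orthogonal:
  fixes U :: "real^'n::{finite,linorder}^'n::_"
  assumes U: "orthogonal_matrix U"
  shows "push_ratio U = 1"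
proof -
  have inv: "invertible U" using U unfolding invertible_def orthogonal_matrix_def by blast
  have "(\<integral>\<^sup>+X. 1 \<partial>inverse_wishart (mat 1 :: 'n square) (real CARD('n))) =
    ennreal (push_ratio U) * (\<integral>\<^sup>+X. 1 \<partial>inverse_wishart (U ** mat 1 ** transpose U) (real CARD('n)))"
    using nn_integral_inverse_wishart_push_ratio[OF inv spd_mat_1, of "\<lambda>_. 1" "real CARD('n)"] by simp
  moreover have "U ** mat 1 ** transpose U = mat 1" using U by (simp add: orthogonal_matrix_def)
  ultimately have "1 = ennreal (push_ratio U)"
    using inverse_wishart_standard_total_mass[where 'n = 'n, of "real CARD('n)"] by (simp del: nn_integral_const)
  then show ?thesis by (metis ennreal_eq_1)
qed

text \<open>
  Polar decomposition: \<open>B\<close> is the positive definite matrix \<open>P\<close> times an orthogonal one.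
\<close>

lemma push_ratio_invertible:
  fixes B :: "real^'n::{finite,linorder}^'n::_"
  assumes B: "invertible B"
  shows "push_ratio B = 1"
proof -
  define P where "P = spd_sqrt (B ** transpose B)"
  have "B ** transpose B \<in> spd" using spd_congruence[OF spd_mat_1 B] by simp
  then have P: "P \<in> spd" "P ** P = B ** transpose B" unfolding P_def by (auto simp: spd_sqrt_works)
  have Pi: "matrix_inv P \<in> spd" by (rule spd_matrix_inv[OF P(1)])
  note I = matrix_inv_mult[OF spd_imp_invertible[OF P(1)]]
  define U where "U = matrix_inv P ** B"
  have "U ** transpose U = matrix_inv P ** (P ** P) ** matrix_inv P"
    unfolding P(2) U_def using Pi by (simp add: matrix_transpose_mul spd_transpose matrix_mul_assoc)
  also have "\<dots> = (matrix_inv P ** P) ** (P ** matrix_inv P)" by (simp add: matrix_mul_assoc)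
  also have "\<dots> = mat 1" by (simp add: I)
  finally have "orthogonal_matrix U"
    using matrix_left_right_inverse orthogonal_matrix_def by blast
  moreover have "B = P ** U" by (simp add: U_def matrix_mul_assoc I)
  moreover have "invertible U" using B Pi by (simp add: U_def invertible_mult spd_imp_invertible)
  ultimately show ?thesis
    using push_ratio_mult[of P U] push_ratio_spd[OF P(1)] push_ratio_orthogonal spd_imp_invertible[OF P(1)] by simp
qed

theorem nn_integral_inverse_wishart_congruence:
  fixes B :: "real^'n::{finite,linorder}^'n::_"
  assumes "invertible B" "\<Psi> \<in> spd" "f \<in> borel_measurable borel"
  shows "(\<integral>\<^sup>+X. f X \<partial>inverse_wishart (B ** \<Psi> ** transpose B) p) = (\<integral>\<^sup>+X. f (B ** X ** transpose B) \<partial>inverse_wishart \<Psi> p)"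
  using nn_integral_inverse_wishart_push_ratio[OF assms] push_ratio_invertible[OF assms(1)] by simp

lemma measurable_inverse_wishart_congruence:
  fixes B :: "real^'n::{finite,linorder}^'n::_"
  assumes B: "invertible B"
  shows "(\<lambda>X. B ** X ** transpose B) \<in> inverse_wishart \<Psi> p \<rightarrow>\<^sub>M inverse_wishart \<Phi> q"
proof -
  have "(\<lambda>X. B ** X ** transpose B) \<in> restrict_space borel spd \<rightarrow>\<^sub>M restrict_space borel spd"
    using spd_congruence[OF _ B]
    by (intro measurable_restrict_space3) auto
  then show ?thesis by (simp add: measurable_cong_sets[OF sets_inverse_wishart sets_inverse_wishart])
qed

theorem distr_inverse_wishart_congruence:
  fixes B :: "real^'n::{finite,linorder}^'n::_"
  assumes B: "invertible B" and \<Psi>: "\<Psi> \<in> spd"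
  shows "distr (inverse_wishart \<Psi> p) (inverse_wishart (B ** \<Psi> ** transpose B) p) (\<lambda>X. B ** X ** transpose B)
    = inverse_wishart (B ** \<Psi> ** transpose B) p"
proof (rule measure_eqI)
  let ?M = "inverse_wishart \<Psi> p" and ?N = "inverse_wishart (B ** \<Psi> ** transpose B) p" and ?L = "\<lambda>X. B ** X ** transpose B"
  fix A assume "A \<in> sets (distr ?M ?N ?L)"
  then have A: "A \<in> sets ?N" by simp
  then have Ab [measurable]: "A \<in> sets borel" by (auto simp: sets_restrict_space)
  note L = measurable_inverse_wishart_congruence[OF B, of \<Psi> p "B ** \<Psi> ** transpose B" p]
  have "emeasure ?N A = (\<integral>\<^sup>+X. indicator A X \<partial>?N)" using A by simp
  also have "\<dots> = (\<integral>\<^sup>+X. indicator A (?L X) \<partial>?M)"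
    by (rule nn_integral_inverse_wishart_congruence[OF B \<Psi>]) measurable
  also have "\<dots> = (\<integral>\<^sup>+X. indicator (?L -` A \<inter> space ?M) X \<partial>?M)"
    by (intro nn_integral_cong) (simp add: indicator_def)
  also have "\<dots> = emeasure (distr ?M ?N ?L) A"
    using measurable_sets[OF L A] by (simp add: emeasure_distr[OF L A])
  finally show "emeasure (distr ?M ?N ?L) A = emeasure ?N A" by simp
qed simp

theorem prob_space_inverse_wishart:
  fixes \<Psi> :: "real^'n::{finite,linorder}^'n::_"
  assumes \<Psi>: "\<Psi> \<in> spd" and p: "p > real CARD('n) - 1"
  shows "prob_space (inverse_wishart \<Psi> p)"
proof -
  let ?B = "spd_sqrt \<Psi>"
  have B: "?B \<in> spd" "?B ** mat 1 ** transpose ?B = \<Psi>" using spd_sqrt_works[OF \<Psi>] by (auto simp: spd_transpose)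
  have "(\<integral>\<^sup>+X. 1 \<partial>inverse_wishart \<Psi> p) = 1"
    using nn_integral_inverse_wishart_congruence[OF spd_imp_invertible[OF B(1)] spd_mat_1, of "\<lambda>_. 1" p]
      inverse_wishart_standard_total_mass[OF p] unfolding B(2) by simp
  then show ?thesis by (intro prob_spaceI) simp
qed

lemma inverse_wishart_standard_entry_moments:
  fixes i j :: "'n::{finite,linorder}"
  assumes p: "p > real CARD('n) + 3"
  defines "m \<equiv> p - real CARD('n)"
  shows "(\<integral>\<^sup>+X. ennreal ((X $ i $ j)\<^sup>2) \<partial>inverse_wishart (mat 1 :: real^'n::{finite,linorder}^'n::_) p)
    = ennreal ((if i = j then m else 1) / (m * (m - 1) * (m - 3)))"
proof -
  let ?c = "ennreal (iw_const (mat 1 :: 'n square) p)"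
  have m: "m > 3" using p by (simp add: m_def)
  have mm [measurable]: "(\<lambda>X :: 'n square. ennreal ((X $ i $ j)\<^sup>2)) \<in> borel_measurable borel"
    using matrix_entry_measurable[of i j] by measurable
  have 1: "block_integral UNIV p (\<lambda>X. ennreal ((X $ i $ j)\<^sup>2)) =
    ennreal ((if i = j then m else 1) / (m * (m - 1) * (m - 3))) * block_integral (UNIV :: 'n set) p (\<lambda>_. 1)"
    using block_integral_UNIV_squares(1)[OF p, of i] block_integral_UNIV_squares(2)[OF p, of i j] m by (cases "i = j") (simp_all add: m_def)
  have eq: "(\<integral>\<^sup>+X. g X \<partial>inverse_wishart (mat 1 :: 'n square) p) =
      ?c * block_integral UNIV p g"
    if "g \<in> borel_measurable borel" for g
    unfolding block_integral_UNIV[OF that] by (rule nn_integral_inverse_wishart[OF that])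
  have 2: "?c * block_integral (UNIV :: 'n set) p (\<lambda>_. 1) = 1"
    using eq[of "\<lambda>_. 1"] inverse_wishart_standard_total_mass[where 'n = 'n, of p] p by (simp del: nn_integral_const)
  have "(\<integral>\<^sup>+X. ennreal ((X $ i $ j)\<^sup>2) \<partial>inverse_wishart (mat 1 :: 'n square) p) =
      ?c * block_integral UNIV p (\<lambda>X. ennreal ((X $ i $ j)\<^sup>2))"
    by (rule eq[OF mm])
  then show ?thesis
    by (simp only: 1 2 mult.left_commute[of "?c"] mult_1_right)
qed

lemma norm_matrix_sq: "(norm (X :: real^'n^'n))\<^sup>2 = (\<Sum>i\<in>UNIV. \<Sum>j\<in>UNIV. (X $ i $ j)\<^sup>2)"
  unfolding power2_norm_eq_inner inner_vec_def by (simp add: power2_eq_square)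

lemma norm_orthogonal_congruence:
  fixes U X :: "real^'n^'n"
  assumes U: "orthogonal_matrix U"
  shows "norm (U ** X ** transpose U) = norm X"
proof -
  have "(norm (U ** X ** transpose U))\<^sup>2 = trace (U ** transpose X ** (transpose U ** U) ** X ** transpose U)"
    unfolding power2_norm_eq_inner inner_matrix_eq_trace by (simp add: matrix_transpose_mul matrix_mul_assoc)
  also have "\<dots> = trace (U ** (transpose X ** X ** transpose U))"
    using U by (simp add: orthogonal_matrix_def matrix_mul_assoc)
  also have "\<dots> = trace (transpose X ** X ** (transpose U ** U))"
    by (subst trace_mul_sym) (simp add: matrix_mul_assoc)
  also have "\<dots> = (norm X)\<^sup>2"
    unfolding power2_norm_eq_inner inner_matrix_eq_trace using U by (simp add: orthogonal_matrix_def)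
  finally show ?thesis by (simp add: power2_eq_iff_nonneg)
qed

definition iw_second_moment :: "real \<Rightarrow> real^'n^'n \<Rightarrow> real" where
  "iw_second_moment p \<Psi> = (let m = p - real CARD('n) in
     ((m - 1) * (norm \<Psi>)\<^sup>2 + (trace \<Psi>)\<^sup>2) / (m * (m - 1) * (m - 3)))"

text \<open>
  Diagonalise \<open>\<Psi> = U D U\<^sup>T\<close> and write \<open>X = (U D\<^sup>1\<^sup>/\<^sup>2) W (U D\<^sup>1\<^sup>/\<^sup>2)\<^sup>T\<close> with \<open>W\<close> standard. Then \<open>\<bar>X\<bar>\<^sup>2\<close> is the sum of
  \<open>d\<^sub>i d\<^sub>j W\<^sub>i\<^sub>j\<^sup>2\<close>, so only the squares of the entries of \<open>W\<close> are needed and no mixed moments.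
\<close>

theorem inverse_wishart_second_moment:
  fixes \<Psi> :: "real^'n::{finite,linorder}^'n::_"
  assumes \<Psi>: "\<Psi> \<in> spd" and p: "p > real CARD('n) + 3"
  shows "(\<integral>\<^sup>+X. ennreal ((norm X)\<^sup>2) \<partial>inverse_wishart \<Psi> p) = ennreal (iw_second_moment p \<Psi>)"
proof -
  define m where "m = p - real CARD('n)"
  define c where "c = 1 / (m * (m - 1) * (m - 3))"
  have m: "m > 3" using p by (simp add: m_def)
  have c: "c > 0" using m by (simp add: c_def)
  obtain U d where U: "orthogonal_matrix U" and d: "\<And>i. d i > 0" and \<Psi>': "\<Psi> = U ** diag d ** transpose U"
    using spd_diagonalization[OF \<Psi>] by metis
  let ?D = "diag (\<lambda>i. sqrt (d i))"
  let ?B = "U ** ?D"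
  have "invertible U" using U unfolding invertible_def orthogonal_matrix_def by blast
  moreover have "invertible ?D" using d by (simp add: diag_spd_iff spd_imp_invertible)
  ultimately have B: "invertible ?B" by (rule invertible_mult)
  have B\<Psi>: "?B ** mat 1 ** transpose ?B = \<Psi>"
  proof -
    have "?B ** mat 1 ** transpose ?B = U ** (?D ** ?D) ** transpose U"
      by (simp add: matrix_transpose_mul matrix_mul_assoc)
    then show ?thesis using d by (simp add: diag_mult \<Psi>' less_imp_le)
  qed
  have nrm: "(norm (?B ** X ** transpose ?B))\<^sup>2 = (\<Sum>i\<in>UNIV. \<Sum>j\<in>UNIV. (d i * d j) * (X $ i $ j)\<^sup>2)" for X
  proof -
    have "norm (?B ** X ** transpose ?B) = norm (?D ** X ** ?D)"
      using norm_orthogonal_congruence[OF U, of "?D ** X ** ?D"] by (simp add: congruence_mult)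
    moreover have "(?D ** X ** ?D) $ i $ j = sqrt (d i) * sqrt (d j) * X $ i $ j" for i j
      by (simp add: matrix_matrix_mult_def diag_def if_distrib[of "\<lambda>y. y * _"] if_distrib[of "\<lambda>y. _ * y"] cong: if_cong)
    ultimately show ?thesis using d by (simp add: norm_matrix_sq power_mult_distrib less_imp_le)
  qed
  have [measurable]: "(\<lambda>X :: 'n square. X $ i $ j) \<in> borel_measurable (inverse_wishart (mat 1) p)" for i j
    by (subst measurable_cong_sets[OF sets_inverse_wishart refl]) (rule measurable_restrict_space1[OF matrix_entry_measurable])
  have mom: "(\<integral>\<^sup>+X. ennreal ((X $ i $ j)\<^sup>2) \<partial>inverse_wishart (mat 1 :: 'n square) p)
      = ennreal ((if i = j then m else 1) * c)" for i j
    unfolding inverse_wishart_standard_entry_moments[OF p] by (simp add: m_def c_def)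
  have "(\<integral>\<^sup>+X. ennreal ((norm X)\<^sup>2) \<partial>inverse_wishart \<Psi> p) = (\<integral>\<^sup>+X. ennreal ((norm (?B ** X ** transpose ?B))\<^sup>2) \<partial>inverse_wishart (mat 1) p)"
    using nn_integral_inverse_wishart_congruence[OF B spd_mat_1, of "\<lambda>X. ennreal ((norm X)\<^sup>2)" p] unfolding B\<Psi> by simp
  also have "\<dots> = (\<integral>\<^sup>+X. (\<Sum>i\<in>UNIV. \<Sum>j\<in>UNIV. ennreal (d i * d j) * ennreal ((X $ i $ j)\<^sup>2)) \<partial>inverse_wishart (mat 1) p)"
    unfolding nrm using d by (simp add: sum_ennreal[symmetric] sum_nonneg ennreal_mult less_imp_le)
  also have "\<dots> = (\<Sum>i\<in>UNIV. \<Sum>j\<in>UNIV. ennreal (d i * d j) * ennreal ((if i = j then m else 1) * c))"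
    by (simp add: nn_integral_sum nn_integral_cmult mom)
  also have "\<dots> = ennreal (\<Sum>i\<in>UNIV. \<Sum>j\<in>UNIV. (d i * d j) * ((if i = j then m else 1) * c))"
    using d m c by (simp add: sum_ennreal[symmetric] sum_nonneg ennreal_mult less_imp_le)
  also have "(\<Sum>i\<in>UNIV. \<Sum>j\<in>UNIV. (d i * d j) * ((if i = j then m else 1) * c)) = c * ((m - 1) * (\<Sum>i\<in>UNIV. (d i)\<^sup>2) + (\<Sum>i\<in>UNIV. d i)\<^sup>2)"
  proof -
    have "(d i * d j) * ((if i = j then m else 1) * c) = c * (d i * d j) + (if i = j then c * (m - 1) * (d i)\<^sup>2 else 0)" for i j
      by (simp add: power2_eq_square algebra_simps)
    note eq = this
    have 1: "(\<Sum>i\<in>UNIV. \<Sum>j\<in>UNIV. c * (d i * d j)) = c * (\<Sum>i\<in>UNIV. d i)\<^sup>2"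
      unfolding power2_eq_square sum_product by (simp only: sum_distrib_left)
    have 2: "(\<Sum>i\<in>UNIV. \<Sum>j\<in>UNIV. if i = j then c * (m - 1) * (d i)\<^sup>2 else 0) = c * (m - 1) * (\<Sum>i\<in>UNIV. (d i)\<^sup>2)"
      by (simp add: sum_distrib_left)
    show ?thesis by (simp only: eq sum.distrib 1 2) (simp add: algebra_simps)
  qed
  also have "(\<Sum>i\<in>UNIV. (d i)\<^sup>2) = (norm \<Psi>)\<^sup>2"
    unfolding \<Psi>' norm_orthogonal_congruence[OF U] by (simp add: norm_matrix_sq diag_def if_distrib[of "\<lambda>x. x\<^sup>2"] cong: if_cong)
  also have "(\<Sum>i\<in>UNIV. d i) = trace \<Psi>"
  proof -
    have "trace \<Psi> = trace (diag d ** (transpose U ** U))"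
      unfolding \<Psi>' by (metis matrix_mul_assoc trace_mul_sym)
    then show ?thesis using U by (simp add: orthogonal_matrix_def trace_def diag_def)
  qed
  finally show ?thesis by (simp add: iw_second_moment_def Let_def c_def m_def)
qed

section \<open>Optimal transport by splitting the cost\<close>

lemma graph_coupling:
  assumes M: "prob_space M" and S: "S \<in> transport_maps M N"
  defines "G \<equiv> distr M (M \<Otimes>\<^sub>M N) (\<lambda>x. (x, S x))"
  shows "G \<in> couplings M N"
    and "c \<in> borel_measurable (M \<Otimes>\<^sub>M N) \<Longrightarrow> (\<integral>\<^sup>+z. c z \<partial>G) = (\<integral>\<^sup>+x. c (x, S x) \<partial>M)"
proof -
  have [measurable]: "S \<in> M \<rightarrow>\<^sub>M N" and push: "distr M N S = N" using S by (auto simp: transport_maps_def)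
  have "prob_space G" unfolding G_def by (rule prob_space.prob_space_distr[OF M]) measurable
  moreover have "distr G M fst = M" "distr G N snd = N"
    unfolding G_def by (subst distr_distr, measurable, simp add: comp_def distr_id2 push)+
  ultimately show "G \<in> couplings M N" by (simp add: couplings_def) (simp add: G_def)
  show "(\<integral>\<^sup>+z. c z \<partial>G) = (\<integral>\<^sup>+x. c (x, S x) \<partial>M)" if "c \<in> borel_measurable (M \<Otimes>\<^sub>M N)"
    unfolding G_def using that by (subst nn_integral_distr) auto
qed

text \<open>
  Kantorovich duality with the dual potentials built in: up to the functions \<open>f\<close>, \<open>g\<close>, \<open>h\<close>, \<open>k\<close> of one variable, the
  cost is a nonnegative remainder \<open>r\<close> whose zero set is the graph of \<open>T\<close>. All terms stay on the side on
  which they are nonnegative, so every integral exists; finiteness of the marginal integrals allows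
  cancellation.
\<close>

theorem transport_by_cost_splitting:
  fixes M :: "'a measure" and N :: "'b measure"
  assumes M: "prob_space M" and T: "T \<in> transport_maps M N"
    and [measurable]: "f \<in> borel_measurable M" "h \<in> borel_measurable M" "g \<in> borel_measurable N" "k \<in> borel_measurable N"
    and c [measurable]: "case_prod c \<in> borel_measurable (M \<Otimes>\<^sub>M N)"
    and r [measurable]: "case_prod r \<in> borel_measurable (M \<Otimes>\<^sub>M N)"
    and split: "\<And>x y. x \<in> space M \<Longrightarrow> y \<in> space N \<Longrightarrow> c x y + (f x + g y) = h x + k y + r x y"
    and zero: "\<And>x y. x \<in> space M \<Longrightarrow> y \<in> space N \<Longrightarrow> r x y = 0 \<longleftrightarrow> y = T x"
    and fin: "(\<integral>\<^sup>+x. f x \<partial>M) \<noteq> \<infinity>" "(\<integral>\<^sup>+y. g y \<partial>N) \<noteq> \<infinity>" "(\<integral>\<^sup>+x. h x \<partial>M) \<noteq> \<infinity>" "(\<integral>\<^sup>+y. k y \<partial>N) \<noteq> \<infinity>"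
  defines "PT \<equiv> distr M (M \<Otimes>\<^sub>M N) (\<lambda>x. (x, T x))"
  shows "kantorovich_cost c M N + ((\<integral>\<^sup>+x. f x \<partial>M) + (\<integral>\<^sup>+y. g y \<partial>N)) = (\<integral>\<^sup>+x. h x \<partial>M) + (\<integral>\<^sup>+y. k y \<partial>N)"
    and "monge_cost c M N = kantorovich_cost c M N"
    and "optimal_monge_map c M N T"
    and "optimal_monge_map c M N S \<Longrightarrow> AE x in M. S x = T x"
    and "optimal_kantorovich_plan c M N PT"
    and "optimal_kantorovich_plan c M N G \<Longrightarrow> G = PT"
proof -
  define F H where "F = (\<integral>\<^sup>+x. f x \<partial>M) + (\<integral>\<^sup>+y. g y \<partial>N)" and "H = (\<integral>\<^sup>+x. h x \<partial>M) + (\<integral>\<^sup>+y. k y \<partial>N)"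
  have FH: "F \<noteq> \<infinity>" "H \<noteq> \<infinity>" using fin by (auto simp: F_def H_def)
  define K where "K G = (\<integral>\<^sup>+z. c (fst z) (snd z) \<partial>G)" for G
  define R where "R G = (\<integral>\<^sup>+z. r (fst z) (snd z) \<partial>G)" for G
  have [measurable]: "T \<in> M \<rightarrow>\<^sub>M N" using T by (simp add: transport_maps_def)
  have c' [measurable]: "(\<lambda>z. c (fst z) (snd z)) \<in> borel_measurable (M \<Otimes>\<^sub>M N)"
    and r' [measurable]: "(\<lambda>z. r (fst z) (snd z)) \<in> borel_measurable (M \<Otimes>\<^sub>M N)"
    using c r by (simp_all add: case_prod_unfold)
  have sp: "space G = space M \<times> space N" if "G \<in> couplings M N" for G
    using sets_eq_imp_space_eq[of G "M \<Otimes>\<^sub>M N"] that by (simp add: couplings_def space_pair_measure)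
  have KR: "K G + F = H + R G" if G: "G \<in> couplings M N" for G
  proof -
    have [measurable_cong]: "sets G = sets (M \<Otimes>\<^sub>M N)" using G by (simp add: couplings_def)
    have m1: "(\<integral>\<^sup>+z. u (fst z) \<partial>G) = (\<integral>\<^sup>+x. u x \<partial>M)" if [measurable]: "u \<in> borel_measurable M" for u :: "'a \<Rightarrow> ennreal"
    proof -
      have "(\<integral>\<^sup>+x. u x \<partial>M) = (\<integral>\<^sup>+x. u x \<partial>distr G M fst)" using G by (simp add: couplings_def)
      also have "\<dots> = (\<integral>\<^sup>+z. u (fst z) \<partial>G)" by (rule nn_integral_distr) measurable
      finally show ?thesis by simp
    qed
    have m2: "(\<integral>\<^sup>+z. u (snd z) \<partial>G) = (\<integral>\<^sup>+x. u x \<partial>N)" if [measurable]: "u \<in> borel_measurable N" for u :: "'b \<Rightarrow> ennreal"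
    proof -
      have "(\<integral>\<^sup>+x. u x \<partial>N) = (\<integral>\<^sup>+x. u x \<partial>distr G N snd)" using G by (simp add: couplings_def)
      also have "\<dots> = (\<integral>\<^sup>+z. u (snd z) \<partial>G)" by (rule nn_integral_distr) measurable
      finally show ?thesis by simp
    qed
    have "K G + F = (\<integral>\<^sup>+z. c (fst z) (snd z) + (f (fst z) + g (snd z)) \<partial>G)"
      unfolding K_def F_def by (simp add: nn_integral_add m1 m2)
    also have "\<dots> = (\<integral>\<^sup>+z. h (fst z) + k (snd z) + r (fst z) (snd z) \<partial>G)"
      by (intro nn_integral_cong split) (auto simp: sp[OF G])
    also have "\<dots> = H + R G"
      unfolding R_def H_def by (simp add: nn_integral_add m1 m2)
    finally show ?thesis .
  qed
  have PT: "PT \<in> couplings M N" unfolding PT_def by (rule graph_coupling(1)[OF M T])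
  have "R PT = (\<integral>\<^sup>+x. r x (T x) \<partial>M)"
    unfolding R_def PT_def using graph_coupling(2)[OF M T r'] by simp
  also have "\<dots> = (\<integral>\<^sup>+x. 0 \<partial>M)"
    using measurable_space[OF \<open>T \<in> M \<rightarrow>\<^sub>M N\<close>] by (intro nn_integral_cong) (auto simp: zero)
  finally have R0: "R PT = 0" by simp
  then have KT: "K PT + F = H" using KR[OF PT] by simp
  have K: "K G = K PT + R G" if "G \<in> couplings M N" for G
  proof -
    have "F + K G = F + (K PT + R G)" using KR[OF that] KT by (simp add: add_ac)
    then show ?thesis using FH by (simp add: ennreal_add_left_cancel)
  qed
  have kant: "kantorovich_cost c M N = K PT"
    unfolding kantorovich_cost_def
  proof (rule antisym)
    show "(INF G\<in>couplings M N. \<integral>\<^sup>+z. c (fst z) (snd z) \<partial>G) \<le> K PT"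
      unfolding K_def by (rule INF_lower[OF PT])
    show "K PT \<le> (INF G\<in>couplings M N. \<integral>\<^sup>+z. c (fst z) (snd z) \<partial>G)"
      using K by (intro INF_greatest) (simp add: K_def)
  qed
  have graph: "K (distr M (M \<Otimes>\<^sub>M N) (\<lambda>x. (x, S x))) = (\<integral>\<^sup>+x. c x (S x) \<partial>M)" if "S \<in> transport_maps M N" for S
    unfolding K_def using graph_coupling(2)[OF M that c'] by simp
  have monge: "monge_cost c M N = K PT"
    unfolding monge_cost_def
  proof (rule antisym)
    show "(INF S\<in>transport_maps M N. \<integral>\<^sup>+x. c x (S x) \<partial>M) \<le> K PT"
      using graph[OF T] unfolding PT_def by (metis INF_lower[OF T])
    show "K PT \<le> (INF S\<in>transport_maps M N. \<integral>\<^sup>+x. c x (S x) \<partial>M)"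
    proof (rule INF_greatest)
      fix S assume S: "S \<in> transport_maps M N"
      show "K PT \<le> (\<integral>\<^sup>+x. c x (S x) \<partial>M)"
        using K[OF graph_coupling(1)[OF M S]] graph[OF S] by simp
    qed
  qed
  have Kfin: "K PT \<noteq> \<infinity>" using KT FH by (metis ennreal_add_eq_top infinity_ennreal_def)
  show "kantorovich_cost c M N + ((\<integral>\<^sup>+x. f x \<partial>M) + (\<integral>\<^sup>+y. g y \<partial>N)) = (\<integral>\<^sup>+x. h x \<partial>M) + (\<integral>\<^sup>+y. k y \<partial>N)"
    using KT unfolding kant F_def H_def .
  show "monge_cost c M N = kantorovich_cost c M N" by (simp add: kant monge)
  show "optimal_monge_map c M N T"
    using graph[OF T] T by (simp add: optimal_monge_map_def monge PT_def)
  show "optimal_kantorovich_plan c M N PT"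
    using PT by (simp add: optimal_kantorovich_plan_def kant) (simp add: K_def)
  have graph_AE: "AE z in G. snd z = T (fst z)" if G: "G \<in> couplings M N" and "K G = K PT" for G
  proof -
    have [measurable_cong]: "sets G = sets (M \<Otimes>\<^sub>M N)" using G by (simp add: couplings_def)
    have "K PT + 0 = K PT + R G" using K[OF G] that(2) by simp
    then have "R G = 0" using Kfin by (simp only: ennreal_add_left_cancel) auto
    then have "AE z in G. r (fst z) (snd z) = 0"
      unfolding R_def by (subst (asm) nn_integral_0_iff_AE) auto
    then show ?thesis
      by (rule AE_mp) (auto simp: sp[OF G] zero intro!: AE_I2)
  qed
  show "AE x in M. S x = T x" if S: "optimal_monge_map c M N S"
  proof -
    have S': "S \<in> transport_maps M N" "(\<integral>\<^sup>+x. c x (S x) \<partial>M) = K PT" using S by (auto simp: optimal_monge_map_def monge)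
    then have [measurable]: "S \<in> M \<rightarrow>\<^sub>M N" by (simp add: transport_maps_def)
    let ?G = "distr M (M \<Otimes>\<^sub>M N) (\<lambda>x. (x, S x))"
    have "K PT + 0 = K PT + R ?G"
      using K[OF graph_coupling(1)[OF M S'(1)]] graph[OF S'(1)] S'(2) by simp
    then have "R ?G = 0" using Kfin by (simp only: ennreal_add_left_cancel) auto
    then have "(\<integral>\<^sup>+x. r x (S x) \<partial>M) = 0"
      unfolding R_def using graph_coupling(2)[OF M S'(1) r'] by simp
    moreover have "(\<lambda>x. r x (S x)) \<in> borel_measurable M"
      using measurable_compose[of "\<lambda>x. (x, S x)" M "M \<Otimes>\<^sub>M N", OF _ r'] by simp
    ultimately have "AE x in M. r x (S x) = 0"
      by (subst (asm) nn_integral_0_iff_AE) auto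
    then show ?thesis
      using measurable_space[OF \<open>S \<in> M \<rightarrow>\<^sub>M N\<close>] by (rule_tac AE_mp) (auto simp: zero intro!: AE_I2)
  qed
  show "G = PT" if opt: "optimal_kantorovich_plan c M N G"
  proof -
    have G: "G \<in> couplings M N" "K G = K PT" using opt by (auto simp: optimal_kantorovich_plan_def kant K_def)
    have [measurable_cong]: "sets G = sets (M \<Otimes>\<^sub>M N)" using G by (simp add: couplings_def)
    have "G = distr G (M \<Otimes>\<^sub>M N) (\<lambda>z. z)" using G by (simp add: distr_id2 couplings_def)
    also have "\<dots> = distr G (M \<Otimes>\<^sub>M N) (\<lambda>z. (fst z, T (fst z)))"
    proof (rule distr_cong_AE)
      show "AE z in G. z = (fst z, T (fst z))" using graph_AE[OF G] by (auto elim!: eventually_mono simp: prod_eq_iff)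
    qed auto
    also have "\<dots> = distr (distr G M fst) (M \<Otimes>\<^sub>M N) (\<lambda>x. (x, T x))"
      by (subst distr_distr) (auto simp: comp_def)
    also have "\<dots> = PT" using G by (simp add: PT_def couplings_def)
    finally show ?thesis .
  qed
qed

lemma inner_congruence_symmetric:
  fixes B X Y :: "real^'n^'n"
  assumes "transpose B = B"
  shows "(B ** X ** B) \<bullet> Y = X \<bullet> (B ** Y ** B)"
proof -
  have "(B ** X ** B) \<bullet> Y = trace (B ** (transpose X ** B ** Y))"
    using assms by (simp add: inner_matrix_eq_trace matrix_transpose_mul matrix_mul_assoc)
  also have "\<dots> = trace (transpose X ** (B ** Y ** B))"
    by (subst trace_mul_sym) (simp add: matrix_mul_assoc)
  finally show ?thesis by (simp add: inner_matrix_eq_trace)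
qed

theorem corollary4:
  fixes \<Sigma>0 \<Sigma>1 :: "real^'n::{finite,linorder}^'n::_" and p :: real
  defines "\<mu>0 \<equiv> inverse_wishart \<Sigma>0 p"
    and "\<mu>1 \<equiv> inverse_wishart \<Sigma>1 p"
    and "m \<equiv> p - real CARD('n)"
    and "C \<equiv> spd_sqrt (spd_sqrt \<Sigma>0 ** \<Sigma>1 ** spd_sqrt \<Sigma>0)"
    and "A \<equiv> matrix_inv (spd_sqrt \<Sigma>0)
                ** spd_sqrt (spd_sqrt \<Sigma>0 ** \<Sigma>1 ** spd_sqrt \<Sigma>0)
                ** matrix_inv (spd_sqrt \<Sigma>0)"
  defines "T \<equiv> (\<lambda>X. A ** X ** A)"
  assumes "\<Sigma>0 \<in> spd" and "\<Sigma>1 \<in> spd" and "p > real CARD('n) + 3"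
  shows
    "(optimal_monge_map frobenius_cost \<mu>0 \<mu>1 T \<and>
      (\<forall>S. optimal_monge_map frobenius_cost \<mu>0 \<mu>1 S \<longrightarrow> (AE X in \<mu>0. S X = T X))) \<and>
     (optimal_kantorovich_plan frobenius_cost \<mu>0 \<mu>1 (distr \<mu>0 (\<mu>0 \<Otimes>\<^sub>M \<mu>1) (\<lambda>X. (X, T X))) \<and>
      (\<forall>G. optimal_kantorovich_plan frobenius_cost \<mu>0 \<mu>1 G \<longrightarrow>
         G = distr \<mu>0 (\<mu>0 \<Otimes>\<^sub>M \<mu>1) (\<lambda>X. (X, T X)))) \<and>
     enn2ereal (kantorovich_cost frobenius_cost \<mu>0 \<mu>1) =
       ereal (1 / (m * (m - 3)) * (norm (\<Sigma>0 - \<Sigma>1))\<^sup>2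
         + 1 / (m * (m - 1) * (m - 3))
           * ((trace \<Sigma>0)\<^sup>2 + (trace \<Sigma>1)\<^sup>2 - 2 * (trace C)\<^sup>2)) \<and>
     monge_cost frobenius_cost \<mu>0 \<mu>1 = kantorovich_cost frobenius_cost \<mu>0 \<mu>1"
proof -
  have S0: "\<Sigma>0 \<in> spd" and S1: "\<Sigma>1 \<in> spd" and p: "p > real CARD('n) + 3" by fact+
  have m: "m > 3" using p by (simp add: m_def)
  \<comment> \<open>\<open>A\<close> solves the Riccati equation \<open>A \<Sigma>0 A = \<Sigma>1\<close>\<close>
  define R where "R = spd_sqrt \<Sigma>0"
  define Ri where "Ri = matrix_inv R"
  have S: "R \<in> spd" "R ** R = \<Sigma>0" unfolding R_def using spd_sqrt_works[OF S0] by auto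
  have Si: "Ri \<in> spd" unfolding Ri_def by (rule spd_matrix_inv[OF S(1)])
  note SI = matrix_inv_mult[OF spd_imp_invertible[OF S(1)], folded Ri_def]
  have SSS: "R ** \<Sigma>1 ** R \<in> spd"
    using spd_congruence[OF S1 spd_imp_invertible[OF S(1)]] by (simp add: spd_transpose[OF S(1)])
  have C: "C \<in> spd" "C ** C = R ** \<Sigma>1 ** R" unfolding C_def R_def[symmetric] using spd_sqrt_works[OF SSS] by auto
  have A_eq: "A = Ri ** C ** Ri" by (simp add: A_def C_def R_def Ri_def)
  have A: "A \<in> spd"
    using spd_congruence[OF C(1) spd_imp_invertible[OF Si]] by (simp add: A_eq spd_transpose[OF Si])
  have "A ** \<Sigma>0 ** A = Ri ** C ** (Ri ** R) ** (R ** Ri) ** C ** Ri"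
    unfolding A_eq S(2)[symmetric] by (simp only: matrix_mul_assoc)
  also have "\<dots> = Ri ** (C ** C) ** Ri" by (simp add: SI matrix_mul_assoc)
  also have "\<dots> = (Ri ** R) ** \<Sigma>1 ** (R ** Ri)" unfolding C(2) by (simp only: matrix_mul_assoc)
  finally have A01: "A ** \<Sigma>0 ** A = \<Sigma>1" by (simp add: SI)
  have "trace (A ** \<Sigma>0) = trace (Ri ** (C ** (Ri ** R) ** R))"
    unfolding A_eq S(2)[symmetric] by (simp only: matrix_mul_assoc)
  also have "\<dots> = trace (C ** (Ri ** R) ** (R ** Ri))"
    by (subst trace_mul_sym) (simp only: matrix_mul_assoc)
  finally have trA: "trace (A ** \<Sigma>0) = trace C" by (simp add: SI)
  define B where "B = spd_sqrt A"
  define Bi where "Bi = matrix_inv B"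
  have B: "B \<in> spd" "B ** B = A" unfolding B_def using spd_sqrt_works[OF A] by auto
  have Bi: "Bi \<in> spd" unfolding Bi_def by (rule spd_matrix_inv[OF B(1)])
  note BI = matrix_inv_mult[OF spd_imp_invertible[OF B(1)], folded Bi_def]
  have tB: "transpose B = B" and tBi: "transpose Bi = Bi" and tA: "transpose A = A"
    using spd_transpose[OF B(1)] spd_transpose[OF Bi] spd_transpose[OF A] by auto
  \<comment> \<open>the common scale matrix of the laws of \<open>B X B\<close> under \<open>\<mu>0\<close> and of \<open>B\<inverse> Y B\<inverse>\<close> under \<open>\<mu>1\<close>\<close>
  let ?O = "B ** \<Sigma>0 ** B"
  have Osp: "?O \<in> spd" using spd_congruence[OF S0 spd_imp_invertible[OF B(1)]] by (simp add: tB)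
  have O1: "Bi ** \<Sigma>1 ** Bi = ?O"
  proof -
    have "Bi ** \<Sigma>1 ** Bi = (Bi ** B) ** B ** \<Sigma>0 ** B ** (B ** Bi)"
      unfolding A01[symmetric] B(2)[symmetric] by (simp only: matrix_mul_assoc)
    then show ?thesis by (simp add: BI)
  qed
  have trO: "trace ?O = trace C"
  proof -
    have "trace ?O = trace (B ** B ** \<Sigma>0)" by (subst trace_mul_sym) (simp only: matrix_mul_assoc)
    then show ?thesis by (simp add: B trA)
  qed
  have nO: "(norm ?O)\<^sup>2 = \<Sigma>0 \<bullet> \<Sigma>1"
  proof -
    have "(norm ?O)\<^sup>2 = \<Sigma>0 \<bullet> (B ** ?O ** B)"
      unfolding power2_norm_eq_inner by (rule inner_congruence_symmetric[OF tB])
    also have "B ** ?O ** B = (B ** B) ** \<Sigma>0 ** (B ** B)" by (simp only: matrix_mul_assoc)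
    finally show ?thesis by (simp add: B A01)
  qed
  define q where "q = (iw_second_moment p :: 'n square \<Rightarrow> real)"
  have q_nonneg: "q X \<ge> 0" for X
    using m by (simp add: q_def iw_second_moment_def Let_def m_def[symmetric])
  let ?f = "\<lambda>X. ennreal ((norm (B ** X ** B))\<^sup>2)" and ?g = "\<lambda>Y. ennreal ((norm (Bi ** Y ** Bi))\<^sup>2)"
  let ?h = "\<lambda>X :: 'n square. ennreal ((norm X)\<^sup>2)"
  let ?r = "\<lambda>X Y. ennreal ((norm (B ** X ** B - Bi ** Y ** Bi))\<^sup>2)"
  have bm: "(\<lambda>X. Q ** X ** Q) \<in> borel_measurable borel" if "transpose Q = Q" for Q :: "'n square"
    using measurable_congruence[of Q] that by simp
  have id0 [measurable]: "(\<lambda>X. X) \<in> borel_measurable \<mu>0" and id1 [measurable]: "(\<lambda>X. X) \<in> borel_measurable \<mu>1"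
    unfolding \<mu>0_def \<mu>1_def
    by (simp_all add: measurable_cong_sets[OF sets_inverse_wishart refl] measurable_restrict_space1)
  have [measurable]: "(\<lambda>X. B ** X ** B) \<in> borel_measurable \<mu>0" "(\<lambda>X. Bi ** X ** Bi) \<in> borel_measurable \<mu>1"
    using measurable_compose[OF id0 bm[OF tB]] measurable_compose[OF id1 bm[OF tBi]] by simp_all
  have int_f: "(\<integral>\<^sup>+X. ?f X \<partial>\<mu>0) = ennreal (q ?O)"
    using nn_integral_inverse_wishart_congruence[OF spd_imp_invertible[OF B(1)] S0, of ?h p]
      inverse_wishart_second_moment[OF Osp p] by (simp add: \<mu>0_def q_def tB)
  have int_g: "(\<integral>\<^sup>+X. ?g X \<partial>\<mu>1) = ennreal (q ?O)"
    using nn_integral_inverse_wishart_congruence[OF spd_imp_invertible[OF Bi] S1, of ?h p]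
      inverse_wishart_second_moment[OF Osp p] by (simp add: \<mu>1_def q_def tBi O1)
  have int_h: "(\<integral>\<^sup>+X. ?h X \<partial>\<mu>0) = ennreal (q \<Sigma>0)" and int_k: "(\<integral>\<^sup>+X. ?h X \<partial>\<mu>1) = ennreal (q \<Sigma>1)"
    using inverse_wishart_second_moment[OF S0 p] inverse_wishart_second_moment[OF S1 p] by (simp_all add: \<mu>0_def \<mu>1_def q_def)
  have prob: "prob_space \<mu>0" unfolding \<mu>0_def using p by (intro prob_space_inverse_wishart S0) simp
  have T: "T \<in> transport_maps \<mu>0 \<mu>1"
    using distr_inverse_wishart_congruence[OF spd_imp_invertible[OF A] S0, of p]
      measurable_inverse_wishart_congruence[OF spd_imp_invertible[OF A], of \<Sigma>0 p \<Sigma>1 p]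
    by (simp add: transport_maps_def T_def \<mu>0_def \<mu>1_def tA A01)
  have split: "frobenius_cost X Y + (?f X + ?g Y) = ?h X + ?h Y + ?r X Y" for X Y
  proof -
    have "(B ** X ** B) \<bullet> (Bi ** Y ** Bi) = X \<bullet> (B ** (Bi ** Y ** Bi) ** B)"
      by (rule inner_congruence_symmetric[OF tB])
    also have "B ** (Bi ** Y ** Bi) ** B = (B ** Bi) ** Y ** (Bi ** B)" by (simp only: matrix_mul_assoc)
    finally have ip: "(B ** X ** B) \<bullet> (Bi ** Y ** Bi) = X \<bullet> Y" by (simp add: BI)
    have "(norm (X - Y))\<^sup>2 + ((norm (B ** X ** B))\<^sup>2 + (norm (Bi ** Y ** Bi))\<^sup>2) =
       (norm X)\<^sup>2 + (norm Y)\<^sup>2 + (norm (B ** X ** B - Bi ** Y ** Bi))\<^sup>2"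
      using ip by (simp add: power2_norm_eq_inner inner_diff_left inner_diff_right inner_commute)
    then show ?thesis by (simp add: frobenius_cost_def ennreal_plus[symmetric] del: ennreal_plus)
  qed
  have zero: "?r X Y = 0 \<longleftrightarrow> Y = T X" for X Y
  proof -
    have "?r X Y = 0 \<longleftrightarrow> B ** X ** B = Bi ** Y ** Bi" by simp
    also have "\<dots> \<longleftrightarrow> B ** (B ** X ** B) ** B = B ** (Bi ** Y ** Bi) ** B"
    proof
      assume *: "B ** (B ** X ** B) ** B = B ** (Bi ** Y ** Bi) ** B"
      have "Z = Bi ** (B ** Z ** B) ** Bi" for Z
      proof -
        have "Bi ** (B ** Z ** B) ** Bi = (Bi ** B) ** Z ** (B ** Bi)" by (simp only: matrix_mul_assoc)
        then show ?thesis by (simp add: BI)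
      qed
      then show "B ** X ** B = Bi ** Y ** Bi" using * by metis
    qed simp
    also have "B ** (B ** X ** B) ** B = (B ** B) ** X ** (B ** B)" by (simp only: matrix_mul_assoc)
    also have "B ** (Bi ** Y ** Bi) ** B = (B ** Bi) ** Y ** (Bi ** B)" by (simp only: matrix_mul_assoc)
    finally show ?thesis by (auto simp: T_def B BI)
  qed
  have cm: "case_prod frobenius_cost \<in> borel_measurable (\<mu>0 \<Otimes>\<^sub>M \<mu>1)"
    unfolding frobenius_cost_def case_prod_unfold
    using measurable_compose[OF measurable_fst id0] measurable_compose[OF measurable_snd id1] by measurable
  have rm: "case_prod ?r \<in> borel_measurable (\<mu>0 \<Otimes>\<^sub>M \<mu>1)"
    unfolding case_prod_unfold by measurable
  have fin: "(\<integral>\<^sup>+X. ?f X \<partial>\<mu>0) \<noteq> \<infinity>" "(\<integral>\<^sup>+X. ?g X \<partial>\<mu>1) \<noteq> \<infinity>" "(\<integral>\<^sup>+X. ?h X \<partial>\<mu>0) \<noteq> \<infinity>" "(\<integral>\<^sup>+X. ?h X \<partial>\<mu>1) \<noteq> \<infinity>"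
    unfolding int_f int_g int_h int_k by simp_all
  have meas: "?f \<in> borel_measurable \<mu>0" "?h \<in> borel_measurable \<mu>0" "?g \<in> borel_measurable \<mu>1" "?h \<in> borel_measurable \<mu>1"
    by measurable
  note main = transport_by_cost_splitting[OF prob T meas cm rm split zero fin]
  have cost: "enn2ereal (kantorovich_cost frobenius_cost \<mu>0 \<mu>1) =
       ereal (1 / (m * (m - 3)) * (norm (\<Sigma>0 - \<Sigma>1))\<^sup>2
         + 1 / (m * (m - 1) * (m - 3))
           * ((trace \<Sigma>0)\<^sup>2 + (trace \<Sigma>1)\<^sup>2 - 2 * (trace C)\<^sup>2))" (is "_ = ereal ?v")
  proof -
    let ?K = "kantorovich_cost frobenius_cost \<mu>0 \<mu>1"
    have sum: "?K + ennreal (2 * q ?O) = ennreal (q \<Sigma>0 + q \<Sigma>1)"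
      using main(1) q_nonneg unfolding int_f int_g int_h int_k
      by (simp add: ennreal_plus[symmetric] del: ennreal_plus)
    then have "?K \<noteq> \<infinity>" by (metis ennreal_add_eq_top ennreal_neq_top infinity_ennreal_def)
    then obtain v where v: "v \<ge> 0" "?K = ennreal v" by (cases ?K) auto
    have "v + 2 * q ?O = q \<Sigma>0 + q \<Sigma>1"
      using sum v q_nonneg by (simp add: ennreal_plus[symmetric] del: ennreal_plus)
    moreover have "q \<Sigma>0 + q \<Sigma>1 - 2 * q ?O = ?v"
    proof -
      have qq: "q X = (1 / (m * (m - 3))) * (norm X)\<^sup>2 + (1 / (m * (m - 1) * (m - 3))) * (trace X)\<^sup>2" for X
        using m unfolding q_def iw_second_moment_def Let_def m_def[symmetric] by (simp add: add_divide_distrib)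
      have "(norm (\<Sigma>0 - \<Sigma>1))\<^sup>2 = (norm \<Sigma>0)\<^sup>2 + (norm \<Sigma>1)\<^sup>2 - 2 * (norm ?O)\<^sup>2"
        using nO by (simp add: power2_norm_eq_inner inner_diff_left inner_diff_right inner_commute)
      then show ?thesis unfolding qq trO by (simp only: ring_distribs)
    qed
    ultimately have "v = ?v" by simp
    then show ?thesis using v by (simp only: enn2ereal_ennreal)
  qed
  show ?thesis
    by (intro conjI allI impI main(3,5) cost main(2); erule main(4) main(6))
qed

end
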